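(* Let $V$ and $W$ be optimal computers, and let $f\colon\mathbb{N}^+\to\mathbb{N}$ be a total recursive function. Then the following two conditions are equivalent: (i) There exist an oracle deterministic Turing machine $M$ and $c\in\mathbb{N}$ such that, for all $n\in\mathbb{N}^+$, $M^{\{\Omega_V\restriction(n-f(n)+c)\}}(n)=\mathrm{Dom}\,W\restriction n$, where the finite set $\mathrm{Dom}\,W\restriction n$ is represented as a finite binary string in a fixed format. (ii) The function $f$ is bounded from above.
   Context: $\{0,1\}^*$ is the set of finite binary strings. A computer is a partial recursive function $C\colon\{0,1\}^*\to\{0,1\}^*$ whose domain $\mathrm{Dom}\,C$ is prefix-free. A computer $U$ is optimal if for every computer $C$ there is $d\in\mathbb{N}$ such that for every $p\in\mathrm{Dom}\,C$ there is $q$ with $U(q)=C(p)$ and $|q|\le|p|+d$. $\Omega_V=\sum_{p\in\mathrm{Dom}\,V}2^{-|p|}$. For $S\subseteq\{0,1\}^*$ and $n\in\mathbb{Z}$, $S\restriction n=\{s\in S:|s|\le n\}$. For a real $\alpha$ and $n\in\mathbb{N}^+$, $\alpha\restriction n$ is the string of the first $n$ bits of the base-two expansion of $\alpha-\lfloor\alpha\rfloor$ (with infinitely many zeros when there is a choice); for integers $n\le0$ it is the empty string. $M^{\{s\}}(n)$ is the output of oracle machine $M$ on input $n$ with oracle the one-element set $\{s\}$. *)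

theory Defs
  imports "HOL-Analysis.Analysis" "HOL-Library.Sublist"
begin

datatype state = Start | Halt | Query | Yes | No | State nat
datatype symbol = Blank | Bit bool | Extra nat
datatype move = MoveLeft | Stay | MoveRight

text \<open>
  A tape is infinite in both directions; it is given by its contents and the position of its head.
  Tape 0 is the input tape, tape 1 the output tape, tape 2 the oracle query tape; all further tapes
  are work tapes. All tapes are readable and writable.
\<close>

type_synonym tape = "(int \<Rightarrow> symbol) \<times> int"
type_synonym config = "state \<times> tape list"

record otm =
  states :: "state set"
  alphabet :: "symbol set"
  num_tapes :: nat
  transition :: "state \<Rightarrow> symbol list \<Rightarrow> state \<times> (symbol \<times> move) list"

text \<open>
  In a well-formed machine only the finite restriction of the transition function to
  \<open>states\<close> and to \<open>num_tapes\<close>-tuples over \<open>alphabet\<close> is ever used.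
\<close>

definition oracle_tm :: "otm \<Rightarrow> bool" where
  "oracle_tm M \<longleftrightarrow>
     finite (states M) \<and> {Start, Halt, Query, Yes, No} \<subseteq> states M \<and>
     finite (alphabet M) \<and> {Blank, Bit False, Bit True} \<subseteq> alphabet M \<and>
     3 \<le> num_tapes M \<and>
     (\<forall>q \<in> states M - {Halt, Query}. \<forall>ss. length ss = num_tapes M \<and> set ss \<subseteq> alphabet M \<longrightarrow>
        (case transition M q ss of (q', as) \<Rightarrow>
           q' \<in> states M \<and> length as = num_tapes M \<and> fst ` set as \<subseteq> alphabet M))"

fun scanned :: "tape \<Rightarrow> symbol" where
  "scanned (t, h) = t h"

fun move_head :: "move \<Rightarrow> int \<Rightarrow> int" where
  "move_head MoveLeft h = h - 1"
| "move_head Stay h = h"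
| "move_head MoveRight h = h + 1"

fun act :: "symbol \<times> move \<Rightarrow> tape \<Rightarrow> tape" where
  "act (a, m) (t, h) = (t(h := a), move_head m h)"

text \<open>
  The word on a tape is read off from cell 0 up to the first cell that does not contain a bit,
  independently of the head position.
\<close>

definition word_on :: "tape \<Rightarrow> bool list \<Rightarrow> bool" where
  "word_on T x \<longleftrightarrow>
     (\<forall>i < length x. fst T (int i) = Bit (x ! i)) \<and> (\<forall>b. fst T (int (length x)) \<noteq> Bit b)"

definition tape_of :: "bool list \<Rightarrow> tape" where
  "tape_of x = ((\<lambda>i. if 0 \<le> i \<and> i < int (length x) then Bit (x ! nat i) else Blank), 0)"

definition init_config :: "otm \<Rightarrow> bool list \<Rightarrow> config" where
  "init_config M x = (Start, tape_of x # replicate (num_tapes M - 1) (tape_of []))"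

fun step :: "otm \<Rightarrow> bool list set \<Rightarrow> config \<Rightarrow> config" where
  "step M A (q, ts) =
     (if q = Halt then (q, ts)
      else if q = Query then (if \<exists>x \<in> A. word_on (ts ! 2) x then Yes else No, ts)
      else (case transition M q (map scanned ts) of (q', as) \<Rightarrow> (q', map2 act as ts)))"

definition halts_with :: "otm \<Rightarrow> bool list set \<Rightarrow> bool list \<Rightarrow> bool list \<Rightarrow> bool" where
  "halts_with M A x y \<longleftrightarrow>
     (\<exists>k ts. (step M A ^^ k) (init_config M x) = (Halt, ts) \<and> word_on (ts ! 1) y)"

text \<open>
  Machines with the empty oracle are ordinary Turing machines. Natural numbers are given to and
  returned by machines in binary, most significant bit first, without leading zeros.
\<close>

definition partial_recursive :: "(bool list \<rightharpoonup> bool list) \<Rightarrow> bool" where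
  "partial_recursive C \<longleftrightarrow>
     (\<exists>M. oracle_tm M \<and> (\<forall>x y. C x = Some y \<longleftrightarrow> halts_with M {} x y))"

fun binary_of_nat :: "nat \<Rightarrow> bool list" where
  "binary_of_nat n = (if n = 0 then [] else binary_of_nat (n div 2) @ [odd n])"

declare binary_of_nat.simps [simp del]

text \<open>The value of \<open>f\<close> at 0 is irrelevant: \<open>f\<close> stands for a function on the positive integers.\<close>

definition total_recursive :: "(nat \<Rightarrow> nat) \<Rightarrow> bool" where
  "total_recursive f \<longleftrightarrow>
     (\<exists>M. oracle_tm M \<and> (\<forall>n \<ge> 1. halts_with M {} (binary_of_nat n) (binary_of_nat (f n))))"

definition prefix_free :: "bool list set \<Rightarrow> bool" where
  "prefix_free S \<longleftrightarrow> (\<forall>p \<in> S. \<forall>q \<in> S. prefix p q \<longrightarrow> p = q)"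

definition computer :: "(bool list \<rightharpoonup> bool list) \<Rightarrow> bool" where
  "computer C \<longleftrightarrow> partial_recursive C \<and> prefix_free (dom C)"

definition optimal_computer :: "(bool list \<rightharpoonup> bool list) \<Rightarrow> bool" where
  "optimal_computer U \<longleftrightarrow> computer U \<and>
     (\<forall>C. computer C \<longrightarrow>
        (\<exists>d. \<forall>p \<in> dom C. \<exists>q. U q = C p \<and> length q \<le> length p + d))"

definition Omega :: "(bool list \<rightharpoonup> bool list) \<Rightarrow> real" where
  "Omega V = (\<Sum>\<^sub>\<infinity>p\<in>dom V. (1/2) ^ length p)"

definition set_restrict :: "bool list set \<Rightarrow> int \<Rightarrow> bool list set" where
  "set_restrict S n = {s \<in> S. int (length s) \<le> n}"

text \<open>
  The \<open>i\<close>-th bit after the binary point of a number \<open>x\<close> in \<open>[0, 1)\<close> is the parity of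
  \<open>\<lfloor>2 ^ i * x\<rfloor>\<close>; this yields the expansion with infinitely many zeros.
\<close>

definition real_restrict :: "real \<Rightarrow> int \<Rightarrow> bool list" where
  "real_restrict \<alpha> n = map (\<lambda>i. odd \<lfloor>2 ^ i * frac \<alpha>\<rfloor>) [1..<nat n + 1]"

text \<open>
  A finite set is listed in length-lexicographic order, and each element \<open>b\<^sub>1\<dots>b\<^sub>k\<close> is written
  as \<open>1 b\<^sub>1 \<dots> 1 b\<^sub>k 0\<close>. The sorting key of \<open>s\<close> is the number with binary notation \<open>1 s\<close>.
\<close>

definition shortlex_index :: "bool list \<Rightarrow> nat" where
  "shortlex_index s = horner_sum of_bool 2 (rev (True # s))"

fun self_delimiting :: "bool list \<Rightarrow> bool list" where
  "self_delimiting [] = [False]"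
| "self_delimiting (b # s) = True # b # self_delimiting s"

definition encode_set :: "bool list set \<Rightarrow> bool list" where
  "encode_set S = concat (map self_delimiting (sorted_key_list_of_set shortlex_index S))"

end

(*
  (ii) implies (i): the first m bits of Omega_V tell when all programs of length less than m have
  been seen to halt on V. Some computer outputs on p the running time of W on p, and V imitates
  it with an overhead of d bits; hence the outputs of the programs of V of length at most n + d
  bound the running times of W on Dom W restricted to n. If f is bounded, n - f(n) + c bits
  of Omega_V suffice.

  (i) implies (ii): let f be unbounded. From j one computes some n with n >= 2j and f(n) >= 2j,
  and thus the length n - f(n) + c of the oracle string s. A computer that reads 1^j 0 s therefore
  has a prefix-free domain; it runs the oracle machine on n, obtains Dom W restricted to n, and
  outputs a string that differs from W(p) for all p in this set. But the input has length
  at most n - j + O(1), so for large j the optimal W yields that string on a program of length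
  at most n.

  Both algorithms are unbounded searches for a number satisfying a test that is total, because
  machines are only simulated for a bounded number of steps. The tests are built from pairing,
  composition and iteration, which register programs can carry out; a register is easily
  kept as the head position on a tape.
*)
theory Submission
  imports Defs "HOL-Library.Nat_Bijection"
begin

section \<open>Multitape machines from while-programs\<close>

text \<open>A machine can only ask whether a given string is the oracle element; it cannot read that
  string. The search for (ii) implies (i) therefore runs through pairs of a candidate string and a
  stage, with one query per pair. In the converse the new computer has no oracle: its input supplies
  the string, and the bounded simulation answers queries by comparison with it.

  \<open>partial_recursive\<close> is an equivalence, so machines must provably run forever off the
  domain. The big-step semantics only describes finished runs; nontermination is therefore treated
  once, for a program with one outer loop whose body always ends, and all constructed machines are
  instances of it.

  The output of the oracle machine is the code of a finite set, but it is never decoded. The test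
  guesses a stage and compares the output with the code of the set of programs of \<open>W\<close>
  found by then; as only elements of the domain are ever found, equal codes force equal sets. The
  same stage yields the values of \<open>W\<close> on that set, and a sum containing each of their
  codes increased by 1 differs from all of them.\<close>

datatype com =
    Inc nat
  | Dec nat
  | Test bool nat
  | Write nat "bool option"
  | Move nat move
  | Ask nat
  | Seq com com (infixr \<open>;;\<close> 60)
  | While nat com

type_synonym store = "(nat \<Rightarrow> nat) \<times> tape list"

fun opt_symbol :: "bool option \<Rightarrow> symbol" where
  "opt_symbol None = Blank"
| "opt_symbol (Some b) = Bit b"

text \<open>Only finished runs are described. The premise of \<open>exec_Ask\<close> lets the
  compiled instruction mark the scanned cell while the oracle is consulted and blank it again
  afterwards; since neither a blank nor the mark is a bit, the queried word stays the same.\<close>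

inductive exec :: "bool list set \<Rightarrow> com \<Rightarrow> store \<Rightarrow> store \<Rightarrow> bool" for A where
  exec_Inc: "exec A (Inc r) (\<sigma>, T) (\<sigma>(r := Suc (\<sigma> r)), T)"
| exec_Dec: "exec A (Dec r) (\<sigma>, T) (\<sigma>(r := \<sigma> r - 1), T)"
| exec_Test: "exec A (Test b r) (\<sigma>, T)
    (if scanned (T ! 0) = Bit b then \<sigma>(r := Suc (\<sigma> r)) else \<sigma>, T)"
| exec_Write: "exec A (Write k a) (\<sigma>, T) (\<sigma>, T[k := act (opt_symbol a, Stay) (T ! k)])"
| exec_Move: "exec A (Move k m) (\<sigma>, T) (\<sigma>, T[k := act (scanned (T ! k), m) (T ! k)])"
| exec_Ask: "scanned (T ! 2) = Blank \<Longrightarrow> exec A (Ask r) (\<sigma>, T)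
    (if \<exists>x\<in>A. word_on (T ! 2) x then \<sigma>(r := Suc (\<sigma> r)) else \<sigma>, T)"
| exec_Seq: "exec A c S S' \<Longrightarrow> exec A d S' S'' \<Longrightarrow> exec A (c ;; d) S S''"
| exec_While_0: "fst S r = 0 \<Longrightarrow> exec A (While r c) S S"
| exec_While: "fst S r \<noteq> 0 \<Longrightarrow> exec A c S S' \<Longrightarrow> exec A (While r c) S' S'' \<Longrightarrow>
    exec A (While r c) S S''"

section \<open>Jump code and the transition function of a compiled program\<close>

datatype instr = Do com | Jz nat nat | Jmp nat

text \<open>Jump targets are absolute, so the address of the first instruction is an argument. The
  number 2 in the exit address of a loop counts the \<open>Jz\<close> before the body and the
  \<open>Jmp\<close> behind it.\<close>

fun compile :: "com \<Rightarrow> nat \<Rightarrow> instr list" where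
  "compile (c ;; d) s = (let u = compile c s in u @ compile d (s + length u))"
| "compile (While r c) s =
    (let u = compile c (Suc s) in Jz r (s + length u + 2) # u @ [Jmp s])"
| "compile c s = [Do c]"

fun regs :: "com \<Rightarrow> nat" where
  "regs (Inc r) = Suc r"
| "regs (Dec r) = Suc r"
| "regs (Test b r) = Suc r"
| "regs (Write k a) = 0"
| "regs (Move k m) = 0"
| "regs (Ask r) = Suc r"
| "regs (c ;; d) = max (regs c) (regs d)"
| "regs (While r c) = max (Suc r) (regs c)"

text \<open>Tapes from 3 on hold the registers, so direct access is confined to the input, output
  and query tapes.\<close>

fun io_wf :: "com \<Rightarrow> bool" where
  "io_wf (Write k a) = (k < 3)"
| "io_wf (Move k m) = (k < 3)"
| "io_wf (c ;; d) = (io_wf c \<and> io_wf d)"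
| "io_wf (While r c) = io_wf c"
| "io_wf _ = True"

definition keep :: "symbol list \<Rightarrow> (symbol \<times> move) list" where
  "keep ss = map (\<lambda>a. (a, Stay)) ss"

text \<open>On the marker \<open>Dec\<close> keeps the head in place, which gives truncated
  subtraction. The last equation covers compound commands under \<open>Do\<close>, which
  \<open>compile\<close> never produces.\<close>

fun instr_trans :: "nat \<Rightarrow> instr \<Rightarrow> symbol list \<Rightarrow> state \<times> (symbol \<times> move) list" where
  "instr_trans i (Do (Inc r)) ss = (State (Suc i), (keep ss)[r + 3 := (ss ! (r + 3), MoveRight)])"
| "instr_trans i (Do (Dec r)) ss =
    (State (Suc i), (keep ss)[r + 3 := (ss ! (r + 3), if ss ! (r + 3) = Extra 0 then Stay else MoveLeft)])"
| "instr_trans i (Do (Test b r)) ss =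
    (State (Suc i), if ss ! 0 = Bit b then (keep ss)[r + 3 := (ss ! (r + 3), MoveRight)] else keep ss)"
| "instr_trans i (Do (Write k a)) ss = (State (Suc i), (keep ss)[k := (opt_symbol a, Stay)])"
| "instr_trans i (Do (Move k m)) ss = (State (Suc i), (keep ss)[k := (ss ! k, m)])"
| "instr_trans i (Do (Ask r)) ss = (Query, (keep ss)[2 := (Extra i, Stay)])"
| "instr_trans i (Jz r n) ss = (State (if ss ! (r + 3) = Extra 0 then n else Suc i), keep ss)"
| "instr_trans i (Jmp n) ss = (State n, keep ss)"
| "instr_trans i _ ss = (Halt, keep ss)"

text \<open>
  While the oracle is consulted, the cell behind the query word holds the number of the \<open>Ask\<close>
  instruction; \<open>Yes\<close> and \<open>No\<close> read off from it where to continue.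
\<close>

definition answer_trans :: "instr list \<Rightarrow> bool \<Rightarrow> symbol list \<Rightarrow> state \<times> (symbol \<times> move) list" where
  "answer_trans P ans ss = (case ss ! 2 of
      Extra i \<Rightarrow> if i < length P then (case P ! i of
          Do (Ask r) \<Rightarrow> (State (Suc i),
            let as = (keep ss)[2 := (Blank, Stay)] in
            if ans then as[r + 3 := (ss ! (r + 3), MoveRight)] else as)
        | _ \<Rightarrow> (Halt, keep ss)) else (Halt, keep ss)
    | _ \<Rightarrow> (Halt, keep ss))"

text \<open>\<open>Start\<close> writes the zero marker on every register tape. The address
  \<open>length P\<close> just behind the program has no instruction, so arriving there halts the
  machine.\<close>

fun prog_trans :: "nat \<Rightarrow> instr list \<Rightarrow> state \<Rightarrow> symbol list \<Rightarrow> state \<times> (symbol \<times> move) list" where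
  "prog_trans N P Start ss = (State 0, take 3 (keep ss) @ replicate N (Extra 0, Stay))"
| "prog_trans N P (State i) ss =
    (if i < length P then instr_trans i (P ! i) ss else (Halt, keep ss))"
| "prog_trans N P Yes ss = answer_trans P True ss"
| "prog_trans N P No ss = answer_trans P False ss"
| "prog_trans N P _ ss = (Halt, keep ss)"

definition prog_tm :: "nat \<Rightarrow> instr list \<Rightarrow> otm" where
  "prog_tm N P = \<lparr>states = {Start, Halt, Query, Yes, No} \<union> State ` {..length P},
     alphabet = {Blank, Bit False, Bit True} \<union> Extra ` {..length P},
     num_tapes = N + 3, transition = prog_trans N P\<rparr>"

text \<open>
  Register \<open>r\<close> is the head position on tape \<open>r + 3\<close>, where only cell 0 is marked; this marker
  is the zero test.
\<close>

definition reg_tape :: "nat \<Rightarrow> tape" where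
  "reg_tape v = ((\<lambda>j. if j = 0 then Extra 0 else Blank), int v)"

definition store_config :: "nat \<Rightarrow> store \<Rightarrow> tape list" where
  "store_config N S = snd S @ map (\<lambda>i. reg_tape (fst S i)) [0..<N]"

definition code_at :: "instr list \<Rightarrow> nat \<Rightarrow> instr list \<Rightarrow> bool" where
  "code_at P s u \<longleftrightarrow> s + length u \<le> length P \<and> (\<forall>j < length u. P ! (s + j) = u ! j)"

lemma code_at_append:
  "code_at P s (u @ v) \<longleftrightarrow> code_at P s u \<and> code_at P (s + length u) v"
proof
  assume L: "code_at P s (u @ v)"
  have "P ! (s + length u + j) = v ! j" if "j < length v" for j
    using L that unfolding code_at_def
    by (metis add.assoc add_less_cancel_left length_append nth_append_length_plus)
  moreover have "P ! (s + j) = u ! j" if "j < length u" for j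
    using L that unfolding code_at_def by (simp add: nth_append)
  ultimately show "code_at P s u \<and> code_at P (s + length u) v"
    using L unfolding code_at_def by auto
next
  assume R: "code_at P s u \<and> code_at P (s + length u) v"
  have "P ! (s + j) = (u @ v) ! j" if "j < length (u @ v)" for j
  proof (cases "j < length u")
    case True
    then show ?thesis using R unfolding code_at_def by (simp add: nth_append)
  next
    case False
    then obtain i where "j = length u + i" by (metis le_Suc_ex linorder_not_less)
    then show ?thesis using R that unfolding code_at_def by (simp add: add.assoc)
  qed
  then show "code_at P s (u @ v)" using R unfolding code_at_def by auto
qed

lemma code_at_Cons:
  "code_at P s (x # u) \<longleftrightarrow> s < length P \<and> P ! s = x \<and> code_at P (Suc s) u"
  using code_at_append[of P s "[x]" u] by (auto simp: code_at_def)

section \<open>Runs of compiled programs on the machine\<close>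

definition reach :: "otm \<Rightarrow> bool list set \<Rightarrow> config \<Rightarrow> config \<Rightarrow> bool" where
  "reach M A x y \<longleftrightarrow> (\<exists>k. (step M A ^^ k) x = y)"

lemma reach_trans: "reach M A x y \<Longrightarrow> reach M A y z \<Longrightarrow> reach M A x z"
proof -
  assume "reach M A x y" and "reach M A y z"
  then obtain k l where "(step M A ^^ k) x = y" "(step M A ^^ l) y = z"
    unfolding reach_def by blast
  then have "(step M A ^^ (l + k)) x = z" by (simp add: funpow_add)
  then show ?thesis unfolding reach_def by blast
qed

lemma reach_step: "step M A x = y \<Longrightarrow> reach M A x y"
  unfolding reach_def by (rule exI[of _ 1]) simp

lemma length_keep [simp]: "length (keep ss) = length ss"
  by (simp add: keep_def)

lemma act_scanned_Stay [simp]: "act (scanned T, Stay) T = T"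
  by (cases T) simp

lemma map2_act_keep [simp]: "map2 act (keep (map scanned ts)) ts = ts"
  by (induction ts) (auto simp: keep_def)

lemma map2_list_update:
  "k < length ys \<Longrightarrow> length xs = length ys \<Longrightarrow>
    map2 g (xs[k := a]) ys = (map2 g xs ys)[k := g a (ys ! k)]"
  by (rule nth_equalityI) (auto simp: nth_list_update)

lemma map2_act_update [simp]:
  "k < length ts \<Longrightarrow>
    map2 act ((keep (map scanned ts))[k := a]) ts = ts[k := act a (ts ! k)]"
  by (subst map2_list_update) auto

lemma map2_act_update2:
  assumes "k < length ts" "l < length ts" "k \<noteq> l"
  shows "map2 act ((keep (map scanned ts))[k := a, l := b]) ts
    = ts[k := act a (ts ! k), l := act b (ts ! l)]"
  using assms by (subst map2_list_update) auto

lemma length_store_config [simp]: "length (store_config N S) = length (snd S) + N"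
  by (simp add: store_config_def)

lemma store_config_reg:
  "length (snd S) = 3 \<Longrightarrow> r < N \<Longrightarrow> store_config N S ! (r + 3) = reg_tape (fst S r)"
  by (simp add: store_config_def nth_append)

lemma store_config_io: "k < length (snd S) \<Longrightarrow> store_config N S ! k = snd S ! k"
  by (simp add: store_config_def nth_append)

lemma store_config_reg_update:
  "length T = 3 \<Longrightarrow> r < N \<Longrightarrow>
    (store_config N (\<sigma>, T))[r + 3 := reg_tape v] = store_config N (\<sigma>(r := v), T)"
  by (rule nth_equalityI) (auto simp: store_config_def nth_append nth_list_update)

lemma store_config_io_update:
  "k < length T \<Longrightarrow> (store_config N (\<sigma>, T))[k := t] = store_config N (\<sigma>, T[k := t])"
  by (simp add: store_config_def list_update_append)

lemma scanned_reg_tape [simp]: "scanned (reg_tape v) = Extra 0 \<longleftrightarrow> v = 0"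
  by (simp add: reg_tape_def)

lemma act_reg_tape_right [simp]:
  "act (scanned (reg_tape v), MoveRight) (reg_tape v) = reg_tape (Suc v)"
  by (auto simp: reg_tape_def)

lemma act_reg_tape_left [simp]:
  "0 < v \<Longrightarrow> act (scanned (reg_tape v), MoveLeft) (reg_tape v) = reg_tape (v - 1)"
  by (auto simp: reg_tape_def)

lemma word_on_mark:
  assumes "scanned T = Blank"
  shows "word_on (act (Extra i, Stay) T) x \<longleftrightarrow> word_on T x"
  using assms by (cases T) (auto simp: word_on_def)

lemma ask_correct:
  assumes "code_at P s [Do (Ask r)]" and r: "r < N" and T: "length T = 3"
    and blank: "scanned (T ! 2) = Blank"
  shows "reach (prog_tm N P) A (State s, store_config N (\<sigma>, T)) (State (Suc s),
    store_config N (if \<exists>x\<in>A. word_on (T ! 2) x then \<sigma>(r := Suc (\<sigma> r)) else \<sigma>, T))"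
proof -
  let ?M = "prog_tm N P" and ?C = "store_config N (\<sigma>, T)" and ?t = "act (Extra s, Stay) (T ! 2)"
  let ?ans = "\<exists>x\<in>A. word_on (T ! 2) x"
  let ?D = "store_config N (\<sigma>, T[2 := ?t])"
  have s: "s < length P" "P ! s = Do (Ask r)" using assms(1) by (auto simp: code_at_Cons)
  have C2: "?C ! 2 = T ! 2" using T by (simp add: store_config_io)
  have D2: "?D ! 2 = ?t" using T by (simp add: store_config_io)
  have t0: "scanned ?t = Extra s" by (cases "T ! 2") simp
  have t1: "act (Blank, Stay) ?t = T ! 2" using blank by (cases "T ! 2") (auto simp: fun_eq_iff)
  have 1: "step ?M A (State s, ?C) = (Query, ?D)"
    using s T C2 by (simp add: prog_tm_def store_config_io_update)
  have 2: "step ?M A (Query, ?D) = (if ?ans then Yes else No, ?D)"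
    using D2 word_on_mark[OF blank] by simp
  have sc2: "map scanned ?D ! 2 = Extra s" using T t0 D2 by simp
  have E: "?D[2 := T ! 2] = ?C"
    using T by (simp add: store_config_io_update)
  have R: "?D ! (r + 3) = reg_tape (\<sigma> r)" using T r by (simp add: store_config_reg)
  have tr: "prog_trans N P (if ?ans then Yes else No) (map scanned ?D) = (State (Suc s),
     let as = (keep (map scanned ?D))[2 := (Blank, Stay)] in
     if ?ans then as[r + 3 := (map scanned ?D ! (r + 3), MoveRight)] else as)"
    using s sc2 by (simp add: answer_trans_def)
  have 3: "step ?M A (if ?ans then Yes else No, ?D) = (State (Suc s),
      store_config N (if ?ans then \<sigma>(r := Suc (\<sigma> r)) else \<sigma>, T))"
  proof (cases ?ans)
    case True
    have "step ?M A (Yes, ?D) = (State (Suc s), ?D[2 := act (Blank, Stay) (?D ! 2),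
        r + 3 := act (map scanned ?D ! (r + 3), MoveRight) (?D ! (r + 3))])"
      using tr True T r by (simp add: prog_tm_def Let_def map2_act_update2)
    also have "\<dots> = (State (Suc s), ?C[r + 3 := reg_tape (Suc (\<sigma> r))])"
      using D2 t1 E R T r by simp
    finally show ?thesis using True T r by (simp add: store_config_reg_update)
  next
    case False
    have "step ?M A (No, ?D) = (State (Suc s), ?D[2 := act (Blank, Stay) (?D ! 2)])"
      using tr False T r by (simp add: prog_tm_def Let_def)
    also have "\<dots> = (State (Suc s), ?C)"
      using D2 t1 E by simp
    finally show ?thesis using False by simp
  qed
  show ?thesis
    by (rule reach_trans[OF reach_step[OF 1] reach_trans[OF reach_step[OF 2] reach_step[OF 3]]])
qed

lemma exec_length: "exec A c S S' \<Longrightarrow> length (snd S') = length (snd S)"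
  by (induction rule: exec.induct) auto

lemma step_Jz:
  assumes "s < length P" "P ! s = Jz r n" "r < N" "length (snd S) = 3"
  shows "step (prog_tm N P) A (State s, store_config N S) =
    (State (if fst S r = 0 then n else Suc s), store_config N S)"
proof -
  have "map scanned (store_config N S) ! (r + 3) = scanned (reg_tape (fst S r))"
    using assms by (simp add: store_config_reg)
  then show ?thesis using assms by (simp add: prog_tm_def)
qed

lemma step_Jmp:
  "s < length P \<Longrightarrow> P ! s = Jmp n \<Longrightarrow>
    step (prog_tm N P) A (State s, ts) = (State n, ts)"
  by (simp add: prog_tm_def)

text \<open>Rule induction over the run, with the address left arbitrary so that the hypotheses
  apply to nested pieces of code. After the body of a loop, \<open>Jmp\<close> leads back to the
  address of its \<open>Jz\<close>, which is where the hypothesis for the remaining iterations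
  starts.\<close>

theorem exec_reach:
  "exec A c S S' \<Longrightarrow> length (snd S) = 3 \<Longrightarrow> regs c \<le> N \<Longrightarrow> io_wf c \<Longrightarrow>
    code_at P s (compile c s) \<Longrightarrow>
    reach (prog_tm N P) A (State s, store_config N S)
      (State (s + length (compile c s)), store_config N S')"
proof (induction arbitrary: s rule: exec.induct)
  case (exec_Inc r \<sigma> T)
  have s: "s < length P" "P ! s = Do (Inc r)" using exec_Inc by (auto simp: code_at_Cons)
  have "r < N" using exec_Inc by simp
  then show ?case using s exec_Inc
    by (intro reach_step) (simp add: prog_tm_def store_config_reg store_config_reg_update)
next
  case (exec_Dec r \<sigma> T)
  have s: "s < length P" "P ! s = Do (Dec r)" using exec_Dec by (auto simp: code_at_Cons)
  have r: "r < N" using exec_Dec by simp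
  show ?case
  proof (cases "\<sigma> r = 0")
    case True
    then have "\<sigma>(r := \<sigma> r - 1) = \<sigma>" by auto
    moreover have "(store_config N (\<sigma>, T))[r + 3 := reg_tape (\<sigma> r)] = store_config N (\<sigma>, T)"
      using exec_Dec.prems r by (simp add: store_config_reg_update)
    ultimately show ?thesis using s exec_Dec.prems r True
      by (intro reach_step) (simp add: prog_tm_def store_config_reg)
  next
    case False
    then show ?thesis using s exec_Dec r
      by (intro reach_step) (simp add: prog_tm_def store_config_reg store_config_reg_update)
  qed
next
  case (exec_Test b r \<sigma> T)
  have s: "s < length P" "P ! s = Do (Test b r)" using exec_Test by (auto simp: code_at_Cons)
  have r: "r < N" using exec_Test by simp
  have z: "map scanned (store_config N (\<sigma>, T)) ! 0 = scanned (T ! 0)"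
    using exec_Test by (simp add: store_config_io)
  then show ?case using s exec_Test r
    by (intro reach_step) (simp add: prog_tm_def store_config_reg store_config_reg_update)
next
  case (exec_Write k a \<sigma> T)
  have s: "s < length P" "P ! s = Do (Write k a)" using exec_Write by (auto simp: code_at_Cons)
  then show ?case using exec_Write
    by (intro reach_step) (simp add: prog_tm_def store_config_io store_config_io_update)
next
  case (exec_Move k m \<sigma> T)
  have s: "s < length P" "P ! s = Do (Move k m)" using exec_Move by (auto simp: code_at_Cons)
  then show ?case using exec_Move
    by (intro reach_step) (simp add: prog_tm_def store_config_io store_config_io_update)
next
  case (exec_Ask T r \<sigma>)
  then show ?case using ask_correct[of P s r N T A \<sigma>] by simp
next
  case (exec_Seq c S S' d S'')
  have l: "length (snd S') = 3" using exec_length exec_Seq by metis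
  have c: "code_at P s (compile c s)"
    "code_at P (s + length (compile c s)) (compile d (s + length (compile c s)))"
    using exec_Seq.prems by (auto simp: Let_def code_at_append)
  have "reach (prog_tm N P) A (State s, store_config N S)
      (State (s + length (compile c s)), store_config N S')"
    using exec_Seq c by simp
  moreover have "reach (prog_tm N P) A (State (s + length (compile c s)), store_config N S')
     (State (s + length (compile c s) + length (compile d (s + length (compile c s)))), store_config N S'')"
    using exec_Seq c l by simp
  ultimately show ?case using reach_trans[of "prog_tm N P" A] by (simp add: Let_def add.assoc)
next
  case (exec_While_0 S r c)
  have s: "s < length P" "P ! s = Jz r (s + length (compile c (Suc s)) + 2)"
    using exec_While_0 by (auto simp: code_at_Cons Let_def)
  have "r < N" using exec_While_0 by simp
  then show ?case using step_Jz[OF s] exec_While_0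
    by (intro reach_step) (simp add: Let_def)
next
  case (exec_While S r c S' S'')
  let ?u = "compile c (Suc s)"
  have l: "length (snd S') = 3" using exec_length exec_While by metis
  have s: "s < length P" "P ! s = Jz r (s + length ?u + 2)"
    and c: "code_at P (Suc s) ?u"
    and e: "s + length ?u + 1 < length P" "P ! (s + length ?u + 1) = Jmp s"
    using exec_While.prems by (auto simp: code_at_Cons code_at_append Let_def)
  have r: "r < N" using exec_While by simp
  have 1: "reach (prog_tm N P) A (State s, store_config N S) (State (Suc s), store_config N S)"
    using step_Jz[OF s r] exec_While by (intro reach_step) simp
  have 2: "reach (prog_tm N P) A (State (Suc s), store_config N S)
     (State (s + length ?u + 1), store_config N S')"
    using exec_While.IH(1)[OF _ _ _ c] exec_While.prems by simp
  have 3: "reach (prog_tm N P) A (State (s + length ?u + 1), store_config N S')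
      (State s, store_config N S')"
    using step_Jmp[OF e] by (rule reach_step)
  have 4: "reach (prog_tm N P) A (State s, store_config N S')
      (State (s + length (compile (While r c) s)), store_config N S'')"
    using exec_While.IH(2) l exec_While.prems by blast
  show ?case
    by (rule reach_trans[OF 1 reach_trans[OF 2 reach_trans[OF 3 4]]])
qed

section \<open>From program runs to halting and diverging machines\<close>

definition init_store :: "bool list \<Rightarrow> store" where
  "init_store x = (\<lambda>_. 0, [tape_of x, tape_of [], tape_of []])"

definition com_tm :: "com \<Rightarrow> otm" where
  "com_tm c = prog_tm (regs c) (compile c 0)"

fun instr_ok :: "nat \<Rightarrow> nat \<Rightarrow> instr \<Rightarrow> bool" where
  "instr_ok N L (Do c) \<longleftrightarrow> regs c \<le> N \<and> io_wf c"
| "instr_ok N L (Jz r n) \<longleftrightarrow> r < N \<and> n \<le> L"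
| "instr_ok N L (Jmp n) \<longleftrightarrow> n \<le> L"

lemma compile_ok:
  "io_wf c \<Longrightarrow> regs c \<le> N \<Longrightarrow> s + length (compile c s) \<le> L \<Longrightarrow>
    \<forall>i\<in>set (compile c s). instr_ok N L i"
proof (induction c arbitrary: s)
  case (Seq c d)
  show ?case using Seq.IH(1)[of s] Seq.IH(2)[of "s + length (compile c s)"] Seq.prems
    by (auto simp: Let_def)
next
  case (While r c)
  show ?case using While.IH[of "Suc s"] While.prems by (auto simp: Let_def)
qed auto

lemma set_keep_subset: "set ss \<subseteq> X \<Longrightarrow> fst ` set (keep ss) \<subseteq> X"
  by (auto simp: keep_def)

lemma set_keep_update_subset:
  "set ss \<subseteq> X \<Longrightarrow> a \<in> X \<Longrightarrow> fst ` set ((keep ss)[k := (a, m)]) \<subseteq> X"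
  using image_mono[OF set_update_subset_insert[of "keep ss" k "(a, m)"], of fst]
    set_keep_subset[of ss X] by auto

lemma set_keep_update2_subset:
  "set ss \<subseteq> X \<Longrightarrow> a \<in> X \<Longrightarrow> b \<in> X \<Longrightarrow>
    fst ` set ((keep ss)[k := (a, m), l := (b, n)]) \<subseteq> X"
  using image_mono[OF set_update_subset_insert[of "(keep ss)[k := (a, m)]" l "(b, n)"], of fst]
    set_keep_update_subset[of ss X a k m] by auto

text \<open>Well-formedness quantifies over all tuples of symbols, including those that no run
  meets. This is why \<open>answer_trans\<close> halts on a mark that does not name an
  \<open>Ask\<close>, and why addresses up to and including \<open>length P\<close> count as
  states.\<close>

lemma oracle_tm_com_tm:
  assumes "io_wf c"
  shows "oracle_tm (com_tm c)"
proof -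
  define P where "P = compile c 0"
  define N where "N = regs c"
  define X where "X = {Blank, Bit False, Bit True} \<union> Extra ` {..length P}"
  define Q where "Q = {Start, Halt, Query, Yes, No} \<union> State ` {..length P}"
  have X: "Blank \<in> X" "Bit b \<in> X" "i \<le> length P \<Longrightarrow> Extra i \<in> X" for b i
    by (cases b) (auto simp: X_def)
  have Q: "Start \<in> Q" "Halt \<in> Q" "Query \<in> Q" "Yes \<in> Q" "No \<in> Q" "i \<le> length P \<Longrightarrow> State i \<in> Q" for i
    by (auto simp: Q_def)
  have ok: "instr_ok N (length P) i" if "i \<in> set P" for i
    using compile_ok[of c N 0 "length P"] assms that by (simp add: P_def N_def)
  have ok': "instr_ok N (length P) (P ! j)" if "j < length P" for j
    using ok nth_mem that by blast
  have opt: "opt_symbol a \<in> X" for a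
    using X by (cases a) auto
  have main: "fst (prog_trans N P q ss) \<in> Q \<and> length (snd (prog_trans N P q ss)) = N + 3 \<and>
      fst ` set (snd (prog_trans N P q ss)) \<subseteq> X"
    if q: "q \<in> Q - {Halt, Query}" and l: "length ss = N + 3" and ss: "set ss \<subseteq> X" for q ss
  proof -
    have nth: "ss ! k \<in> X" if "k < N + 3" for k
      using l ss nth_mem[of k ss] that by (metis subsetD)
    have k0: "fst ` set (keep ss) \<subseteq> X" using ss by (rule set_keep_subset)
    have k1: "fst ` set ((keep ss)[k := (a, m)]) \<subseteq> X" if "a \<in> X" for k a m
      using ss that by (rule set_keep_update_subset)
    have k2: "fst ` set ((keep ss)[k := (a, m), k' := (b, n)]) \<subseteq> X"
      if "a \<in> X" "b \<in> X" for k a m k' b n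
      using ss that by (rule set_keep_update2_subset)
    have ans: "fst (answer_trans P b ss) \<in> Q \<and> length (snd (answer_trans P b ss)) = N + 3 \<and>
      fst ` set (snd (answer_trans P b ss)) \<subseteq> X" for b
    proof (cases "\<exists>i r. ss ! 2 = Extra i \<and> i < length P \<and> P ! i = Do (Ask r)")
      case True
      then obtain i r where i: "ss ! 2 = Extra i" "i < length P" "P ! i = Do (Ask r)" by blast
      have "r < N" using ok'[OF i(2)] i(3) by simp
      then show ?thesis using i l k1[of Blank] k2[of Blank "ss ! (r + 3)"] nth[of "r + 3"] X Q
        by (auto simp: answer_trans_def Let_def)
    next
      case False
      then have "answer_trans P b ss = (Halt, keep ss)"
        by (auto simp: answer_trans_def split: symbol.splits instr.splits com.splits)
      then show ?thesis using k0 l Q by simp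
    qed
    consider "q = Start" | i where "q = State i" "i < length P" | "q = State (length P)"
      | "q = Yes" | "q = No" using q unfolding Q_def by fastforce
    then show ?thesis
    proof cases
      case 1
      have "fst ` set (take 3 (keep ss)) \<subseteq> X"
        using k0 set_take_subset[of 3 "keep ss"] by blast
      then show ?thesis using 1 l X Q by auto
    next
      case 2
      show ?thesis
      proof (cases "P ! i")
        case (Do d)
        have "instr_ok N (length P) (Do d)" using ok'[OF 2(2)] Do by simp
        then show ?thesis using 2 Do l
          by (cases d) (simp_all add: k0 k1 nth opt X Q)
      next
        case (Jz r n)
        then show ?thesis using ok'[OF 2(2)] 2 l k0 Q by auto
      next
        case (Jmp n)
        then show ?thesis using ok'[OF 2(2)] 2 l k0 Q by auto
      qed
    qed (use k0 l ans Q in auto)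
  qed
  show ?thesis
    using main X Q unfolding oracle_tm_def com_tm_def P_def[symmetric] N_def[symmetric] prog_tm_def
      X_def[symmetric] Q_def[symmetric]
    by (auto simp: case_prod_beta X_def Q_def)
qed

lemma step_Start:
  assumes "length T = 3"
  shows "step (prog_tm N P) A (Start, T @ replicate N (tape_of [])) =
    (State 0, store_config N (\<lambda>_. 0, T))"
proof -
  have t: "act (Extra 0, Stay) (tape_of []) = reg_tape 0"
    by (auto simp: tape_of_def reg_tape_def)
  have "take 3 (keep (map scanned (T @ replicate N (tape_of [])))) = keep (map scanned T)"
    using assms by (simp add: keep_def)
  moreover have "map2 act (replicate N (Extra 0, Stay)) (replicate N (tape_of []))
      = map (\<lambda>i. reg_tape 0) [0..<N]"
    using t by (simp add: zip_replicate map_replicate_const)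
  ultimately show ?thesis using assms
    by (simp add: prog_tm_def store_config_def)
qed

lemma init_reach:
  "reach (com_tm c) A (init_config (com_tm c) x) (State 0, store_config (regs c) (init_store x))"
proof (rule reach_step)
  have "tape_of x # replicate (regs c + 2) (tape_of []) =
      snd (init_store x) @ replicate (regs c) (tape_of [])"
    by (simp add: init_store_def)
  then have "init_config (com_tm c) x =
      (Start, snd (init_store x) @ replicate (regs c) (tape_of []))"
    by (simp add: init_config_def com_tm_def prog_tm_def)
  moreover have "(\<lambda>_. 0, snd (init_store x)) = init_store x"
    by (simp add: init_store_def)
  ultimately show "step (com_tm c) A (init_config (com_tm c) x) =
      (State 0, store_config (regs c) (init_store x))"
    using step_Start[of "snd (init_store x)" "regs c" "compile c 0" A]
    by (simp add: com_tm_def init_store_def)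
qed

lemma code_at_self: "code_at P 0 P"
  by (simp add: code_at_def)

lemma exec_halts_with:
  assumes e: "exec A c (init_store x) S" and w: "word_on (snd S ! 1) y" and "io_wf c"
  shows "halts_with (com_tm c) A x y"
proof -
  let ?N = "regs c" and ?P = "compile c 0"
  have l: "length (snd S) = 3" using exec_length[OF e] by (simp add: init_store_def)
  have 1: "reach (com_tm c) A (State 0, store_config ?N (init_store x))
      (State (length ?P), store_config ?N S)"
    using exec_reach[OF e, of ?N ?P 0] assms(3) code_at_self
    by (simp add: init_store_def com_tm_def)
  have 2: "step (com_tm c) A (State (length ?P), store_config ?N S) = (Halt, store_config ?N S)"
    by (simp add: com_tm_def prog_tm_def)
  have "reach (com_tm c) A (init_config (com_tm c) x) (Halt, store_config ?N S)"
    using reach_trans[OF init_reach reach_trans[OF 1 reach_step[OF 2]]] .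
  moreover have "word_on (store_config ?N S ! 1) y"
    using w l by (simp add: store_config_io)
  ultimately show ?thesis unfolding halts_with_def reach_def by blast
qed

lemma funpow_step_Halt: "fst C = Halt \<Longrightarrow> (step M A ^^ k) C = C"
  by (induction k) (cases C, auto)+

lemma funpow_step_after_Halt:
  assumes "fst ((step M A ^^ k) C) = Halt" and "k \<le> l"
  shows "(step M A ^^ l) C = (step M A ^^ k) C"
proof -
  have "(step M A ^^ l) C = (step M A ^^ (l - k)) ((step M A ^^ k) C)"
    using assms(2) by (metis funpow_add le_add_diff_inverse2 o_apply)
  then show ?thesis using funpow_step_Halt[OF assms(1)] by simp
qed

lemma word_on_unique:
  assumes "word_on T x" and "word_on T y"
  shows "x = y"
proof -
  have "length x = length y"
  proof (rule ccontr)
    assume "length x \<noteq> length y"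
    then consider "length x < length y" | "length y < length x" by linarith
    then show False using assms unfolding word_on_def by cases blast+
  qed
  then show ?thesis using assms unfolding word_on_def by (auto intro: nth_equalityI)
qed

lemma halts_with_unique:
  assumes "halts_with M A x y" and "halts_with M A x z"
  shows "y = z"
proof -
  obtain k ts where k: "(step M A ^^ k) (init_config M x) = (Halt, ts)" "word_on (ts ! 1) y"
    using assms(1) unfolding halts_with_def by blast
  obtain l us where l: "(step M A ^^ l) (init_config M x) = (Halt, us)" "word_on (us ! 1) z"
    using assms(2) unfolding halts_with_def by blast
  have "ts = us"
    using funpow_step_after_Halt[of k M A "init_config M x" "max k l"]
      funpow_step_after_Halt[of l M A "init_config M x" "max k l"] k l by simp
  then show ?thesis using k l word_on_unique by blast
qed

text \<open>\<open>X n\<close> is the store after \<open>n\<close> rounds of the loop. The zero test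
  alone takes a step, so \<open>n\<close> rounds take at least \<open>n\<close> steps; at
  arbitrarily late times the machine is thus at the address of the loop, whereas a halted machine
  stays in \<open>Halt\<close>.\<close>

lemma exec_diverges:
  assumes c: "exec A c (init_store x) (X 0)"
    and d: "\<And>n. exec A d (X n) (X (Suc n))"
    and r: "\<And>n. fst (X n) r \<noteq> 0"
    and wf: "io_wf (c ;; While r d ;; e)"
  shows "\<not> halts_with (com_tm (c ;; While r d ;; e)) A x y"
proof
  let ?c = "c ;; While r d ;; e"
  define P where "P = compile ?c 0"
  define N where "N = regs ?c"
  define M where "M = com_tm ?c"
  define I where "I = init_config M x"
  define s where "s = length (compile c 0)"
  let ?u = "compile d (Suc s)"
  assume "halts_with (com_tm ?c) A x y"
  then have "halts_with M A x y" unfolding M_def .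
  then obtain k ts where k: "(step M A ^^ k) I = (Halt, ts)"
    unfolding halts_with_def I_def by blast
  have M: "M = prog_tm N P" by (simp only: M_def com_tm_def N_def P_def)
  have N: "regs c \<le> N" "regs d \<le> N" "r < N" by (auto simp: N_def)
  have l: "length (snd (X n)) = 3" for n
    by (induction n) (use exec_length[OF c] exec_length[OF d] in \<open>auto simp: init_store_def\<close>)
  have "P = compile c 0 @ compile (While r d) s @ compile e (s + length (compile (While r d) s))"
    by (simp add: P_def s_def Let_def)
  then have P: "code_at P 0 (compile c 0)" "code_at P s (compile (While r d) s)"
    using code_at_self[of P] by (metis code_at_append s_def add_0, metis code_at_append s_def add_0)
  have s: "s < length P" "P ! s = Jz r (s + length ?u + 2)"
    and u: "code_at P (Suc s) ?u"
    and j: "s + length ?u + 1 < length P" "P ! (s + length ?u + 1) = Jmp s"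
    using P(2) by (auto simp: code_at_Cons code_at_append Let_def)
  have start: "reach M A I (State s, store_config N (X 0))"
  proof (rule reach_trans)
    show "reach M A I (State 0, store_config N (init_store x))"
      unfolding I_def M_def N_def by (rule init_reach)
    show "reach M A (State 0, store_config N (init_store x)) (State s, store_config N (X 0))"
      using exec_reach[OF c, of N P 0] P(1) wf N
      unfolding M s_def by (simp add: init_store_def)
  qed
  have iter: "\<exists>m>0. (step M A ^^ m) (State s, store_config N (X n)) =
      (State s, store_config N (X (Suc n)))" for n
  proof -
    have 1: "step M A (State s, store_config N (X n)) = (State (Suc s), store_config N (X n))"
      unfolding M using step_Jz[OF s, of N "X n" A] l r N by simp
    have 2: "reach M A (State (Suc s), store_config N (X n))
        (State (s + length ?u + 1), store_config N (X (Suc n)))"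
      unfolding M using exec_reach[OF d l _ _ u, of N n] wf N by simp
    have 3: "reach M A (State (s + length ?u + 1), store_config N (X (Suc n)))
        (State s, store_config N (X (Suc n)))"
      unfolding M using step_Jmp[OF j] by (intro reach_step)
    obtain m where m: "(step M A ^^ m) (State (Suc s), store_config N (X n)) =
        (State s, store_config N (X (Suc n)))"
      using reach_trans[OF 2 3] unfolding reach_def by blast
    have "(step M A ^^ Suc m) (State s, store_config N (X n)) =
        (State s, store_config N (X (Suc n)))"
      by (simp only: funpow_Suc_right o_apply 1 m)
    then show ?thesis by blast
  qed
  have "\<exists>m\<ge>n. (step M A ^^ m) I = (State s, store_config N (X n))" for n
  proof (induction n)
    case 0
    then show ?case using start unfolding reach_def by blast
  next
    case (Suc n)
    then obtain m where m: "m \<ge> n" "(step M A ^^ m) I = (State s, store_config N (X n))"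
      by blast
    obtain m' where m': "m' > 0" "(step M A ^^ m') (State s, store_config N (X n)) =
      (State s, store_config N (X (Suc n)))" using iter by blast
    have "(step M A ^^ (m' + m)) I = (State s, store_config N (X (Suc n)))"
      using m m' by (simp add: funpow_add)
    then show ?case using m m' by (intro exI[of _ "m' + m"]) auto
  qed
  then obtain m where m: "m \<ge> k" "(step M A ^^ m) I = (State s, store_config N (X k))" by blast
  have "fst ((step M A ^^ k) I) = Halt" unfolding k by (rule fst_conv)
  then have "(State s, store_config N (X k)) = (Halt, ts)"
    by (rule trans[OF trans[OF m(2)[symmetric] funpow_step_after_Halt[OF _ m(1)]] k])
  then show False by blast
qed

section \<open>Functions computed by while-programs\<close>

lemma exec_Inc': "S = (\<sigma>(r := Suc (\<sigma> r)), T) \<Longrightarrow> exec A (Inc r) (\<sigma>, T) S"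
  by (simp add: exec_Inc)

lemma exec_Dec': "S = (\<sigma>(r := \<sigma> r - 1), T) \<Longrightarrow> exec A (Dec r) (\<sigma>, T) S"
  by (simp only: exec_Dec)

lemma exec_While_once:
  "fst S r \<noteq> 0 \<Longrightarrow> exec A c S S' \<Longrightarrow> fst S' r = 0 \<Longrightarrow> exec A (While r c) S S'"
  by (rule exec_While[OF _ _ exec_While_0])

definition clear :: "nat \<Rightarrow> com" where
  "clear a = While a (Dec a)"

lemma exec_clear: "exec A (clear a) (\<sigma>, T) (\<sigma>(a := 0), T)"
proof (induction n \<equiv> "\<sigma> a" arbitrary: \<sigma>)
  case 0
  then have "\<sigma>(a := 0) = \<sigma>" by auto
  then show ?case using 0 by (simp add: clear_def exec_While_0)
next
  case (Suc n)
  have 1: "exec A (clear a) (\<sigma>(a := n), T) (\<sigma>(a := 0), T)" using Suc.hyps(1)[of "\<sigma>(a := n)"] by simp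
  have 2: "exec A (Dec a) (\<sigma>, T) (\<sigma>(a := n), T)"
    by (rule exec_Dec') (simp flip: Suc.hyps(2))
  show ?case unfolding clear_def
    by (rule exec_While[OF _ 2 1[unfolded clear_def]]) (simp flip: Suc.hyps(2))
qed

definition copy :: "nat \<Rightarrow> nat \<Rightarrow> nat \<Rightarrow> com" where
  "copy a b c = While a (Dec a ;; Inc b ;; Inc c)"

definition move :: "nat \<Rightarrow> nat \<Rightarrow> com" where
  "move a b = While a (Dec a ;; Inc b)"

definition dup :: "nat \<Rightarrow> nat \<Rightarrow> nat \<Rightarrow> com" where
  "dup a b c = copy a b c ;; move c a"

lemma exec_copy:
  "distinct [a, b, c] \<Longrightarrow>
    exec A (copy a b c) (\<sigma>, T) (\<sigma>(a := 0, b := \<sigma> b + \<sigma> a, c := \<sigma> c + \<sigma> a), T)"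
proof (induction n \<equiv> "\<sigma> a" arbitrary: \<sigma>)
  case 0
  then have "\<sigma>(a := 0, b := \<sigma> b + \<sigma> a, c := \<sigma> c + \<sigma> a) = \<sigma>" by auto
  moreover have "exec A (copy a b c) (\<sigma>, T) (\<sigma>, T)"
    unfolding copy_def by (rule exec_While_0) (simp flip: 0(1))
  ultimately show ?case by (simp only:)
next
  case (Suc n)
  let ?\<sigma> = "\<sigma>(a := n, b := Suc (\<sigma> b), c := Suc (\<sigma> c))"
  have 1: "exec A (Dec a ;; Inc b ;; Inc c) (\<sigma>, T) (?\<sigma>, T)"
    by (rule exec_Seq[OF exec_Dec exec_Seq[OF exec_Inc exec_Inc']])
      (use Suc.prems in \<open>auto simp flip: Suc.hyps(2)\<close>)
  have 2: "exec A (copy a b c) (?\<sigma>, T)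
      (?\<sigma>(a := 0, b := ?\<sigma> b + ?\<sigma> a, c := ?\<sigma> c + ?\<sigma> a), T)"
    using Suc.hyps(1)[of ?\<sigma>] Suc.prems by simp
  have 3: "?\<sigma>(a := 0, b := ?\<sigma> b + ?\<sigma> a, c := ?\<sigma> c + ?\<sigma> a) =
      \<sigma>(a := 0, b := \<sigma> b + \<sigma> a, c := \<sigma> c + \<sigma> a)"
    using Suc.prems by (auto simp: fun_eq_iff simp flip: Suc.hyps(2))
  show ?case unfolding copy_def
    by (rule exec_While[OF _ 1 2[unfolded 3 copy_def]]) (simp flip: Suc.hyps(2))
qed

lemma exec_move:
  "a \<noteq> b \<Longrightarrow> exec A (move a b) (\<sigma>, T) (\<sigma>(a := 0, b := \<sigma> b + \<sigma> a), T)"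
proof (induction n \<equiv> "\<sigma> a" arbitrary: \<sigma>)
  case 0
  then have "\<sigma>(a := 0, b := \<sigma> b + \<sigma> a) = \<sigma>" by auto
  moreover have "exec A (move a b) (\<sigma>, T) (\<sigma>, T)"
    unfolding move_def by (rule exec_While_0) (simp flip: 0(1))
  ultimately show ?case by (simp only:)
next
  case (Suc n)
  let ?\<sigma> = "\<sigma>(a := n, b := Suc (\<sigma> b))"
  have 1: "exec A (Dec a ;; Inc b) (\<sigma>, T) (?\<sigma>, T)"
    by (rule exec_Seq[OF exec_Dec exec_Inc'])
      (use Suc.prems in \<open>auto simp flip: Suc.hyps(2)\<close>)
  have 2: "exec A (move a b) (?\<sigma>, T) (?\<sigma>(a := 0, b := ?\<sigma> b + ?\<sigma> a), T)"
    using Suc.hyps(1)[of ?\<sigma>] Suc.prems by simp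
  have 3: "?\<sigma>(a := 0, b := ?\<sigma> b + ?\<sigma> a) = \<sigma>(a := 0, b := \<sigma> b + \<sigma> a)"
    using Suc.prems by (auto simp: fun_eq_iff simp flip: Suc.hyps(2))
  show ?case unfolding move_def
    by (rule exec_While[OF _ 1 2[unfolded 3 move_def]]) (simp flip: Suc.hyps(2))
qed

lemma exec_move':
  "a \<noteq> b \<Longrightarrow> S = (\<sigma>(a := 0, b := \<sigma> b + \<sigma> a), T) \<Longrightarrow> exec A (move a b) (\<sigma>, T) S"
  using exec_move by simp

lemma exec_dup:
  assumes "distinct [a, b, c]" and "\<sigma> c = 0"
  shows "exec A (dup a b c) (\<sigma>, T) (\<sigma>(b := \<sigma> b + \<sigma> a), T)"
  unfolding dup_def
  by (rule exec_Seq[OF exec_copy exec_move']) (use assms in auto)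

lemma io_wf_moves [simp]:
  "io_wf (clear a)" "io_wf (copy a b c)" "io_wf (move a b)" "io_wf (dup a b c)"
  by (simp_all add: clear_def copy_def move_def dup_def)

text \<open>Computes \<open>prod_encode (m, n) = triangle (m + n) + m\<close> from \<open>m\<close>
  in register \<open>b+3\<close> and \<open>n\<close> in \<open>b+4\<close>: the copy leaves
  \<open>m\<close> in \<open>b\<close> and \<open>m + n\<close> in \<open>b+4\<close>, and the loop
  adds \<open>m + n\<close>, \<open>m + n - 1\<close>, ..., 1 to \<open>b\<close>.\<close>

definition encode_pair :: "nat \<Rightarrow> com" where
  "encode_pair b = copy (b+3) b (b+4) ;;
     While (b+4) (copy (b+4) b (b+5) ;; Dec (b+5) ;; move (b+5) (b+4))"

lemma exec_triangle:
  "\<sigma> (b+5) = 0 \<Longrightarrow>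
    exec A (While (b+4) (copy (b+4) b (b+5) ;; Dec (b+5) ;; move (b+5) (b+4)))
      (\<sigma>, T) (\<sigma>(b := \<sigma> b + triangle (\<sigma> (b+4)), b+4 := 0), T)"
proof (induction n \<equiv> "\<sigma> (b+4)" arbitrary: \<sigma>)
  case 0
  then have "\<sigma>(b := \<sigma> b + triangle (\<sigma> (b+4)), b+4 := 0) = \<sigma>"
    by (auto simp: triangle_def fun_eq_iff simp flip: 0(1))
  moreover have "fst (\<sigma>, T) (b+4) = 0" using 0(1) by simp
  ultimately show ?case using exec_While_0 by metis
next
  case (Suc n)
  let ?\<sigma> = "\<sigma>(b := \<sigma> b + Suc n, b+4 := n)"
  have 1: "exec A (copy (b+4) b (b+5) ;; Dec (b+5) ;; move (b+5) (b+4)) (\<sigma>, T) (?\<sigma>, T)"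
    by (rule exec_Seq[OF exec_copy exec_Seq[OF exec_Dec exec_move']])
      (use Suc.prems Suc.hyps(2)[symmetric] in \<open>auto simp: fun_eq_iff\<close>)
  have 2: "exec A (While (b+4) (copy (b+4) b (b+5) ;; Dec (b+5) ;; move (b+5) (b+4)))
      (?\<sigma>, T) (?\<sigma>(b := ?\<sigma> b + triangle (?\<sigma> (b+4)), b+4 := 0), T)"
    using Suc.hyps(1)[of ?\<sigma>] Suc.prems by simp
  have 3: "?\<sigma>(b := ?\<sigma> b + triangle (?\<sigma> (b+4)), b+4 := 0) =
      \<sigma>(b := \<sigma> b + triangle (\<sigma> (b+4)), b+4 := 0)"
    by (auto simp: fun_eq_iff simp flip: Suc.hyps(2))
  show ?case by (rule exec_While[OF _ 1 2[unfolded 3]]) (simp flip: Suc.hyps(2))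
qed

lemma exec_encode_pair:
  assumes "\<sigma> b = 0" and "\<sigma> (b+5) = 0"
  shows "exec A (encode_pair b) (\<sigma>, T)
    (\<sigma>(b := prod_encode (\<sigma> (b+3), \<sigma> (b+4)), b+3 := 0, b+4 := 0), T)"
proof -
  let ?\<sigma> = "\<sigma>(b+3 := 0, b := \<sigma> b + \<sigma> (b+3), b+4 := \<sigma> (b+4) + \<sigma> (b+3))"
  have 1: "exec A (copy (b+3) b (b+4)) (\<sigma>, T) (?\<sigma>, T)"
    by (rule exec_copy) auto
  have 2: "exec A (While (b+4) (copy (b+4) b (b+5) ;; Dec (b+5) ;; move (b+5) (b+4)))
      (?\<sigma>, T) (?\<sigma>(b := ?\<sigma> b + triangle (?\<sigma> (b+4)), b+4 := 0), T)"
    by (rule exec_triangle) (use assms in auto)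
  have 3: "?\<sigma>(b := ?\<sigma> b + triangle (?\<sigma> (b+4)), b+4 := 0) =
      \<sigma>(b := prod_encode (\<sigma> (b+3), \<sigma> (b+4)), b+3 := 0, b+4 := 0)"
    using assms by (auto simp: fun_eq_iff prod_encode_def add.commute)
  show ?thesis unfolding encode_pair_def using exec_Seq[OF 1 2] unfolding 3 .
qed

text \<open>One step along the diagonals of the enumeration of pairs, from
  \<open>prod_decode y\<close> to \<open>prod_decode (Suc y)\<close>. In place of a conditional, the
  flag \<open>b+5\<close> is set in advance and cleared by the first loop if the second component is
  positive; then exactly one of the other two loops runs, and only once.\<close>

definition decode_step :: "nat \<Rightarrow> com" where
  "decode_step b = Inc (b+5) ;;
     While (b+4) (Dec (b+5) ;; move (b+4) (b+6)) ;;
     While (b+5) (Dec (b+5) ;; move (b+3) (b+4) ;; Inc (b+4)) ;;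
     While (b+6) (Inc (b+3) ;; Dec (b+6) ;; move (b+6) (b+4))"

lemma exec_decode_step:
  assumes z: "\<sigma> (b+5) = 0" "\<sigma> (b+6) = 0"
  shows "exec A (decode_step b) (\<sigma>, T)
    (if \<sigma> (b+4) = 0 then \<sigma>(b+3 := 0, b+4 := Suc (\<sigma> (b+3)))
     else \<sigma>(b+3 := Suc (\<sigma> (b+3)), b+4 := \<sigma> (b+4) - 1), T)"
proof (cases "\<sigma> (b+4) = 0")
  case True
  let ?\<sigma> = "\<sigma>(b+3 := 0, b+4 := Suc (\<sigma> (b+3)))"
  have 1: "exec A (Inc (b+5)) (\<sigma>, T) (\<sigma>(b+5 := 1), T)"
    by (rule exec_Inc') (simp add: z)
  have 2: "exec A (While (b+4) (Dec (b+5) ;; move (b+4) (b+6))) (\<sigma>(b+5 := 1), T) (\<sigma>(b+5 := 1), T)"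
    by (rule exec_While_0) (simp add: True)
  have 3: "exec A (While (b+5) (Dec (b+5) ;; move (b+3) (b+4) ;; Inc (b+4))) (\<sigma>(b+5 := 1), T) (?\<sigma>, T)"
  proof (rule exec_While_once)
    show "exec A (Dec (b+5) ;; move (b+3) (b+4) ;; Inc (b+4)) (\<sigma>(b+5 := 1), T) (?\<sigma>, T)"
      by (rule exec_Seq[OF exec_Dec exec_Seq[OF exec_move exec_Inc']])
        (use True z in \<open>auto simp: fun_eq_iff\<close>)
  qed (use z in auto)
  have 4: "exec A (While (b+6) (Inc (b+3) ;; Dec (b+6) ;; move (b+6) (b+4))) (?\<sigma>, T) (?\<sigma>, T)"
    by (rule exec_While_0) (simp add: z)
  show ?thesis unfolding decode_step_def
    using exec_Seq[OF 1 exec_Seq[OF 2 exec_Seq[OF 3 4]]] True by simp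
next
  case False
  let ?\<rho> = "\<sigma>(b+4 := 0, b+6 := \<sigma> (b+4))"
  let ?\<sigma> = "\<sigma>(b+3 := Suc (\<sigma> (b+3)), b+4 := \<sigma> (b+4) - 1)"
  have 1: "exec A (Inc (b+5)) (\<sigma>, T) (\<sigma>(b+5 := 1), T)"
    by (rule exec_Inc') (simp add: z)
  have 2: "exec A (While (b+4) (Dec (b+5) ;; move (b+4) (b+6))) (\<sigma>(b+5 := 1), T) (?\<rho>, T)"
  proof (rule exec_While_once)
    show "exec A (Dec (b+5) ;; move (b+4) (b+6)) (\<sigma>(b+5 := 1), T) (?\<rho>, T)"
      by (rule exec_Seq[OF exec_Dec exec_move']) (use z in \<open>auto simp: fun_eq_iff\<close>)
  qed (use False in auto)
  have 3: "exec A (While (b+5) (Dec (b+5) ;; move (b+3) (b+4) ;; Inc (b+4))) (?\<rho>, T) (?\<rho>, T)"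
    by (rule exec_While_0) (simp add: z)
  have 4: "exec A (While (b+6) (Inc (b+3) ;; Dec (b+6) ;; move (b+6) (b+4))) (?\<rho>, T) (?\<sigma>, T)"
  proof (rule exec_While_once)
    show "exec A (Inc (b+3) ;; Dec (b+6) ;; move (b+6) (b+4)) (?\<rho>, T) (?\<sigma>, T)"
      by (rule exec_Seq[OF exec_Inc exec_Seq[OF exec_Dec exec_move']])
        (use z in \<open>auto simp: fun_eq_iff\<close>)
  qed (use False z in auto)
  show ?thesis unfolding decode_step_def
    using exec_Seq[OF 1 exec_Seq[OF 2 exec_Seq[OF 3 4]]] False by simp
qed

lemma prod_decode_Suc:
  "prod_decode (Suc y) = (case prod_decode y of (m, n) \<Rightarrow> if n = 0 then (0, Suc m) else (Suc m, n - 1))"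
proof -
  obtain m n where mn: "prod_decode y = (m, n)" by fastforce
  then have y: "y = prod_encode (m, n)" by (metis prod_decode_inverse)
  have "Suc y = prod_encode (if n = 0 then (0, Suc m) else (Suc m, n - 1))"
    unfolding y by (cases n) (auto simp: prod_encode_def)
  then have "prod_decode (Suc y) = (if n = 0 then (0, Suc m) else (Suc m, n - 1))"
    by (metis prod_encode_inverse)
  then show ?thesis using mn by simp
qed

definition decode_pair :: "nat \<Rightarrow> com" where
  "decode_pair b = While b (Dec b ;; decode_step b)"

text \<open>\<open>y\<close> is the index of the pair reached so far. Counting up to the code avoids
  inverting the triangular numbers.\<close>

lemma exec_decode_pair_aux:
  assumes "\<sigma> (b+5) = 0" "\<sigma> (b+6) = 0" "(\<sigma> (b+3), \<sigma> (b+4)) = prod_decode y"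
  shows "exec A (decode_pair b) (\<sigma>, T)
    (\<sigma>(b := 0, b+3 := fst (prod_decode (y + \<sigma> b)), b+4 := snd (prod_decode (y + \<sigma> b))), T)"
  using assms
proof (induction n \<equiv> "\<sigma> b" arbitrary: \<sigma> y)
  case 0
  have "fst (prod_decode y) = \<sigma> (b+3)" "snd (prod_decode y) = \<sigma> (b+4)"
    using 0(4) by (metis fst_conv, metis snd_conv)
  then have "\<sigma>(b := 0, b+3 := fst (prod_decode (y + \<sigma> b)), b+4 := snd (prod_decode (y + \<sigma> b))) = \<sigma>"
    using 0(1) by (auto simp: fun_eq_iff)
  moreover have "exec A (decode_pair b) (\<sigma>, T) (\<sigma>, T)"
    unfolding decode_pair_def by (rule exec_While_0) (simp flip: 0(1))
  ultimately show ?case by (simp only:)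
next
  case (Suc n)
  let ?p = "prod_decode (Suc y)"
  let ?\<sigma> = "\<sigma>(b := n, b+3 := fst ?p, b+4 := snd ?p)"
  have p: "?p = (if \<sigma> (b+4) = 0 then (0, Suc (\<sigma> (b+3))) else (Suc (\<sigma> (b+3)), \<sigma> (b+4) - 1))"
    by (simp add: prod_decode_Suc flip: Suc.prems(3))
  have 1: "exec A (decode_step b) (\<sigma>(b := n), T) (?\<sigma>, T)"
    using exec_decode_step[of "\<sigma>(b := n)" b A T] Suc.prems(1,2)
    unfolding p by (auto split: if_splits)
  have 2: "exec A (Dec b) (\<sigma>, T) (\<sigma>(b := n), T)"
    by (rule exec_Dec') (simp flip: Suc.hyps(2))
  have 3: "exec A (decode_pair b) (?\<sigma>, T)
     (?\<sigma>(b := 0, b+3 := fst (prod_decode (Suc y + ?\<sigma> b)), b+4 := snd (prod_decode (Suc y + ?\<sigma> b))), T)"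
    using Suc.hyps(1)[of ?\<sigma> "Suc y"] Suc.prems by simp
  have 4: "?\<sigma>(b := 0, b+3 := fst (prod_decode (Suc y + ?\<sigma> b)), b+4 := snd (prod_decode (Suc y + ?\<sigma> b)))
    = \<sigma>(b := 0, b+3 := fst (prod_decode (y + \<sigma> b)), b+4 := snd (prod_decode (y + \<sigma> b)))"
    by (auto simp: fun_eq_iff simp flip: Suc.hyps(2))
  show ?case unfolding decode_pair_def
    by (rule exec_While[OF _ exec_Seq[OF 2 1] 3[unfolded 4 decode_pair_def]]) (simp flip: Suc.hyps(2))
qed

lemma exec_decode_pair:
  assumes "\<sigma> (b+3) = 0" "\<sigma> (b+4) = 0" "\<sigma> (b+5) = 0" "\<sigma> (b+6) = 0"
  shows "exec A (decode_pair b) (\<sigma>, T)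
    (\<sigma>(b := 0, b+3 := fst (prod_decode (\<sigma> b)), b+4 := snd (prod_decode (\<sigma> b))), T)"
proof -
  have "prod_encode (0, 0) = 0" by (simp add: prod_encode_def)
  then have "prod_decode 0 = (0, 0)" by (metis prod_encode_inverse)
  then show ?thesis using exec_decode_pair_aux[of \<sigma> b 0 A T] assms by simp
qed

lemma io_wf_pair [simp]: "io_wf (encode_pair b)" "io_wf (decode_pair b)"
  by (simp_all add: encode_pair_def decode_pair_def decode_step_def)

text \<open>Registers above \<open>b\<close> must be zero before the run and are zero again after
  it, and nothing but \<open>b\<close> changes. A program can thus work on a block of registers
  above live data. As programs are not relocated, \<open>computable\<close> asks for one at every
  base \<open>b\<close>.\<close>

definition implements :: "com \<Rightarrow> nat \<Rightarrow> (nat \<Rightarrow> nat) \<Rightarrow> bool" where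
  "implements c b f \<longleftrightarrow> io_wf c \<and>
     (\<forall>A \<sigma> T. (\<forall>i>b. \<sigma> i = 0) \<longrightarrow> exec A c (\<sigma>, T) (\<sigma>(b := f (\<sigma> b)), T))"

definition computable :: "(nat \<Rightarrow> nat) \<Rightarrow> bool" where
  "computable f \<longleftrightarrow> (\<forall>b. \<exists>c. implements c b f)"

lemma implementsD:
  "implements c b f \<Longrightarrow> (\<And>i. i > b \<Longrightarrow> \<sigma> i = 0) \<Longrightarrow> S = (\<sigma>(b := f (\<sigma> b)), T) \<Longrightarrow>
    exec A c (\<sigma>, T) S"
  unfolding implements_def by blast

lemma implements_io_wf: "implements c b f \<Longrightarrow> io_wf c"
  unfolding implements_def by blast

section \<open>Closure properties of computable functions\<close>

lemma computable_Suc: "computable Suc"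
  unfolding computable_def implements_def
  by (intro allI exI[of _ "Inc b" for b]) (auto intro: exec_Inc)

lemma computable_pred: "computable (\<lambda>x. x - 1)"
  unfolding computable_def implements_def
  by (intro allI exI[of _ "Dec b" for b]) (auto intro: exec_Dec simp del: One_nat_def)

lemma computable_zero: "computable (\<lambda>_. 0)"
  unfolding computable_def implements_def
  by (intro allI exI[of _ "clear b" for b]) (auto intro: exec_clear)

lemma computable_comp:
  assumes "computable f" and "computable g"
  shows "computable (\<lambda>x. f (g x))"
  unfolding computable_def
proof
  fix b
  obtain c d where c: "implements c b f" and d: "implements d b g"
    using assms unfolding computable_def by meson
  have "exec A (d ;; c) (\<sigma>, T) (\<sigma>(b := f (g (\<sigma> b))), T)" if "\<forall>i>b. \<sigma> i = 0" for A \<sigma> T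
    by (rule exec_Seq[OF implementsD[OF d _ refl] implementsD[OF c]]) (use that in auto)
  then show "\<exists>c. implements c b (\<lambda>x. f (g x))"
    using c d unfolding implements_def by (intro exI[of _ "d ;; c"]) auto
qed

lemma computable_id: "computable (\<lambda>x. x)"
  using computable_comp[OF computable_pred computable_Suc] by simp

lemma computable_pair:
  assumes "computable f" and "computable g"
  shows "computable (\<lambda>x. prod_encode (f x, g x))"
  unfolding computable_def
proof
  fix b
  obtain c d where c: "implements c (b+3) f" and d: "implements d (b+4) g"
    using assms unfolding computable_def by meson
  let ?p = "dup b (b+3) (b+4) ;; c ;; dup b (b+4) (b+5) ;; d ;; clear b ;; encode_pair b"
  have "exec A ?p (\<sigma>, T) (\<sigma>(b := prod_encode (f (\<sigma> b), g (\<sigma> b))), T)"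
    if z: "\<forall>i>b. \<sigma> i = 0" for A \<sigma> T
  proof -
    let ?x = "\<sigma> b"
    have z': "\<sigma> (b+3) = 0" "\<sigma> (b+4) = 0" "\<sigma> (b+5) = 0" using z by auto
    have 1: "exec A (dup b (b+3) (b+4)) (\<sigma>, T) (\<sigma>(b+3 := ?x), T)"
      using exec_dup[of b "b+3" "b+4" \<sigma> A T] z' by simp
    have 2: "exec A c (\<sigma>(b+3 := ?x), T) (\<sigma>(b+3 := f ?x), T)"
      by (rule implementsD[OF c]) (use z in auto)
    have 3: "exec A (dup b (b+4) (b+5)) (\<sigma>(b+3 := f ?x), T) (\<sigma>(b+3 := f ?x, b+4 := ?x), T)"
      using exec_dup[of b "b+4" "b+5" "\<sigma>(b+3 := f ?x)" A T] z' by simp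
    have 4: "exec A d (\<sigma>(b+3 := f ?x, b+4 := ?x), T) (\<sigma>(b+3 := f ?x, b+4 := g ?x), T)"
      by (rule implementsD[OF d]) (use z in auto)
    have 5: "exec A (clear b) (\<sigma>(b+3 := f ?x, b+4 := g ?x), T) (\<sigma>(b+3 := f ?x, b+4 := g ?x, b := 0), T)"
      by (rule exec_clear)
    have "(\<sigma>(b+3 := f ?x, b+4 := g ?x, b := 0))(b := prod_encode (f ?x, g ?x), b+3 := 0, b+4 := 0)
        = \<sigma>(b := prod_encode (f ?x, g ?x))"
      using z' by (auto simp: fun_eq_iff)
    then have 6: "exec A (encode_pair b) (\<sigma>(b+3 := f ?x, b+4 := g ?x, b := 0), T)
        (\<sigma>(b := prod_encode (f ?x, g ?x)), T)"
      using exec_encode_pair[of "\<sigma>(b+3 := f ?x, b+4 := g ?x, b := 0)" b A T] z' by simp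
    show ?thesis
      by (rule exec_Seq[OF 1 exec_Seq[OF 2 exec_Seq[OF 3 exec_Seq[OF 4 exec_Seq[OF 5 6]]]]])
  qed
  then show "\<exists>c. implements c b (\<lambda>x. prod_encode (f x, g x))"
    using c d implements_io_wf unfolding implements_def[of ?p] implements_def
    by (intro exI[of _ ?p]) auto
qed

definition pfst :: "nat \<Rightarrow> nat" where "pfst x = fst (prod_decode x)"
definition psnd :: "nat \<Rightarrow> nat" where "psnd x = snd (prod_decode x)"

lemma pfst_encode [simp]: "pfst (prod_encode (a, b)) = a"
  by (simp add: pfst_def)

lemma psnd_encode [simp]: "psnd (prod_encode (a, b)) = b"
  by (simp add: psnd_def)

text \<open>The counter lies in \<open>b+3\<close>, below the base \<open>b+4\<close> of the
  iterated program, which therefore finds zeros above its base and leaves the counter alone.\<close>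

lemma computable_iter_base:
  assumes "computable f"
  shows "computable (\<lambda>x. (f ^^ pfst x) (psnd x))"
  unfolding computable_def
proof
  fix b
  obtain c where c: "implements c (b+4) f"
    using assms unfolding computable_def by meson
  let ?w = "While (b+3) (Dec (b+3) ;; c)"
  let ?p = "decode_pair b ;; ?w ;; move (b+4) b"
  have w: "exec A ?w (\<sigma>, T) (\<sigma>(b+3 := 0, b+4 := (f ^^ \<sigma> (b+3)) (\<sigma> (b+4))), T)"
    if "\<forall>i>b+4. \<sigma> i = 0" for A \<sigma> T
    using that
  proof (induction n \<equiv> "\<sigma> (b+3)" arbitrary: \<sigma>)
    case 0
    have "\<sigma>(b+3 := 0, b+4 := (f ^^ \<sigma> (b+3)) (\<sigma> (b+4))) = \<sigma>"
      by (auto simp: fun_eq_iff simp flip: 0(1))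
    moreover have "exec A ?w (\<sigma>, T) (\<sigma>, T)" by (rule exec_While_0) (simp flip: 0(1))
    ultimately show ?case by (simp only:)
  next
    case (Suc n)
    let ?\<sigma> = "\<sigma>(b+3 := n, b+4 := f (\<sigma> (b+4)))"
    have 1: "exec A (Dec (b+3) ;; c) (\<sigma>, T) (?\<sigma>, T)"
      by (rule exec_Seq[OF exec_Dec implementsD[OF c]])
        (use Suc.prems in \<open>auto simp flip: Suc.hyps(2)\<close>)
    have 2: "exec A ?w (?\<sigma>, T) (?\<sigma>(b+3 := 0, b+4 := (f ^^ ?\<sigma> (b+3)) (?\<sigma> (b+4))), T)"
      by (rule Suc.hyps(1)) (use Suc.prems in auto)
    have "?\<sigma>(b+3 := 0, b+4 := (f ^^ ?\<sigma> (b+3)) (?\<sigma> (b+4))) =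
        \<sigma>(b+3 := 0, b+4 := (f ^^ \<sigma> (b+3)) (\<sigma> (b+4)))"
      by (auto simp: fun_eq_iff funpow_swap1 simp flip: Suc.hyps(2))
    then show ?case using exec_While[OF _ 1 2] by (simp flip: Suc.hyps(2))
  qed
  have "exec A ?p (\<sigma>, T) (\<sigma>(b := (f ^^ pfst (\<sigma> b)) (psnd (\<sigma> b))), T)"
    if z: "\<forall>i>b. \<sigma> i = 0" for A \<sigma> T
  proof -
    let ?m = "pfst (\<sigma> b)" and ?n = "psnd (\<sigma> b)"
    let ?\<sigma> = "\<sigma>(b := 0, b+3 := ?m, b+4 := ?n)"
    have 1: "exec A (decode_pair b) (\<sigma>, T) (?\<sigma>, T)"
      unfolding pfst_def psnd_def by (rule exec_decode_pair) (use z in auto)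
    have 2: "exec A ?w (?\<sigma>, T) (?\<sigma>(b+3 := 0, b+4 := (f ^^ ?\<sigma> (b+3)) (?\<sigma> (b+4))), T)"
      by (rule w) (use z in auto)
    have 3: "exec A (move (b+4) b) (?\<sigma>(b+3 := 0, b+4 := (f ^^ ?\<sigma> (b+3)) (?\<sigma> (b+4))), T)
        (\<sigma>(b := (f ^^ ?m) ?n), T)"
      by (rule exec_move') (use z in \<open>auto simp: fun_eq_iff\<close>)
    show ?thesis by (rule exec_Seq[OF 1 exec_Seq[OF 2 3]])
  qed
  then show "\<exists>c. implements c b (\<lambda>x. (f ^^ pfst x) (psnd x))"
    using c implements_io_wf unfolding implements_def
    by (intro exI[of _ ?p]) auto
qed

lemma computable_pfst: "computable pfst"
  unfolding computable_def
proof
  fix b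
  let ?p = "decode_pair b ;; clear (b+4) ;; move (b+3) b"
  have "exec A ?p (\<sigma>, T) (\<sigma>(b := pfst (\<sigma> b)), T)"
    if z: "\<forall>i>b. \<sigma> i = 0" for A \<sigma> T
    unfolding pfst_def
    by (rule exec_Seq[OF exec_decode_pair exec_Seq[OF exec_clear exec_move']])
      (use z in \<open>auto simp: fun_eq_iff\<close>)
  then show "\<exists>c. implements c b pfst"
    unfolding implements_def by (intro exI[of _ ?p]) auto
qed

lemma computable_psnd: "computable psnd"
  unfolding computable_def
proof
  fix b
  let ?p = "decode_pair b ;; clear (b+3) ;; move (b+4) b"
  have "exec A ?p (\<sigma>, T) (\<sigma>(b := psnd (\<sigma> b)), T)"
    if z: "\<forall>i>b. \<sigma> i = 0" for A \<sigma> T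
    unfolding psnd_def
    by (rule exec_Seq[OF exec_decode_pair exec_Seq[OF exec_clear exec_move']])
      (use z in \<open>auto simp: fun_eq_iff\<close>)
  then show "\<exists>c. implements c b psnd"
    unfolding implements_def by (intro exI[of _ ?p]) auto
qed

section \<open>Arithmetic and strings\<close>

named_theorems comp_intros

lemma computable_const [comp_intros]: "computable (\<lambda>_. n)"
proof (induction n)
  case 0
  show ?case by (rule computable_zero)
next
  case (Suc n)
  then show ?case using computable_comp[OF computable_Suc] by blast
qed

lemmas [comp_intros] = computable_id computable_pair computable_comp[OF computable_Suc]
  computable_comp[OF computable_pfst] computable_comp[OF computable_psnd]

text \<open>The parameter travels along: the map that is iterated acts on pairs and copies
  \<open>x\<close> unchanged, so \<open>f\<close> may depend on it.\<close>

lemma computable_iter [comp_intros]: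
  assumes "computable (\<lambda>p. f (pfst p) (psnd p))" and "computable n" and "computable a"
  shows "computable (\<lambda>x. (f x ^^ n x) (a x))"
proof -
  let ?F = "\<lambda>p. prod_encode (pfst p, f (pfst p) (psnd p))"
  have "computable ?F" by (intro comp_intros assms)
  then have "computable (\<lambda>q. (?F ^^ pfst q) (psnd q))" by (rule computable_iter_base)
  then have "computable (\<lambda>x. (\<lambda>q. (?F ^^ pfst q) (psnd q))
      (prod_encode (n x, prod_encode (x, a x))))"
    by (rule computable_comp) (intro comp_intros assms)
  then have 1: "computable (\<lambda>x. (?F ^^ n x) (prod_encode (x, a x)))" by simp
  have 2: "(?F ^^ k) (prod_encode (x, y)) = prod_encode (x, (f x ^^ k) y)" for k x y
    by (induction k) auto
  have "computable (\<lambda>x. psnd ((?F ^^ n x) (prod_encode (x, a x))))"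
    by (rule computable_comp[OF computable_psnd 1])
  then show ?thesis unfolding 2 by simp
qed

lemma computable_rec [comp_intros]:
  assumes "computable a" and "computable (\<lambda>p. g (pfst p) (pfst (psnd p)) (psnd (psnd p)))"
    and "computable h"
  shows "computable (\<lambda>x. rec_nat (a x) (g x) (h x))"
proof -
  let ?F = "\<lambda>x q. prod_encode (Suc (pfst q), g x (pfst q) (psnd q))"
  have g: "computable (\<lambda>p. g (pfst p) (pfst (psnd p)) (psnd (psnd p)))" by (rule assms)
  have "(?F x ^^ k) (prod_encode (0, a x)) = prod_encode (k, rec_nat (a x) (g x) k)" for k x
    by (induction k) auto
  moreover have "computable (\<lambda>x. psnd ((?F x ^^ h x) (prod_encode (0, a x))))"
    by (intro comp_intros assms g)
  ultimately show ?thesis by simp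
qed

lemma computable_add [comp_intros]:
  assumes "computable f" and "computable g"
  shows "computable (\<lambda>x. f x + g x)"
proof -
  have "(Suc ^^ m) n = m + n" for m n by (induction m) auto
  moreover have "computable (\<lambda>x. (Suc ^^ f x) (g x))" by (intro comp_intros assms)
  ultimately show ?thesis by simp
qed

lemma computable_diff [comp_intros]:
  assumes "computable f" and "computable g"
  shows "computable (\<lambda>x. f x - g x)"
proof -
  have "((\<lambda>y. y - 1) ^^ m) n = n - m" for m n :: nat by (induction m) auto
  moreover have "computable (\<lambda>x. ((\<lambda>y. y - 1) ^^ g x) (f x))"
    by (intro computable_iter computable_comp[OF computable_pred] computable_psnd assms)
  ultimately show ?thesis by simp
qed

lemma computable_mult [comp_intros]:
  assumes "computable f" and "computable g"
  shows "computable (\<lambda>x. f x * g x)"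
proof -
  have "((\<lambda>y. y + n) ^^ m) 0 = m * n" for m n :: nat by (induction m) auto
  moreover have "computable (\<lambda>x. ((\<lambda>y. y + g x) ^^ f x) 0)"
    by (intro comp_intros assms computable_comp[OF assms(2)])
  ultimately show ?thesis by simp
qed

lemma computable_power [comp_intros]:
  assumes "computable f" and "computable g"
  shows "computable (\<lambda>x. f x ^ g x)"
proof -
  have "((\<lambda>y. m * y) ^^ n) 1 = m ^ n" for m n :: nat by (induction n) auto
  moreover have "computable (\<lambda>x. ((\<lambda>y. f x * y) ^^ g x) 1)"
    by (intro comp_intros assms computable_comp[OF assms(1)])
  ultimately show ?thesis by simp
qed

section \<open>Decidable predicates, division and bounded search\<close>

definition decidable :: "(nat \<Rightarrow> bool) \<Rightarrow> bool" where
  "decidable P \<longleftrightarrow> computable (\<lambda>x. of_bool (P x))"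

lemma computable_of_bool [comp_intros]: "decidable P \<Longrightarrow> computable (\<lambda>x. of_bool (P x))"
  by (simp add: decidable_def)

lemma decidable_not [comp_intros]:
  assumes "decidable P"
  shows "decidable (\<lambda>x. \<not> P x)"
proof -
  have "of_bool (\<not> p) = (1 :: nat) - of_bool p" for p by simp
  then show ?thesis unfolding decidable_def by (simp only:) (intro comp_intros assms)
qed

lemma decidable_conj [comp_intros]:
  "decidable P \<Longrightarrow> decidable Q \<Longrightarrow> decidable (\<lambda>x. P x \<and> Q x)"
  using computable_mult[of "\<lambda>x. of_bool (P x)" "\<lambda>x. of_bool (Q x)"]
  by (simp add: decidable_def of_bool_conj)

lemma decidable_disj [comp_intros]:
  "decidable P \<Longrightarrow> decidable Q \<Longrightarrow> decidable (\<lambda>x. P x \<or> Q x)"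
  using decidable_not[OF decidable_conj[OF decidable_not decidable_not], of P Q] by simp

lemma decidable_le [comp_intros]:
  assumes "computable f" and "computable g"
  shows "decidable (\<lambda>x. f x \<le> g x)"
proof -
  have "of_bool (a \<le> b) = 1 - (a - b)" for a b :: nat by auto
  then show ?thesis unfolding decidable_def by (simp only:) (intro comp_intros assms)
qed

lemma decidable_less [comp_intros]:
  assumes "computable f" and "computable g"
  shows "decidable (\<lambda>x. f x < g x)"
  unfolding less_eq_Suc_le by (intro comp_intros assms)

lemma decidable_eq [comp_intros]:
  assumes "computable f" and "computable g"
  shows "decidable (\<lambda>x. f x = g x)"
  unfolding eq_iff by (intro comp_intros assms)

lemma computable_if [comp_intros]:
  assumes "decidable P" and "computable f" and "computable g"
  shows "computable (\<lambda>x. if P x then f x else g x)"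
proof -
  have "(if b then m else n) = of_bool b * m + of_bool (\<not> b) * n" for b and m n :: nat by auto
  then show ?thesis by (simp only:) (intro comp_intros assms)
qed

lemma computable_sum [comp_intros]:
  assumes g: "computable (\<lambda>p. g (pfst p) (psnd p))" and "computable h"
  shows "computable (\<lambda>x. \<Sum>i<h x. g x i)"
proof -
  have "rec_nat 0 (\<lambda>i r. r + g x i) n = (\<Sum>i<n. g x i)" for x n by (induction n) auto
  moreover have "computable (\<lambda>x. rec_nat 0 (\<lambda>i r. r + g x i) (h x))"
    using computable_comp[OF g, of "\<lambda>p. prod_encode (pfst p, pfst (psnd p))"]
    by (intro comp_intros assms) (simp add: comp_intros)
  ultimately show ?thesis by simp
qed

text \<open>The quotient counts the positive multiples of \<open>b\<close> up to \<open>a\<close>,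
  and bounded sums are already available. The factor in front handles division by 0.\<close>

lemma div_eq_sum: "a div b = of_bool (b \<noteq> 0) * (\<Sum>i<a. of_bool (Suc i * b \<le> a))" for a b :: nat
proof (cases "b = 0")
  case False
  have "(\<Sum>i<a. of_bool (Suc i * b \<le> a)) = card {i. i < a \<and> Suc i * b \<le> a}"
    by (simp add: Int_def lessThan_def del: mult_Suc)
  also have "{i. i < a \<and> Suc i * b \<le> a} = {..<a div b}"
  proof (intro set_eqI)
    fix i
    have "Suc i * b \<le> a \<longleftrightarrow> i < a div b"
      using False by (simp add: less_eq_div_iff_mult_less_eq Suc_le_eq[symmetric] del: mult_Suc)
    moreover have "a div b \<le> a" by simp
    ultimately show "i \<in> {i. i < a \<and> Suc i * b \<le> a} \<longleftrightarrow> i \<in> {..<a div b}"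
      by (auto simp del: div_le_dividend)
  qed
  finally show ?thesis using False by simp
qed simp

lemma computable_div [comp_intros]:
  assumes "computable f" and "computable g"
  shows "computable (\<lambda>x. f x div g x)"
  unfolding div_eq_sum
  by (intro comp_intros assms computable_comp[OF assms(1)] computable_comp[OF assms(2)])

lemma computable_mod [comp_intros]:
  assumes "computable f" and "computable g"
  shows "computable (\<lambda>x. f x mod g x)"
  unfolding minus_mult_div_eq_mod[symmetric] by (intro comp_intros assms)

lemma decidable_even [comp_intros]: "computable f \<Longrightarrow> decidable (\<lambda>x. even (f x))"
  unfolding even_iff_mod_2_eq_zero by (intro comp_intros)

text \<open>The iteration stops moving at the first witness; without a witness below
  \<open>n\<close> the value is \<open>n\<close>. So \<open>P e\<close> together with
  \<open>search_below P e = e\<close> is a decidable way of saying that \<open>e\<close> is the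
  least witness.\<close>

definition search_below :: "(nat \<Rightarrow> bool) \<Rightarrow> nat \<Rightarrow> nat" where
  "search_below P n = ((\<lambda>i. if P i then i else Suc i) ^^ n) 0"

lemma computable_search_below [comp_intros]:
  assumes "decidable (\<lambda>p. P (pfst p) (psnd p))" and "computable n"
  shows "computable (\<lambda>x. search_below (P x) (n x))"
  unfolding search_below_def by (intro comp_intros assms)

lemma search_below_fail: "\<forall>i<k. \<not> P i \<Longrightarrow> n \<le> k \<Longrightarrow> search_below P n = n"
  by (induction n) (auto simp: search_below_def)

lemma search_below_eq:
  assumes "\<forall>i<k. \<not> P i" and "P k" and "k \<le> n"
  shows "search_below P n = k"
  using assms(3)
proof (induction n rule: dec_induct)
  case base
  show ?case using search_below_fail[OF assms(1)] by simp
next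
  case (step n)
  then show ?case using assms(2) by (simp add: search_below_def)
qed

lemma search_below_Least: "P k \<Longrightarrow> k \<le> n \<Longrightarrow> search_below P n = (LEAST i. P i)"
  by (rule search_below_eq) (auto dest: not_less_Least intro: LeastI Least_le[THEN order_trans])

text \<open>
  Bijective binary notation makes every number the code of a string, and \<open>enc s + 1\<close> is the
  length-lexicographic index of \<open>s\<close>.
\<close>

definition enc :: "bool list \<Rightarrow> nat" where
  "enc s = foldl (\<lambda>c b. 2 * c + 1 + of_bool b) 0 s"

fun dec :: "nat \<Rightarrow> bool list" where
  "dec n = (if n = 0 then [] else dec ((n - 1) div 2) @ [even n])"

declare dec.simps [simp del]

lemma dec_0 [simp]: "dec 0 = []"
  by (simp add: dec.simps)

lemma dec_pos: "n \<noteq> 0 \<Longrightarrow> dec n = dec ((n - 1) div 2) @ [even n]"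
  by (simp add: dec.simps)

lemma enc_Nil [simp]: "enc [] = 0"
  by (simp add: enc_def)

lemma enc_snoc [simp]: "enc (s @ [b]) = 2 * enc s + 1 + of_bool b"
  by (simp add: enc_def)

lemma dec_enc [simp]: "dec (enc s) = s"
  by (induction s rule: rev_induct) (auto simp: dec_pos)

lemma enc_dec [simp]: "enc (dec n) = n"
proof (induction n rule: less_induct)
  case (less n)
  show ?case
  proof (cases "n = 0")
    case False
    then have "enc (dec ((n - 1) div 2)) = (n - 1) div 2" by (intro less) auto
    then show ?thesis using False by (auto simp: dec_pos elim!: evenE oddE)
  qed simp
qed

lemma enc_inject [simp]: "enc s = enc t \<longleftrightarrow> s = t"
  by (metis dec_enc)

text \<open>Parity and halving take the last bit off a code, so the fold runs from the end of the
  string. Halving strictly decreases positive codes and a finished pair is a fixed point, which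
  makes the code itself a sufficient number of iterations.\<close>

lemma computable_foldr [comp_intros]:
  assumes g: "computable (\<lambda>p. g (pfst p) (pfst (psnd p)) (psnd (psnd p)))"
    and h: "computable h" and a: "computable a"
  shows "computable (\<lambda>x. foldr (\<lambda>b. g x (of_bool b)) (dec (h x)) (a x))"
proof -
  let ?F = "\<lambda>x q. if pfst q = 0 then q
    else prod_encode ((pfst q - 1) div 2, g x (of_bool (even (pfst q))) (psnd q))"
  have F: "(?F x ^^ n) (prod_encode (c, r)) = prod_encode (0, foldr (\<lambda>b. g x (of_bool b)) (dec c) r)"
    if "c \<le> n" for x n c r
    using that
  proof (induction n arbitrary: c r)
    case (Suc n)
    show ?case
    proof (cases "c = 0")
      case True
      have "(?F x ^^ m) (prod_encode (0, r)) = prod_encode (0, r)" for m by (induction m) auto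
      then show ?thesis using True by simp
    next
      case False
      then have "(c - 1) div 2 \<le> n" using Suc.prems by linarith
      then show ?thesis using Suc.IH False
        by (simp add: funpow_Suc_right dec_pos del: funpow.simps)
    qed
  qed simp
  have "computable (\<lambda>p. g (pfst p) (of_bool (even (pfst (psnd p)))) (psnd (psnd p)))"
    using computable_comp[OF g, of "\<lambda>p. prod_encode (pfst p,
      prod_encode (of_bool (even (pfst (psnd p))), psnd (psnd p)))"]
    by (simp add: comp_intros)
  then have "computable (\<lambda>x. psnd ((?F x ^^ h x) (prod_encode (h x, a x))))"
    by (intro comp_intros h a)
  then show ?thesis by (simp add: F)
qed

lemma computable_length_dec [comp_intros]:
  assumes "computable f"
  shows "computable (\<lambda>x. length (dec (f x)))"
proof -
  have "computable (\<lambda>x. foldr (\<lambda>b. (\<lambda>_ _ r. Suc r) x (of_bool b :: nat)) (dec (f x)) 0)"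
    by (rule computable_foldr) (intro comp_intros assms)+
  moreover have "foldr (\<lambda>b. Suc) xs n = length xs + n" for xs :: "bool list" and n
    by (induction xs) auto
  ultimately show ?thesis by simp
qed

lemma foldr_enc: "foldr (\<lambda>b r. 2 * r + 1 + of_bool b) xs (enc ys) = enc (ys @ rev xs)"
  by (induction xs) (auto simp flip: append_assoc)

text \<open>The fold delivers the bits of the second string from its end, so the reversed append
  comes first; reversing twice then gives the plain one.\<close>

lemma computable_append_rev:
  assumes "computable f" and "computable g"
  shows "computable (\<lambda>x. enc (dec (f x) @ rev (dec (g x))))"
proof -
  have "computable (\<lambda>x. foldr (\<lambda>b. (\<lambda>_ b r. 2 * r + 1 + b) x (of_bool b :: nat)) (dec (g x)) (f x))"
    by (rule computable_foldr) (intro comp_intros assms)+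
  then show ?thesis using foldr_enc[of "dec (g x)" "dec (f x)" for x] by simp
qed

lemma computable_rev [comp_intros]:
  "computable f \<Longrightarrow> computable (\<lambda>x. enc (rev (dec (f x))))"
  using computable_append_rev[OF computable_zero] by simp

lemma computable_append [comp_intros]:
  "computable f \<Longrightarrow> computable g \<Longrightarrow> computable (\<lambda>x. enc (dec (f x) @ dec (g x)))"
  using computable_append_rev[OF _ computable_rev] by simp

section \<open>Programs that query an oracle\<close>

text \<open>The head rests on the blank behind the word, where the next bit goes and where a query
  may be asked.\<close>

definition word_tape :: "bool list \<Rightarrow> tape" where
  "word_tape y = (fst (tape_of y), int (length y))"

lemma word_tape_Nil: "word_tape [] = tape_of []"
  by (simp add: word_tape_def tape_of_def)

lemma scanned_word_tape [simp]: "scanned (word_tape y) = Blank"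
  by (simp add: word_tape_def tape_of_def)

lemma word_on_word_tape: "word_on (word_tape y) x \<longleftrightarrow> x = y"
proof -
  have "word_on (word_tape y) y"
    by (simp add: word_on_def word_tape_def tape_of_def)
  then show ?thesis using word_on_unique by blast
qed

definition write_bit :: "bool \<Rightarrow> tape \<Rightarrow> tape" where
  "write_bit b T = act (Bit b, Stay) T"

lemma write_bit_twice [simp]: "write_bit b (write_bit a T) = write_bit b T"
  by (cases T) (simp add: write_bit_def)

lemma word_tape_snoc:
  "act (scanned (write_bit b (word_tape y)), MoveRight) (write_bit b (word_tape y)) = word_tape (y @ [b])"
  by (auto simp: write_bit_def word_tape_def tape_of_def fun_eq_iff nth_append nat_less_iff)

text \<open>\<open>Write\<close> takes a fixed symbol, so a computed bit is written as
  \<open>False\<close> and overwritten in a loop that runs once if the bit is set.\<close>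

definition emit :: "nat \<Rightarrow> nat \<Rightarrow> com \<Rightarrow> com \<Rightarrow> com" where
  "emit k b cbit chalf = While b (dup b (b+3) (b+4) ;; cbit ;; Write k (Some False) ;;
     While (b+3) (Dec (b+3) ;; Write k (Some True)) ;; Move k MoveRight ;; chalf)"

text \<open>The bits of a code are split off from its end, hence the reversal.\<close>

lemma exec_emit:
  assumes bit: "implements cbit (b+3) (\<lambda>v. of_bool (even v))"
    and half: "implements chalf b (\<lambda>v. (v - 1) div 2)"
  shows "\<lbrakk>\<forall>i>b. \<sigma> i = 0; k < length T; T ! k = word_tape y\<rbrakk> \<Longrightarrow>
    exec A (emit k b cbit chalf) (\<sigma>, T)
      (\<sigma>(b := 0), T[k := word_tape (y @ rev (dec (\<sigma> b)))])"
proof (induction v \<equiv> "\<sigma> b" arbitrary: \<sigma> T y rule: less_induct)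
  case less
  note z = less.prems(1) and k = less.prems(2,3)
  have z': "\<sigma> (b+3) = 0" "\<sigma> (b+4) = 0" using z by auto
  show ?case
  proof (cases "\<sigma> b = 0")
    case True
    then have "\<sigma>(b := 0) = \<sigma>" by auto
    moreover have "T[k := word_tape (y @ rev (dec (\<sigma> b)))] = T"
      using True k by (metis append_Nil2 dec_0 list_update_id rev.simps(1))
    moreover have "exec A (emit k b cbit chalf) (\<sigma>, T) (\<sigma>, T)"
      unfolding emit_def by (rule exec_While_0) (simp add: True)
    ultimately show ?thesis by (simp only:)
  next
    case False
    let ?v = "\<sigma> b" and ?e = "even (\<sigma> b)"
    let ?\<sigma> = "\<sigma>(b := (?v - 1) div 2)"
    let ?T = "T[k := word_tape (y @ [?e])]"
    let ?W = "\<lambda>a. T[k := write_bit a (word_tape y)]"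
    have 1: "exec A (dup b (b+3) (b+4)) (\<sigma>, T) (\<sigma>(b+3 := ?v), T)"
      using exec_dup[of b "b+3" "b+4" \<sigma> A T] z' by simp
    have 2: "exec A cbit (\<sigma>(b+3 := ?v), T) (\<sigma>(b+3 := of_bool ?e), T)"
      by (rule implementsD[OF bit]) (use z in auto)
    have 3: "exec A (Write k (Some False)) (\<sigma>(b+3 := of_bool ?e), T) (\<sigma>(b+3 := of_bool ?e), ?W False)"
      using exec_Write[of A k "Some False" _ T] k by (simp add: write_bit_def)
    have 4: "exec A (While (b+3) (Dec (b+3) ;; Write k (Some True)))
        (\<sigma>(b+3 := of_bool ?e), ?W False) (\<sigma>, ?W ?e)"
    proof (cases ?e)
      case True
      have s: "(\<sigma>(b+3 := of_bool ?e))(b+3 := (\<sigma>(b+3 := of_bool ?e)) (b+3) - 1) = \<sigma>"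
        using True z' by (auto simp: fun_eq_iff)
      have t: "(?W False)[k := act (opt_symbol (Some True), Stay) (?W False ! k)] = ?W ?e"
        using True k write_bit_twice[of True False "word_tape y"] by (simp add: write_bit_def)
      show ?thesis
      proof (rule exec_While_once)
        show "exec A (Dec (b+3) ;; Write k (Some True)) (\<sigma>(b+3 := of_bool ?e), ?W False) (\<sigma>, ?W ?e)"
          using exec_Seq[OF exec_Dec[of A "b+3" "\<sigma>(b+3 := of_bool ?e)" "?W False"]
              exec_Write[of A k "Some True"]]
          unfolding s t .
      qed (use True z' in auto)
    next
      case False
      then have "\<sigma>(b+3 := of_bool ?e) = \<sigma>" using z' by (auto simp: fun_eq_iff)
      then show ?thesis using False z' exec_While_0[of "(\<sigma>, ?W False)" "b+3" A] by simp
    qed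
    have 5: "exec A (Move k MoveRight) (\<sigma>, ?W ?e) (\<sigma>, ?T)"
      using exec_Move[of A k MoveRight \<sigma> "?W ?e"] k word_tape_snoc[of ?e y] by simp
    have 6: "exec A chalf (\<sigma>, ?T) (?\<sigma>, ?T)"
      by (rule implementsD[OF half]) (use z in auto)
    have 7: "exec A (emit k b cbit chalf) (?\<sigma>, ?T)
        (?\<sigma>(b := 0), ?T[k := word_tape ((y @ [?e]) @ rev (dec (?\<sigma> b)))])"
      by (rule less.hyps) (use False z k in auto)
    have 8: "?\<sigma>(b := 0) = \<sigma>(b := 0)" by auto
    have 9: "?T[k := word_tape ((y @ [?e]) @ rev (dec (?\<sigma> b)))] = T[k := word_tape (y @ rev (dec ?v))]"
      using dec_pos[OF False] by simp
    show ?thesis unfolding emit_def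
      by (rule exec_While[OF _ exec_Seq[OF 1 exec_Seq[OF 2 exec_Seq[OF 3 exec_Seq[OF 4 exec_Seq[OF 5 6]]]]]
            7[unfolded 8 9 emit_def]]) (simp add: False)
  qed
qed

text \<open>Starts on the blank behind the word, with the length of the word in \<open>b\<close>.
  Each round blanks a cell before moving left, so the first cell of the word is reached but not
  blanked; a further \<open>Write 2 None\<close> does that.\<close>

definition erase :: "nat \<Rightarrow> com" where
  "erase b = While b (Dec b ;; Write 2 None ;; Move 2 MoveLeft)"

lemma exec_erase:
  assumes "length T = 3" and "act (Blank, Stay) (T ! 2) = word_tape y" and "\<sigma> b = length y"
  shows "exec A (erase b ;; Write 2 None) (\<sigma>, T) (\<sigma>(b := 0), T[2 := word_tape []])"
proof -
  \<comment> \<open>The loop steps onto a bit before erasing it, so the invariant describes the tape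
    as it looks once the scanned cell has been blanked.\<close>
  have "\<exists>t. exec A (erase b) (\<sigma>, T) (\<sigma>(b := 0), T[2 := t]) \<and> act (Blank, Stay) t = word_tape []"
    using assms
  proof (induction y arbitrary: \<sigma> T rule: rev_induct)
    case Nil
    then have "\<sigma>(b := 0) = \<sigma>" by auto
    moreover have "exec A (erase b) (\<sigma>, T) (\<sigma>, T)"
      unfolding erase_def by (rule exec_While_0) (simp add: Nil)
    ultimately show ?case using Nil(2) by (intro exI[of _ "T ! 2"]) (simp del: act.simps)
  next
    case (snoc a y)
    let ?t = "(fst (tape_of (y @ [a])), int (length y))"
    have 1: "exec A (Dec b ;; Write 2 None ;; Move 2 MoveLeft) (\<sigma>, T)
        (\<sigma>(b := \<sigma> b - 1), T[2 := act (opt_symbol None, Stay) (T ! 2),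
          2 := act (scanned (T[2 := act (opt_symbol None, Stay) (T ! 2)] ! 2), MoveLeft)
              (T[2 := act (opt_symbol None, Stay) (T ! 2)] ! 2)])"
      by (rule exec_Seq[OF exec_Dec exec_Seq[OF exec_Write exec_Move]])
    have "act (scanned (word_tape (y @ [a])), MoveLeft) (word_tape (y @ [a])) = ?t"
      by (auto simp: word_tape_def)
    then have 2: "T[2 := act (opt_symbol None, Stay) (T ! 2),
          2 := act (scanned (T[2 := act (opt_symbol None, Stay) (T ! 2)] ! 2), MoveLeft)
              (T[2 := act (opt_symbol None, Stay) (T ! 2)] ! 2)] = T[2 := ?t]"
      using snoc.prems(1,2) by (simp del: act.simps scanned.simps)
    have "act (Blank, Stay) ?t = word_tape y"
      by (auto simp: word_tape_def tape_of_def fun_eq_iff nth_append nat_less_iff)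
    then have "\<exists>t. exec A (erase b) (\<sigma>(b := \<sigma> b - 1), T[2 := ?t])
       ((\<sigma>(b := \<sigma> b - 1))(b := 0), T[2 := ?t, 2 := t]) \<and> act (Blank, Stay) t = word_tape []"
      using snoc.prems by (intro snoc.IH) (auto simp del: act.simps)
    then obtain t where t: "exec A (erase b) (\<sigma>(b := \<sigma> b - 1), T[2 := ?t]) (\<sigma>(b := 0), T[2 := t])"
      "act (Blank, Stay) t = word_tape []" by (auto simp del: act.simps)
    have "exec A (erase b) (\<sigma>, T) (\<sigma>(b := 0), T[2 := t])"
      unfolding erase_def
      by (rule exec_While[OF _ 1[unfolded 2] t(1)[unfolded erase_def]]) (simp add: snoc.prems)
    then show ?case using t(2) by blast
  qed
  then obtain t where t: "exec A (erase b) (\<sigma>, T) (\<sigma>(b := 0), T[2 := t])"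
      "act (Blank, Stay) t = word_tape []" by blast
  have "exec A (Write 2 None) (\<sigma>(b := 0), T[2 := t])
      (\<sigma>(b := 0), T[2 := t, 2 := act (opt_symbol None, Stay) (T[2 := t] ! 2)])"
    by (rule exec_Write)
  then have "exec A (Write 2 None) (\<sigma>(b := 0), T[2 := t]) (\<sigma>(b := 0), T[2 := word_tape []])"
    using t(2) assms(1) by (simp del: act.simps)
  then show ?thesis by (rule exec_Seq[OF t(1)])
qed

definition input_tape :: "bool list \<Rightarrow> nat \<Rightarrow> tape" where
  "input_tape x i =
    ((\<lambda>j. if int i \<le> j \<and> j < int (length x) then Bit (x ! nat j) else Blank), int i)"

definition scan_bit :: com where
  "scan_bit = Test False 0 ;; Test True 0"

text \<open>Register 0 tells whether a bit is scanned, register 1 collects the code. Reading from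
  left to right follows the fold in \<open>enc\<close>: \<open>d\<close> is to compute
  \<open>2 * c + 1\<close>, and the test adds the bit.\<close>

definition read_input :: "com \<Rightarrow> com" where
  "read_input d = scan_bit ;; While 0 (Dec 0 ;; d ;; Test True 1 ;; Write 0 None ;; Move 0 MoveRight ;; scan_bit)"

lemma exec_scan_bit:
  assumes "T ! 0 = input_tape x i" and "\<sigma> 0 = 0"
  shows "exec A scan_bit (\<sigma>, T) (\<sigma>(0 := of_bool (i < length x)), T)"
proof -
  have s: "scanned (input_tape x i) = (if i < length x then Bit (x ! i) else Blank)"
    by (simp add: input_tape_def)
  have "exec A scan_bit (\<sigma>, T)
    (let \<rho> = if scanned (T ! 0) = Bit False then \<sigma>(0 := Suc (\<sigma> 0)) else \<sigma> in
      if scanned (T ! 0) = Bit True then \<rho>(0 := Suc (\<rho> 0)) else \<rho>, T)"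
    unfolding scan_bit_def Let_def by (rule exec_Seq[OF exec_Test exec_Test])
  moreover have "(let \<rho> = if scanned (T ! 0) = Bit False then \<sigma>(0 := Suc (\<sigma> 0)) else \<sigma> in
      if scanned (T ! 0) = Bit True then \<rho>(0 := Suc (\<rho> 0)) else \<rho>) = \<sigma>(0 := of_bool (i < length x))"
    using assms by (cases "x ! i") (auto simp: s Let_def)
  ultimately show ?thesis by simp
qed

lemma exec_read_input_aux:
  assumes d: "implements d 1 (\<lambda>c. 2 * c + 1)"
  shows "i \<le> length x \<Longrightarrow>
    exec A (While 0 (Dec 0 ;; d ;; Test True 1 ;; Write 0 None ;; Move 0 MoveRight ;; scan_bit))
      ((\<lambda>_. 0)(0 := of_bool (i < length x), 1 := enc (take i x)), [input_tape x i, t1, t2])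
      ((\<lambda>_. 0)(1 := enc x), [input_tape x (length x), t1, t2])"
proof (induction i rule: inc_induct)
  case base
  have e: "(\<lambda>_::nat. 0)(0 := of_bool (length x < length x), 1 := enc (take (length x) x)) = (\<lambda>_. 0)(1 := enc x)"
    by auto
  show ?case unfolding e by (rule exec_While_0) simp
next
  case (step i)
  let ?z = "\<lambda>_::nat. 0::nat"
  let ?T = "\<lambda>t. [t, t1, t2]"
  let ?c = "enc (take i x)"
  let ?t = "act (opt_symbol None, Stay) (input_tape x i)"
  have c: "enc (take (Suc i) x) = 2 * ?c + 1 + of_bool (x ! i)"
    using step by (simp add: take_Suc_conv_app_nth)
  have 1: "exec A (Dec 0) (?z(0 := of_bool (i < length x), 1 := ?c), ?T (input_tape x i))
      (?z(1 := ?c), ?T (input_tape x i))"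
    by (rule exec_Dec') (use step in auto)
  have 2: "exec A d (?z(1 := ?c), ?T (input_tape x i)) (?z(1 := 2 * ?c + 1), ?T (input_tape x i))"
    by (rule implementsD[OF d]) auto
  have s: "scanned (input_tape x i) = Bit (x ! i)" using step by (simp add: input_tape_def)
  have 3: "exec A (Test True 1) (?z(1 := 2 * ?c + 1), ?T (input_tape x i))
      (?z(1 := enc (take (Suc i) x)), ?T (input_tape x i))"
    using exec_Test[of A True 1 "?z(1 := 2 * ?c + 1)" "?T (input_tape x i)"] s c
    by (auto split: if_splits)
  have 4: "exec A (Write 0 None) (?z(1 := enc (take (Suc i) x)), ?T (input_tape x i))
      (?z(1 := enc (take (Suc i) x)), ?T ?t)"
    using exec_Write[of A 0 None _ "?T (input_tape x i)"] by simp
  have t: "act (scanned ?t, MoveRight) ?t = input_tape x (Suc i)"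
    by (auto simp: input_tape_def fun_eq_iff)
  have 5: "exec A (Move 0 MoveRight) (?z(1 := enc (take (Suc i) x)), ?T ?t)
      (?z(1 := enc (take (Suc i) x)), ?T (input_tape x (Suc i)))"
    using exec_Move[of A 0 MoveRight _ "?T ?t"] t by (simp del: act.simps scanned.simps)
  have 6: "exec A scan_bit (?z(1 := enc (take (Suc i) x)), ?T (input_tape x (Suc i)))
      (?z(0 := of_bool (Suc i < length x), 1 := enc (take (Suc i) x)), ?T (input_tape x (Suc i)))"
    using exec_scan_bit[of "?T (input_tape x (Suc i))" x "Suc i" "?z(1 := enc (take (Suc i) x))" A]
    by (simp add: fun_upd_twist)
  show ?case
    by (rule exec_While[OF _ exec_Seq[OF 1 exec_Seq[OF 2 exec_Seq[OF 3 exec_Seq[OF 4 exec_Seq[OF 5 6]]]]] step.IH])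
      (use step in auto)
qed

lemma exec_read_input:
  assumes d: "implements d 1 (\<lambda>c. 2 * c + 1)"
  shows "exec A (read_input d) (init_store x)
     ((\<lambda>_. 0)(1 := enc x), [input_tape x (length x), word_tape [], word_tape []])"
proof -
  have t: "tape_of x = input_tape x 0"
    by (auto simp: tape_of_def input_tape_def)
  have 1: "exec A scan_bit (init_store x)
      ((\<lambda>_. 0)(0 := of_bool (0 < length x)), [input_tape x 0, word_tape [], word_tape []])"
    unfolding init_store_def t word_tape_Nil by (rule exec_scan_bit) auto
  have e: "(\<lambda>_::nat. 0)(0 := of_bool (0 < length x), 1 := enc (take 0 x)) = (\<lambda>_. 0)(0 := of_bool (0 < length x))"
    by (auto simp: fun_eq_iff)
  show ?thesis unfolding read_input_def
    by (rule exec_Seq[OF 1 exec_read_input_aux[OF d, of 0 x A "word_tape []" "word_tape []", unfolded e]]) simp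
qed

definition dialogue_step :: "bool list set \<Rightarrow> (nat \<Rightarrow> nat) \<Rightarrow> (nat \<Rightarrow> nat) \<Rightarrow> nat \<Rightarrow> nat" where
  "dialogue_step A Q F z = F (prod_encode (z, of_bool (rev (dec (Q z)) \<in> A)))"

text \<open>The body computes total functions and always ends, so only the outer loop can run
  forever. If some iterate makes \<open>G\<close> vanish, \<open>exec_halts_with\<close> gives the
  output; otherwise \<open>exec_diverges\<close> excludes halting. This yields an equivalence,
  uniformly in the oracle.\<close>

lemma dialogue_tm:
  assumes I: "computable I" and Q: "computable Q" and F: "computable F"
    and G: "computable G" and H: "computable H"
  shows "\<exists>M. oracle_tm M \<and> (\<forall>A x y. halts_with M A x y \<longleftrightarrow>
    (\<exists>n. (\<forall>i<n. G ((dialogue_step A Q F ^^ i) (I (enc x))) \<noteq> 0) \<and>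
      G ((dialogue_step A Q F ^^ n) (I (enc x))) = 0 \<and>
      y = rev (dec (H ((dialogue_step A Q F ^^ n) (I (enc x)))))))"
proof -
  have Q': "computable (\<lambda>z. length (dec (Q z)))" by (intro comp_intros Q)
  have half: "computable (\<lambda>v. (v - 1) div 2)" and bit: "computable (\<lambda>v. of_bool (even v))"
    and dbl: "computable (\<lambda>c. 2 * c + 1)"
    by (intro comp_intros)+
  obtain cI cQ cL cF cG cH cd where c: "implements cI 1 I" "implements cQ 2 Q"
    "implements cL 3 (\<lambda>z. length (dec (Q z)))" "implements cF 1 F" "implements cG 2 G"
    "implements cH 1 H" "implements cd 1 (\<lambda>c. 2 * c + 1)"
    using I Q Q' F G H dbl unfolding computable_def by meson
  obtain b2 h2 b1 h1 where h: "implements b2 (2+3) (\<lambda>v. of_bool (even v))"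
    "implements h2 2 (\<lambda>v. (v - 1) div 2)"
    "implements b1 (1+3) (\<lambda>v. of_bool (even v))" "implements h1 1 (\<lambda>v. (v - 1) div 2)"
    using half bit unfolding computable_def by meson
  note wf = c[THEN implements_io_wf] h[THEN implements_io_wf]
  let ?z = "\<lambda>_::nat. 0::nat"
  define test where "test = dup 1 2 3 ;; cG ;; move 2 0"
  \<comment> \<open>Register 0 is the loop flag, register 1 the state of the dialogue. The query
    tape is wiped after each answer, and \<open>encode_pair 5\<close> expects state and answer in
    registers 8 and 9.\<close>
  define body where "body = clear 0 ;; dup 1 2 3 ;; cQ ;; emit 2 2 b2 h2 ;; Ask 2 ;;
    dup 1 3 4 ;; cL ;; (erase 3 ;; Write 2 None) ;;
    move 1 8 ;; move 2 9 ;; encode_pair 5 ;; move 5 1 ;; cF ;; test"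
  define pre where "pre = read_input cd ;; cI ;; test"
  define post where "post = cH ;; emit 1 1 b1 h1"
  define M where "M = com_tm (pre ;; While 0 body ;; post)"
  have io: "io_wf (pre ;; While 0 body ;; post)"
    using wf by (simp add: pre_def body_def post_def test_def read_input_def scan_bit_def
      emit_def erase_def)
  have test: "exec A test (?z(1 := v), T) (?z(1 := v, 0 := G v), T)" for A v T
  proof -
    have 1: "exec A (dup 1 2 3) (?z(1 := v), T) (?z(1 := v, 2 := v), T)"
      using exec_dup[of 1 2 3 "?z(1 := v)" A T] by simp
    have 2: "exec A cG (?z(1 := v, 2 := v), T) (?z(1 := v, 2 := G v), T)"
      by (rule implementsD[OF c(5)]) auto
    have 3: "exec A (move 2 0) (?z(1 := v, 2 := G v), T) (?z(1 := v, 0 := G v), T)"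
      by (rule exec_move') auto
    show ?thesis unfolding test_def by (rule exec_Seq[OF 1 exec_Seq[OF 2 3]])
  qed
  have body: "exec A body (?z(1 := v, 0 := G v), [t, word_tape [], word_tape []])
     (?z(1 := dialogue_step A Q F v, 0 := G (dialogue_step A Q F v)), [t, word_tape [], word_tape []])"
    for A v t
  proof -
    let ?T = "\<lambda>q. [t, word_tape [], q]"
    let ?Te = "?T (word_tape [])"
    let ?q = "rev (dec (Q v))"
    let ?a = "of_bool (?q \<in> A) :: nat"
    let ?Tq = "?T (word_tape ?q)"
    have 1: "exec A (clear 0) (?z(1 := v, 0 := G v), ?Te) (?z(1 := v), ?Te)"
      using exec_clear[of A 0 "?z(1 := v, 0 := G v)" ?Te] by (simp add: fun_upd_idem)
    have 2: "exec A (dup 1 2 3) (?z(1 := v), ?Te) (?z(1 := v, 2 := v), ?Te)"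
      using exec_dup[of 1 2 3 "?z(1 := v)" A ?Te] by simp
    have 3: "exec A cQ (?z(1 := v, 2 := v), ?Te) (?z(1 := v, 2 := Q v), ?Te)"
      by (rule implementsD[OF c(2)]) auto
    have "(?z(1 := v, 2 := Q v))(2 := 0) = ?z(1 := v)" by auto
    then have 4: "exec A (emit 2 2 b2 h2) (?z(1 := v, 2 := Q v), ?Te) (?z(1 := v), ?Tq)"
      using exec_emit[OF h(1,2), of "?z(1 := v, 2 := Q v)" 2 ?Te "[]" A] by simp
    have "(if \<exists>x\<in>A. word_on (?Tq ! 2) x then (?z(1 := v))(2 := Suc ((?z(1 := v)) 2)) else ?z(1 := v))
        = ?z(1 := v, 2 := ?a)"
      by (auto simp: word_on_word_tape)
    then have 5: "exec A (Ask 2) (?z(1 := v), ?Tq) (?z(1 := v, 2 := ?a), ?Tq)"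
      using exec_Ask[of ?Tq A 2 "?z(1 := v)"] by simp
    have 6: "exec A (dup 1 3 4) (?z(1 := v, 2 := ?a), ?Tq) (?z(1 := v, 2 := ?a, 3 := v), ?Tq)"
      using exec_dup[of 1 3 4 "?z(1 := v, 2 := ?a)" A ?Tq] by simp
    have 7: "exec A cL (?z(1 := v, 2 := ?a, 3 := v), ?Tq)
        (?z(1 := v, 2 := ?a, 3 := length (dec (Q v))), ?Tq)"
      by (rule implementsD[OF c(3)]) auto
    have ta: "act (Blank, Stay) (word_tape ?q) = word_tape ?q"
      using act_scanned_Stay[of "word_tape ?q"] by (simp del: act.simps)
    have r: "(?z(1 := v, 2 := ?a, 3 := length (dec (Q v))))(3 := 0) = ?z(1 := v, 2 := ?a)"
      by (auto simp: fun_eq_iff)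
    have 8: "exec A (erase 3 ;; Write 2 None) (?z(1 := v, 2 := ?a, 3 := length (dec (Q v))), ?Tq)
        (?z(1 := v, 2 := ?a), ?Te)"
      using exec_erase[of ?Tq ?q "?z(1 := v, 2 := ?a, 3 := length (dec (Q v)))" 3 A] ta
      unfolding r by (simp del: act.simps)
    have 9: "exec A (move 1 8) (?z(1 := v, 2 := ?a), ?Te) (?z(2 := ?a, 8 := v), ?Te)"
      by (rule exec_move') (auto simp: fun_eq_iff)
    have 10: "exec A (move 2 9) (?z(2 := ?a, 8 := v), ?Te) (?z(8 := v, 9 := ?a), ?Te)"
      by (rule exec_move') (auto simp: fun_eq_iff)
    have "(?z(8 := v, 9 := ?a))(5 := prod_encode ((?z(8 := v, 9 := ?a)) (5+3), (?z(8 := v, 9 := ?a)) (5+4)),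
        5+3 := 0, 5+4 := 0) = ?z(5 := prod_encode (v, ?a))"
      by (auto simp: fun_eq_iff)
    then have 11: "exec A (encode_pair 5) (?z(8 := v, 9 := ?a), ?Te) (?z(5 := prod_encode (v, ?a)), ?Te)"
      using exec_encode_pair[of "?z(8 := v, 9 := ?a)" 5 A ?Te] by (simp only:) simp
    have 12: "exec A (move 5 1) (?z(5 := prod_encode (v, ?a)), ?Te) (?z(1 := prod_encode (v, ?a)), ?Te)"
      by (rule exec_move') (auto simp: fun_eq_iff)
    have 13: "exec A cF (?z(1 := prod_encode (v, ?a)), ?Te) (?z(1 := dialogue_step A Q F v), ?Te)"
      by (rule implementsD[OF c(4)]) (auto simp: dialogue_step_def)
    show ?thesis unfolding body_def
      by (rule exec_Seq[OF 1 exec_Seq[OF 2 exec_Seq[OF 3 exec_Seq[OF 4 exec_Seq[OF 5 exec_Seq[OF 6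
        exec_Seq[OF 7 exec_Seq[OF 8 exec_Seq[OF 9 exec_Seq[OF 10 exec_Seq[OF 11 exec_Seq[OF 12
        exec_Seq[OF 13 test]]]]]]]]]]]]])
  qed
  have pre: "exec A pre (init_store x) (?z(1 := I (enc x), 0 := G (I (enc x))),
      [input_tape x (length x), word_tape [], word_tape []])" for A x
  proof -
    have "exec A cI (?z(1 := enc x), [input_tape x (length x), word_tape [], word_tape []])
      (?z(1 := I (enc x)), [input_tape x (length x), word_tape [], word_tape []])"
      by (rule implementsD[OF c(1)]) auto
    then show ?thesis unfolding pre_def
      by (rule exec_Seq[OF exec_read_input[OF c(7)] exec_Seq[OF _ test]])
  qed
  have post: "\<exists>\<sigma>. exec A post (?z(1 := v), [t, word_tape [], u]) (\<sigma>, [t, word_tape (rev (dec (H v))), u])"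
    for A v t u
  proof -
    have 1: "exec A cH (?z(1 := v), [t, word_tape [], u]) (?z(1 := H v), [t, word_tape [], u])"
      by (rule implementsD[OF c(6)]) auto
    have 2: "exec A (emit 1 1 b1 h1) (?z(1 := H v), [t, word_tape [], u])
      ((?z(1 := H v))(1 := 0), [t, word_tape (rev (dec (H v))), u])"
      using exec_emit[OF h(3,4), of "?z(1 := H v)" 1 "[t, word_tape [], u]" "[]" A] by simp
    show ?thesis unfolding post_def using exec_Seq[OF 1 2] by blast
  qed
  have main: "halts_with M A x y \<longleftrightarrow>
      (\<exists>n. (\<forall>i<n. G ((dialogue_step A Q F ^^ i) (I (enc x))) \<noteq> 0) \<and>
      G ((dialogue_step A Q F ^^ n) (I (enc x))) = 0 \<and>
      y = rev (dec (H ((dialogue_step A Q F ^^ n) (I (enc x))))))" for A x y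
  proof -
    define Z where "Z i = (dialogue_step A Q F ^^ i) (I (enc x))" for i
    let ?T = "[input_tape x (length x), word_tape [], word_tape []]"
    define X where "X i = (?z(1 := Z i, 0 := G (Z i)), ?T)" for i
    have p: "exec A pre (init_store x) (X 0)" using pre by (simp add: X_def Z_def)
    have b: "exec A body (X i) (X (Suc i))" for i
      using body unfolding X_def Z_def by simp
    have halt: "halts_with M A x (rev (dec (H (Z n))))"
      if n: "\<forall>i<n. G (Z i) \<noteq> 0" "G (Z n) = 0" for n
    proof -
      have "exec A (While 0 body) (X i) (X n)" if "i \<le> n" for i
        using that
      proof (induction i rule: inc_induct)
        case base
        show ?case by (rule exec_While_0) (simp add: X_def n)
      next
        case (step i)
        show ?case by (rule exec_While[OF _ b step.IH]) (use step n in \<open>simp add: X_def\<close>)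
      qed
      then have w: "exec A (While 0 body) (X 0) (X n)" by simp
      have Xn: "X n = (?z(1 := Z n), ?T)" using n(2) by (auto simp: X_def fun_eq_iff)
      obtain \<sigma> where "exec A post (X n) (\<sigma>, [input_tape x (length x), word_tape (rev (dec (H (Z n)))), word_tape []])"
        unfolding Xn using post by blast
      then have "exec A (pre ;; While 0 body ;; post) (init_store x)
         (\<sigma>, [input_tape x (length x), word_tape (rev (dec (H (Z n)))), word_tape []])"
        by (rule exec_Seq[OF p exec_Seq[OF w]])
      then show ?thesis unfolding M_def
        by (rule exec_halts_with) (use io in \<open>auto simp: word_on_word_tape\<close>)
    qed
    show ?thesis
    proof (cases "\<exists>n. G (Z n) = 0")
      case True
      define n where "n = (LEAST n. G (Z n) = 0)"
      have n: "\<forall>i<n. G (Z i) \<noteq> 0" "G (Z n) = 0"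
        using True unfolding n_def by (auto dest: not_less_Least intro: LeastI)
      have u: "m = n" if "\<forall>i<m. G (Z i) \<noteq> 0" "G (Z m) = 0" for m
        using n that by (metis linorder_neqE_nat)
      show ?thesis unfolding Z_def[symmetric]
        using halt[OF n] halts_with_unique n u by metis
    next
      case False
      then have "\<not> halts_with M A x y"
        unfolding M_def by (intro exec_diverges[OF p b _ io]) (simp add: X_def)
      then show ?thesis unfolding Z_def[symmetric] using False by blast
    qed
  qed
  have "oracle_tm M" unfolding M_def by (rule oracle_tm_com_tm[OF io])
  then show ?thesis using main by blast
qed

section \<open>Unbounded search\<close>

text \<open>The third argument of \<open>P\<close> is the oracle's answer for
  \<open>dec (pfst t)\<close>: a candidate carries the string to be asked, so one query per
  candidate is enough. The dialogue state holds the input, the number of candidates tried, and a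
  flag that becomes 0 once a candidate passes.\<close>

lemma search_tm:
  assumes P: "decidable (\<lambda>p. P (pfst p) (pfst (psnd p)) (psnd (psnd p)))"
    and U: "computable (\<lambda>p. U (pfst p) (psnd p))"
  shows "\<exists>M. oracle_tm M \<and> (\<forall>A x y. halts_with M A x y \<longleftrightarrow>
    (\<exists>t. P (enc x) t (of_bool (dec (pfst t) \<in> A)) \<and>
      (\<forall>i<t. \<not> P (enc x) i (of_bool (dec (pfst i) \<in> A))) \<and> y = dec (U (enc x) t)))"
proof -
  let ?I = "\<lambda>x. prod_encode (x, prod_encode (0, 1))"
  let ?F = "\<lambda>p. prod_encode (pfst (pfst p), prod_encode (Suc (pfst (psnd (pfst p))),
    of_bool (\<not> P (pfst (pfst p)) (pfst (psnd (pfst p))) (psnd p))))"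
  \<comment> \<open>Words are emitted in reverse, so the query, like the output in
    \<open>?H\<close>, is reversed beforehand.\<close>
  let ?Q = "\<lambda>z. enc (rev (dec (pfst (pfst (psnd z)))))"
  let ?G = "\<lambda>z. psnd (psnd z)"
  \<comment> \<open>The counter is already one past the accepted candidate.\<close>
  let ?H = "\<lambda>z. enc (rev (dec (U (pfst z) (pfst (psnd z) - 1))))"
  have "decidable (\<lambda>p. P (pfst (pfst p)) (pfst (psnd (pfst p))) (psnd p))"
    using computable_comp[OF P[unfolded decidable_def],
      of "\<lambda>p. prod_encode (pfst (pfst p), prod_encode (pfst (psnd (pfst p)), psnd p))"]
    by (simp add: decidable_def comp_intros)
  then have F: "computable ?F" by (intro comp_intros)
  have "computable (\<lambda>z. U (pfst z) (pfst (psnd z) - 1))"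
    using computable_comp[OF U, of "\<lambda>z. prod_encode (pfst z, pfst (psnd z) - 1)"]
    by (simp add: comp_intros del: One_nat_def)
  then have H: "computable ?H" by (intro comp_intros)
  have I: "computable ?I" and Q: "computable ?Q" and G: "computable ?G" by (intro comp_intros)+
  obtain M where M: "oracle_tm M" "\<And>A x y. halts_with M A x y \<longleftrightarrow>
    (\<exists>n. (\<forall>i<n. ?G ((dialogue_step A ?Q ?F ^^ i) (?I (enc x))) \<noteq> 0) \<and>
      ?G ((dialogue_step A ?Q ?F ^^ n) (?I (enc x))) = 0 \<and>
      y = rev (dec (?H ((dialogue_step A ?Q ?F ^^ n) (?I (enc x))))))"
    using dialogue_tm[OF I Q F G H] by blast
  have Z: "(dialogue_step A ?Q ?F ^^ Suc n) (?I x) =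
      prod_encode (x, prod_encode (Suc n, of_bool (\<not> P x n (of_bool (dec (pfst n) \<in> A)))))" for A n x
    by (induction n) (simp_all add: dialogue_step_def)
  have "halts_with M A x y \<longleftrightarrow> (\<exists>t. P (enc x) t (of_bool (dec (pfst t) \<in> A)) \<and>
      (\<forall>i<t. \<not> P (enc x) i (of_bool (dec (pfst i) \<in> A))) \<and> y = dec (U (enc x) t))" for A x y
  proof
    assume "halts_with M A x y"
    then obtain n where n: "\<forall>i<n. ?G ((dialogue_step A ?Q ?F ^^ i) (?I (enc x))) \<noteq> 0"
      "?G ((dialogue_step A ?Q ?F ^^ n) (?I (enc x))) = 0"
      "y = rev (dec (?H ((dialogue_step A ?Q ?F ^^ n) (?I (enc x)))))"
      unfolding M(2) by blast
    obtain t where t: "n = Suc t" using n(2) by (cases n) auto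
    have "\<not> P (enc x) i (of_bool (dec (pfst i) \<in> A))" if "i < t" for i
      using n(1)[rule_format, of "Suc i"] that unfolding t Z by simp
    moreover have "P (enc x) t (of_bool (dec (pfst t) \<in> A))"
      using n(2) unfolding t Z by simp
    moreover have "y = dec (U (enc x) t)"
      using n(3) unfolding t Z by simp
    ultimately show "\<exists>t. P (enc x) t (of_bool (dec (pfst t) \<in> A)) \<and>
      (\<forall>i<t. \<not> P (enc x) i (of_bool (dec (pfst i) \<in> A))) \<and> y = dec (U (enc x) t)"
      by blast
  next
    assume "\<exists>t. P (enc x) t (of_bool (dec (pfst t) \<in> A)) \<and>
      (\<forall>i<t. \<not> P (enc x) i (of_bool (dec (pfst i) \<in> A))) \<and> y = dec (U (enc x) t)"
    then obtain t where t: "P (enc x) t (of_bool (dec (pfst t) \<in> A))"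
      "\<forall>i<t. \<not> P (enc x) i (of_bool (dec (pfst i) \<in> A))" "y = dec (U (enc x) t)" by blast
    have "?G ((dialogue_step A ?Q ?F ^^ i) (?I (enc x))) \<noteq> 0" if "i < Suc t" for i
    proof (cases i)
      case (Suc j)
      then show ?thesis using t(2) that unfolding Suc Z by simp
    qed simp
    moreover have "?G ((dialogue_step A ?Q ?F ^^ Suc t) (?I (enc x))) = 0"
      "y = rev (dec (?H ((dialogue_step A ?Q ?F ^^ Suc t) (?I (enc x)))))"
      unfolding Z using t by auto
    ultimately show "halts_with M A x y" unfolding M(2) by blast
  qed
  then show ?thesis using M(1) by blast
qed

lemma search_partial_recursive:
  assumes P: "decidable (\<lambda>p. P (pfst p) (psnd p))" and U: "computable (\<lambda>p. U (pfst p) (psnd p))"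
  shows "partial_recursive (\<lambda>x. if \<exists>t. P (enc x) t
    then Some (dec (U (enc x) (LEAST t. P (enc x) t))) else None)"
proof -
  have "decidable (\<lambda>p. P (pfst p) (pfst (psnd p)))"
    using computable_comp[OF P[unfolded decidable_def],
      of "\<lambda>p. prod_encode (pfst p, pfst (psnd p))"]
    by (simp add: decidable_def comp_intros)
  from search_tm[of "\<lambda>x t _. P x t", OF this U] obtain M where M: "oracle_tm M"
    "\<And>x y. halts_with M {} x y \<longleftrightarrow>
      (\<exists>t. P (enc x) t \<and> (\<forall>i<t. \<not> P (enc x) i) \<and> y = dec (U (enc x) t))"
    by blast
  have "(if \<exists>t. P (enc x) t then Some (dec (U (enc x) (LEAST t. P (enc x) t))) else None) = Some y
      \<longleftrightarrow> halts_with M {} x y" for x y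
  proof (cases "\<exists>t. P (enc x) t")
    case True
    then have "P (enc x) t \<and> (\<forall>i<t. \<not> P (enc x) i) \<longleftrightarrow> t = (LEAST t. P (enc x) t)" for t
      by (metis LeastI linorder_neqE_nat not_less_Least)
    then have "(\<exists>t. P (enc x) t \<and> (\<forall>i<t. \<not> P (enc x) i) \<and> y = dec (U (enc x) t)) \<longleftrightarrow>
        y = dec (U (enc x) (LEAST t. P (enc x) t))" by metis
    then show ?thesis using True unfolding M(2) by auto
  qed (simp add: M(2))
  then show ?thesis unfolding partial_recursive_def using M(1) by blast
qed

section \<open>Number codes of symbols, states and tapes\<close>

fun symbol_code :: "symbol \<Rightarrow> nat" where
  "symbol_code Blank = 0"
| "symbol_code (Bit b) = 1 + of_bool b"
| "symbol_code (Extra n) = n + 3"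

fun state_code :: "state \<Rightarrow> nat" where
  "state_code Start = 0"
| "state_code Halt = 1"
| "state_code Query = 2"
| "state_code Yes = 3"
| "state_code No = 4"
| "state_code (State n) = n + 5"

fun move_code :: "move \<Rightarrow> nat" where
  "move_code MoveLeft = 0"
| "move_code Stay = 1"
| "move_code MoveRight = 2"

lemma symbol_code_inject: "symbol_code a = symbol_code b \<Longrightarrow> a = b"
  by (cases a; cases b) (auto split: if_splits simp: of_bool_def)

lemma state_code_inject: "state_code a = state_code b \<Longrightarrow> a = b"
  by (cases a; cases b) auto

definition digit :: "nat \<Rightarrow> nat \<Rightarrow> nat \<Rightarrow> nat" where
  "digit B x e = x div B ^ e mod B"

definition set_digit :: "nat \<Rightarrow> nat \<Rightarrow> nat \<Rightarrow> nat \<Rightarrow> nat" where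
  "set_digit B x e a = x + a * B ^ e - digit B x e * B ^ e"

lemma digit_add_mult:
  assumes "a < B" and "l < B ^ e"
  shows "digit B (h * B ^ Suc e + a * B ^ e + l) i =
    (if i = e then a else if i < e then digit B l i else digit B (h * B ^ Suc e) i)"
proof -
  have B: "B > 0" using assms(1) by simp
  have eq: "h * B ^ Suc e + a * B ^ e + l = l + B ^ e * (h * B + a)" by (simp add: algebra_simps)
  consider "i = e" | "i < e" | "e < i" by linarith
  then show ?thesis
  proof cases
    case 1
    then show ?thesis unfolding digit_def eq using assms B by simp
  next
    case 2
    then obtain j where "e = i + Suc j" by (metis add_Suc_right less_imp_Suc_add)
    then have e: "B ^ e = B ^ i * (B * B ^ j)" by (simp add: power_add)
    have "l + B ^ e * (h * B + a) = l + B ^ i * (B * (B ^ j * (h * B + a)))"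
      unfolding e by (simp only: mult.assoc)
    moreover have "B ^ i \<noteq> 0" using B by simp
    ultimately have "(l + B ^ e * (h * B + a)) div B ^ i = B * (B ^ j * (h * B + a)) + l div B ^ i"
      using div_mult_self2 by metis
    then show ?thesis unfolding digit_def eq using 2 by simp
  next
    case 3
    then obtain j where "i = Suc e + j" by (metis Suc_leI le_Suc_ex)
    then have i: "B ^ i = B ^ Suc e * B ^ j" by (simp add: power_add)
    have "a * B ^ e + l < Suc a * B ^ e" using assms by simp
    also have "\<dots> \<le> B ^ Suc e" using assms by (simp add: mult_le_mono1 del: mult_Suc)
    finally have "(h * B ^ Suc e + (a * B ^ e + l)) div B ^ Suc e = h"
      using B by simp
    moreover have "(h * B ^ Suc e) div B ^ Suc e = h" using B by simp
    ultimately show ?thesis unfolding digit_def i div_mult2_eq add.assoc using 3 by simp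
  qed
qed

lemma digit_set_digit:
  assumes "a < B"
  shows "digit B (set_digit B x e a) i = (if i = e then a else digit B x i)"
proof -
  have B: "B > 0" using assms by simp
  let ?h = "x div B ^ Suc e" and ?d = "digit B x e" and ?l = "x mod B ^ e"
  have "x = B ^ e * (x div B ^ e) + ?l" by simp
  also have "x div B ^ e = B * ?h + ?d"
    unfolding digit_def power_Suc2 div_mult2_eq by simp
  finally have x: "x = ?h * B ^ Suc e + ?d * B ^ e + ?l" by (simp add: algebra_simps)
  have s: "set_digit B x e a = ?h * B ^ Suc e + a * B ^ e + ?l"
    unfolding set_digit_def using x by linarith
  have "?d < B" "?l < B ^ e" using B by (auto simp: digit_def)
  then show ?thesis
    using digit_add_mult[OF assms, of ?l e ?h i] digit_add_mult[of ?d B ?l e ?h i] x s by simp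
qed

lemma digit_eq_0:
  assumes "B \<ge> 2" and "x \<le> e"
  shows "digit B x e = 0"
proof -
  have "e < 2 ^ e" by simp
  also have "\<dots> \<le> B ^ e" using assms(1) by (rule power_mono) simp
  finally show ?thesis using assms(2) by (simp add: digit_def)
qed

text \<open>A tape with finitely many non-blank cells becomes a number in base \<open>B\<close>.
  \<open>int_encode\<close> places the cells \<open>i >= 0\<close> at the digits
  \<open>2 * i\<close> and the negative cells at odd digits; the code 0 of \<open>Blank\<close>
  turns the blank rest into leading zeros.\<close>

definition tape_rep :: "nat \<Rightarrow> tape \<Rightarrow> nat \<Rightarrow> bool" where
  "tape_rep B T u \<longleftrightarrow> (\<forall>i. digit B (pfst u) (int_encode i) = symbol_code (fst T i)) \<and>
    psnd u = int_encode (snd T)"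

text \<open>The digits 0, 1, 2, 3, ... hold the cells 0, -1, 1, -2, ..., so a neighbouring cell is
  two digits away except when passing between 0 and -1.\<close>

definition move_index :: "nat \<Rightarrow> nat \<Rightarrow> nat" where
  "move_index e m = (if m = 0 then (if e = 0 then 1 else if even e then e - 2 else e + 2)
     else if m = 2 then (if even e then e + 2 else if e = 1 then 0 else e - 2) else e)"

lemma int_encode_nonneg: "0 \<le> i \<Longrightarrow> int_encode i = 2 * nat i"
  by (simp add: int_encode_def sum_encode_def)

lemma int_encode_neg: "i < 0 \<Longrightarrow> int_encode i = Suc (2 * nat (- i - 1))"
  by (simp add: int_encode_def sum_encode_def)

lemma move_index_correct: "move_index (int_encode h) (move_code m) = int_encode (move_head m h)"
proof (cases m)
  case MoveLeft
  consider "h < 0" | "h = 0" | "h > 0" by linarith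
  then show ?thesis
    by cases (use MoveLeft in \<open>auto simp: move_index_def int_encode_nonneg int_encode_neg nat_diff_distrib\<close>)
next
  case MoveRight
  consider "h < -1" | "h = -1" | "h \<ge> 0" by linarith
  then show ?thesis
    by cases (use MoveRight in \<open>auto simp: move_index_def int_encode_nonneg int_encode_neg nat_add_distrib\<close>)
qed (simp add: move_index_def)

definition act_code :: "nat \<Rightarrow> nat \<Rightarrow> nat \<Rightarrow> nat" where
  "act_code B u v = prod_encode (set_digit B (pfst u) (psnd u) (pfst v), move_index (psnd u) (psnd v))"

lemma tape_rep_act:
  assumes "tape_rep B T u" and "symbol_code a < B"
  shows "tape_rep B (act (a, m) T) (act_code B u (prod_encode (symbol_code a, move_code m)))"
proof -
  obtain t h where T: "T = (t, h)" by fastforce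
  have "int_encode i = int_encode h \<longleftrightarrow> i = h" for i
    using int_encode_inverse by metis
  then show ?thesis using assms
    by (simp add: tape_rep_def act_code_def T digit_set_digit move_index_correct)
qed

lemma tape_rep_scanned: "tape_rep B T u \<Longrightarrow> digit B (pfst u) (psnd u) = symbol_code (scanned T)"
  by (cases T) (simp add: tape_rep_def)

text \<open>The cells 0, 1, 2, ... are the even digits. Bits have the symbol codes 1 and 2, so
  \<open>2 * r + d\<close> is the recursion of \<open>enc\<close>. At the first other digit the pair
  becomes a fixed point, and \<open>x\<close> rounds suffice because all digits from place
  \<open>x\<close> on vanish.\<close>

definition word_code :: "nat \<Rightarrow> nat \<Rightarrow> nat" where
  "word_code B x = psnd (((\<lambda>p. let d = digit B x (2 * pfst p) in
     if d = 0 \<or> 2 < d then p else prod_encode (Suc (pfst p), 2 * psnd p + d)) ^^ x) 0)"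

lemma pfst_0 [simp]: "pfst 0 = 0" and psnd_0 [simp]: "psnd 0 = 0"
proof -
  have "0 = prod_encode (0, 0)" by (simp add: prod_encode_def)
  then show "pfst 0 = 0" "psnd 0 = 0" by (metis pfst_encode, metis psnd_encode)
qed

lemma word_code_correct:
  assumes B: "B \<ge> 2" and rep: "tape_rep B T u" and w: "word_on T y"
  shows "word_code B (pfst u) = enc y"
proof -
  let ?x = "pfst u"
  let ?F = "\<lambda>p. let d = digit B ?x (2 * pfst p) in
     if d = 0 \<or> 2 < d then p else prod_encode (Suc (pfst p), 2 * psnd p + d)"
  have d: "digit B ?x (2 * n) = symbol_code (fst T (int n))" for n
  proof -
    have "digit B ?x (int_encode (int n)) = symbol_code (fst T (int n))"
      using rep unfolding tape_rep_def by blast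
    then show ?thesis by (simp add: int_encode_nonneg)
  qed
  have step: "?F (prod_encode (n, enc (take n y))) =
      (if n < length y then prod_encode (Suc n, enc (take (Suc n) y)) else prod_encode (n, enc (take n y)))"
    if "n \<le> length y" for n
  proof (cases "n < length y")
    case True
    then have "digit B ?x (2 * n) = 1 + of_bool (y ! n)" using w d by (simp add: word_on_def)
    moreover have "take (Suc n) y = take n y @ [y ! n]" using True by (simp add: take_Suc_conv_app_nth)
    ultimately show ?thesis using True by (simp add: Let_def)
  next
    case False
    then have "n = length y" using that by simp
    then have "\<nexists>b. fst T (int n) = Bit b" using w by (simp add: word_on_def)
    then have "digit B ?x (2 * n) = 0 \<or> 2 < digit B ?x (2 * n)"
      unfolding d by (cases "fst T (int n)") auto
    then show ?thesis using False by (simp add: Let_def)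
  qed
  have it: "(?F ^^ k) 0 = prod_encode (min k (length y), enc (take (min k (length y)) y))" for k
  proof (induction k)
    case 0
    show ?case by (simp add: prod_encode_def)
  next
    case (Suc k)
    have "(?F ^^ Suc k) 0 = ?F (prod_encode (min k (length y), enc (take (min k (length y)) y)))"
      unfolding funpow.simps o_apply Suc ..
    also have "\<dots> = prod_encode (min (Suc k) (length y), enc (take (min (Suc k) (length y)) y))"
    proof (cases "k < length y")
      case True
      then have "min k (length y) = k" "min (Suc k) (length y) = Suc k" by simp_all
      then show ?thesis using True step[of k] by (simp only: if_True)
    next
      case False
      then have "min k (length y) = length y" "min (Suc k) (length y) = length y" by simp_all
      then show ?thesis using step[of "length y"] by (simp only: if_False less_irrefl)
    qed
    finally show ?case .
  qed
  have "length y \<le> ?x"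
  proof (rule ccontr)
    assume "\<not> length y \<le> ?x"
    then have l: "?x < length y" by simp
    then have "digit B ?x (2 * ?x) \<noteq> 0" using w d[of ?x] by (simp add: word_on_def)
    then show False using digit_eq_0[OF B, of ?x "2 * ?x"] by simp
  qed
  then show ?thesis unfolding word_code_def it by (simp add: min_def)
qed

text \<open>A number has only finitely many non-zero digits, so reading from cell 0 eventually meets
  a non-bit. An arbitrary tape may consist of bits forever and carry no word.\<close>

lemma word_on_exists:
  assumes B: "B \<ge> 2" and rep: "tape_rep B T u"
  shows "\<exists>y. word_on T y"
proof -
  let ?P = "\<lambda>n. \<nexists>b. fst T (int n) = Bit b"
  have "digit B (pfst u) (int_encode (int (pfst u))) = 0"
    by (rule digit_eq_0[OF B]) (simp add: int_encode_nonneg)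
  then have "symbol_code (fst T (int (pfst u))) = 0" using rep by (simp add: tape_rep_def)
  then have "?P (pfst u)" by auto
  then have P: "?P (LEAST n. ?P n)" by (rule LeastI)
  have "\<exists>b. fst T (int n) = Bit b" if "n < (LEAST n. ?P n)" for n
    using not_less_Least[OF that] by blast
  then obtain b where b: "\<And>n. n < (LEAST n. ?P n) \<Longrightarrow> fst T (int n) = Bit (b n)" by metis
  have "word_on T (map b [0..<LEAST n. ?P n])"
    using b P unfolding word_on_def by simp
  then show ?thesis by blast
qed

section \<open>Codes of tuples and of finite tables\<close>

fun list_code :: "nat list \<Rightarrow> nat" where
  "list_code [] = 0"
| "list_code (u # us) = prod_encode (u, list_code us)"

definition nth_code :: "nat \<Rightarrow> nat \<Rightarrow> nat" where
  "nth_code L i = pfst ((psnd ^^ i) L)"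

lemma nth_code_list_code: "i < length us \<Longrightarrow> nth_code (list_code us) i = us ! i"
proof (induction us arbitrary: i)
  case (Cons u us)
  then show ?case
    by (cases i) (auto simp: nth_code_def funpow_Suc_right simp del: funpow.simps)
qed simp

lemma list_code_inject: "length us = length vs \<Longrightarrow> list_code us = list_code vs \<Longrightarrow> us = vs"
  by (induction us vs rule: list_induct2) auto

lemma computable_list_code:
  "(\<And>i. i \<in> set is \<Longrightarrow> computable (g i)) \<Longrightarrow> computable (\<lambda>x. list_code (map (\<lambda>i. g i x) is))"
  by (induction "is") (auto intro: comp_intros)

lemma computable_nth_code [comp_intros]:
  "computable f \<Longrightarrow> computable g \<Longrightarrow> computable (\<lambda>x. nth_code (f x) (g x))"
  unfolding nth_code_def by (intro comp_intros)

lemma computable_digit [comp_intros]: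
  "computable f \<Longrightarrow> computable g \<Longrightarrow> computable (\<lambda>x. digit B (f x) (g x))"
  unfolding digit_def by (intro comp_intros)

lemma computable_act_code [comp_intros]:
  "computable f \<Longrightarrow> computable g \<Longrightarrow> computable (\<lambda>x. act_code B (f x) (g x))"
  unfolding act_code_def set_digit_def move_index_def by (intro comp_intros)

lemma computable_word_code [comp_intros]:
  assumes f: "computable f"
  shows "computable (\<lambda>x. word_code B (f x))"
proof -
  have f': "computable (\<lambda>p. f (pfst p))" by (rule computable_comp[OF f computable_pfst])
  show ?thesis unfolding word_code_def Let_def
    by (intro comp_intros f f')
qed

text \<open>A nested case distinction, one case per key. This is how the transition function, which
  is an arbitrary function as a whole, enters the simulation through its finite restriction.\<close>

lemma finite_table:
  assumes "finite K" and "inj_on key K"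
  shows "\<exists>g. computable g \<and> (\<forall>k\<in>K. g (key k) = val k)"
  using assms
proof (induction K rule: finite_induct)
  case empty
  show ?case using computable_zero by blast
next
  case (insert k K)
  then obtain g where g: "computable g" "\<forall>k\<in>K. g (key k) = val k" by auto
  have "computable (\<lambda>x. if x = key k then val k else g x)" by (intro comp_intros g(1))
  moreover have "\<forall>j\<in>insert k K. (if key j = key k then val k else g (key j)) = val j"
    using g(2) insert.prems insert.hyps by (auto simp: inj_on_def)
  ultimately show ?case by (intro exI[of _ "\<lambda>x. if x = key k then val k else g x"]) auto
qed

section \<open>Simulating a machine on codes\<close>

text \<open>Code 0 is the empty oracle of an ordinary machine, \<open>Suc s\<close> an oracle with
  one string, so one simulation serves both.\<close>

fun oracle_of :: "nat \<Rightarrow> bool list set" where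
  "oracle_of 0 = {}"
| "oracle_of (Suc s) = {dec s}"

definition scan_code :: "nat \<Rightarrow> nat \<Rightarrow> nat \<Rightarrow> nat" where
  "scan_code B n L = list_code (map (\<lambda>i. digit B (pfst (nth_code L i)) (psnd (nth_code L i))) [0..<n])"

definition act_list_code :: "nat \<Rightarrow> nat \<Rightarrow> nat \<Rightarrow> nat \<Rightarrow> nat" where
  "act_list_code B n L v = list_code (map (\<lambda>i. act_code B (nth_code L i) (nth_code v i)) [0..<n])"

text \<open>The numbers 1, 2, 3, 4 are the codes of \<open>Halt\<close>, \<open>Query\<close>,
  \<open>Yes\<close>, \<open>No\<close>. For \<open>w = 0\<close> the comparison with a successor
  fails, as it should for the empty oracle.\<close>

definition step_code :: "nat \<Rightarrow> nat \<Rightarrow> (nat \<Rightarrow> nat) \<Rightarrow> nat \<Rightarrow> nat \<Rightarrow> nat" where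
  "step_code B n tbl w c = (
     if pfst c = 1 then c
     else if pfst c = 2 then
       prod_encode (if Suc (word_code B (pfst (nth_code (psnd c) 2))) = w then 3 else 4, psnd c)
     else prod_encode (pfst (tbl (prod_encode (pfst c, scan_code B n (psnd c)))),
       act_list_code B n (psnd c) (psnd (tbl (prod_encode (pfst c, scan_code B n (psnd c)))))))"

text \<open>Input cells are the even digits, so each bit shifts by two places and the digits of the
  negative cells stay 0.\<close>

definition input_code :: "nat \<Rightarrow> nat \<Rightarrow> nat" where
  "input_code B x = foldr (\<lambda>b r. r * B\<^sup>2 + 1 + of_bool b) (dec x) 0"

text \<open>By \<open>prod_encode (0, 0) = 0\<close>, the number 0 is the code of a blank tape with
  its head on cell 0.\<close>

definition init_code :: "nat \<Rightarrow> nat \<Rightarrow> nat \<Rightarrow> nat" where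
  "init_code B n x = prod_encode (0, list_code (prod_encode (input_code B x, 0) # replicate (n - 1) 0))"

definition sim_code :: "nat \<Rightarrow> nat \<Rightarrow> (nat \<Rightarrow> nat) \<Rightarrow> nat \<Rightarrow> nat \<Rightarrow> nat \<Rightarrow> nat" where
  "sim_code B n tbl w x k =
     (if pfst ((step_code B n tbl w ^^ k) (init_code B n x)) = 1
      then Suc (word_code B (pfst (nth_code (psnd ((step_code B n tbl w ^^ k) (init_code B n x))) 1)))
      else 0)"

lemma computable_scan_code [comp_intros]:
  assumes "computable f"
  shows "computable (\<lambda>x. scan_code B n (f x))"
  unfolding scan_code_def by (rule computable_list_code) (intro comp_intros assms)

lemma computable_act_list_code [comp_intros]:
  assumes "computable f" "computable g"
  shows "computable (\<lambda>x. act_list_code B n (f x) (g x))"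
  unfolding act_list_code_def by (rule computable_list_code) (intro comp_intros assms)

lemma computable_step_code:
  assumes tbl: "computable tbl"
  shows "computable (\<lambda>p. step_code B n tbl (pfst p) (psnd p))"
  unfolding step_code_def by (intro comp_intros computable_comp[OF tbl])

lemma computable_input_code [comp_intros]:
  assumes "computable f"
  shows "computable (\<lambda>x. input_code B (f x))"
proof -
  have "computable (\<lambda>x. foldr (\<lambda>b. (\<lambda>_ b r. r * B\<^sup>2 + 1 + b) x (of_bool b :: nat)) (dec (f x)) 0)"
    by (rule computable_foldr) (intro comp_intros assms)+
  then show ?thesis by (simp add: input_code_def)
qed

lemma computable_sim_code:
  assumes tbl: "computable tbl"
  shows "computable (\<lambda>p. sim_code B n tbl (pfst p) (pfst (psnd p)) (psnd (psnd p)))"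
proof -
  have s: "computable (\<lambda>p. step_code B n tbl (pfst (pfst p)) (psnd p))"
    using computable_comp[OF computable_step_code[OF tbl], of "\<lambda>p. prod_encode (pfst (pfst p), psnd p)"]
    by (simp add: comp_intros)
  have i: "computable (\<lambda>p. init_code B n (pfst (psnd p)))"
    unfolding init_code_def list_code.simps by (intro comp_intros)
  have r: "computable (\<lambda>p. (step_code B n tbl (pfst p) ^^ psnd (psnd p)) (init_code B n (pfst (psnd p))))"
    by (intro comp_intros s i)
  show ?thesis unfolding sim_code_def by (intro comp_intros r)
qed

definition config_rep :: "nat \<Rightarrow> config \<Rightarrow> nat \<Rightarrow> bool" where
  "config_rep B C c \<longleftrightarrow> (\<exists>us. c = prod_encode (state_code (fst C), list_code us) \<and>
     list_all2 (tape_rep B) (snd C) us)"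

text \<open>The table is only known to be correct for states and symbols of the machine; this
  invariant keeps every lookup inside it.\<close>

definition config_ok :: "otm \<Rightarrow> config \<Rightarrow> bool" where
  "config_ok M C \<longleftrightarrow> fst C \<in> states M \<and> length (snd C) = num_tapes M \<and>
     (\<forall>T \<in> set (snd C). range (fst T) \<subseteq> alphabet M)"

definition action_code :: "state \<times> (symbol \<times> move) list \<Rightarrow> nat" where
  "action_code v = prod_encode (state_code (fst v),
     list_code (map (\<lambda>(a, m). prod_encode (symbol_code a, move_code m)) (snd v)))"

definition scan_key :: "state \<times> symbol list \<Rightarrow> nat" where
  "scan_key k = prod_encode (state_code (fst k), list_code (map symbol_code (snd k)))"

lemma oracle_tm_transition:
  assumes "oracle_tm M" and "q \<in> states M - {Halt, Query}" and "length ss = num_tapes M"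
    and "set ss \<subseteq> alphabet M" and "transition M q ss = (q', as)"
  shows "q' \<in> states M \<and> length as = num_tapes M \<and> fst ` set as \<subseteq> alphabet M"
proof -
  have "\<forall>ss. length ss = num_tapes M \<and> set ss \<subseteq> alphabet M \<longrightarrow> (case transition M q ss of (q', as) \<Rightarrow>
      q' \<in> states M \<and> length as = num_tapes M \<and> fst ` set as \<subseteq> alphabet M)"
    using assms(1,2) unfolding oracle_tm_def by (elim conjE) (rule bspec)
  then show ?thesis using assms(3-) by fastforce
qed

lemma config_ok_step:
  assumes M: "oracle_tm M" and C: "config_ok M C"
  shows "config_ok M (step M A C)"
proof -
  obtain q ts where qts: "C = (q, ts)" by fastforce
  have c: "q \<in> states M" "length ts = num_tapes M" "\<And>T. T \<in> set ts \<Longrightarrow> range (fst T) \<subseteq> alphabet M"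
    using C by (auto simp: config_ok_def qts)
  have st: "{Yes, No} \<subseteq> states M" using M by (simp add: oracle_tm_def)
  consider "q = Halt" | "q = Query" | "q \<in> states M - {Halt, Query}" using c(1) by blast
  then show ?thesis
  proof cases
    case 3
    have "scanned T \<in> range (fst T)" for T by (cases T) auto
    then have "scanned T \<in> alphabet M" if "T \<in> set ts" for T using c(3)[OF that] by blast
    then have ss: "set (map scanned ts) \<subseteq> alphabet M" by (simp add: image_subset_iff)
    obtain q' as where tr: "transition M q (map scanned ts) = (q', as)" by fastforce
    have as: "q' \<in> states M" "length as = num_tapes M" "fst ` set as \<subseteq> alphabet M"
      using oracle_tm_transition[OF M 3 _ ss tr] c(2) by simp_all
    have r: "range (fst (act (a, m) T)) \<subseteq> alphabet M" if "(a, m) \<in> set as" "T \<in> set ts" for a m T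
    proof -
      have "a \<in> alphabet M" using that(1) as(3) by force
      then have "insert a (range (fst T)) \<subseteq> alphabet M" using c(3)[OF that(2)] by (rule insert_subsetI)
      moreover have "range (fst (act (a, m) T)) \<subseteq> insert a (range (fst T))" by (cases T) auto
      ultimately show ?thesis by (rule order_trans[rotated])
    qed
    have "range (fst T) \<subseteq> alphabet M" if T: "T \<in> set (map2 act as ts)" for T
    proof -
      obtain a m U where U: "T = act (a, m) U" "((a, m), U) \<in> set (zip as ts)"
        using T by (auto simp del: act.simps)
      then show ?thesis
        using r[OF set_zip_leftD set_zip_rightD, OF U(2) U(2)] by (simp del: act.simps)
    qed
    then show ?thesis using 3 as c(2) tr unfolding qts config_ok_def by simp
  qed (use c st in \<open>auto simp: qts config_ok_def\<close>)
qed

lemma oracle_of_word_on: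
  assumes "B \<ge> 2" and "tape_rep B T u"
  shows "(\<exists>x\<in>oracle_of w. word_on T x) \<longleftrightarrow> Suc (word_code B (pfst u)) = w"
proof -
  obtain y where y: "word_on T y" using word_on_exists[OF assms] by blast
  then have 1: "word_code B (pfst u) = enc y" by (rule word_code_correct[OF assms])
  have 2: "word_on T x \<longleftrightarrow> x = y" for x
    by (rule iffI) (rule word_on_unique[OF _ y], simp_all add: y)
  have 3: "dec s = y \<longleftrightarrow> enc y = s" for s by (metis dec_enc enc_dec)
  show ?thesis unfolding 1 2 using 3 by (cases w) simp_all
qed

lemma config_rep_step:
  assumes M: "oracle_tm M" and C: "config_ok M C" and rep: "config_rep B C c"
    and B: "B \<ge> 2" "\<forall>a \<in> alphabet M. symbol_code a < B"
    and tbl: "\<forall>q \<in> states M - {Halt, Query}. \<forall>ss. length ss = num_tapes M \<and> set ss \<subseteq> alphabet M \<longrightarrow>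
        tbl (scan_key (q, ss)) = action_code (transition M q ss)"
  shows "config_rep B (step M (oracle_of w) C) (step_code B (num_tapes M) tbl w c)"
proof -
  obtain q ts where qts: "C = (q, ts)" by fastforce
  obtain us where us: "c = prod_encode (state_code q, list_code us)" "list_all2 (tape_rep B) ts us"
    using rep by (auto simp: config_rep_def qts)
  have len: "length us = length ts" using us(2) by (simp add: list_all2_lengthD)
  have c: "q \<in> states M" "length ts = num_tapes M" "\<And>T. T \<in> set ts \<Longrightarrow> range (fst T) \<subseteq> alphabet M"
    using C by (auto simp: config_ok_def qts)
  have n3: "3 \<le> num_tapes M" using M by (simp add: oracle_tm_def)
  have nth: "tape_rep B (ts ! i) (us ! i)" "nth_code (list_code us) i = us ! i" if "i < num_tapes M" for i
    using that us(2) len c(2) by (auto simp: list_all2_conv_all_nth nth_code_list_code)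
  consider "q = Halt" | "q = Query" | "q \<in> states M - {Halt, Query}" using c(1) by blast
  then show ?thesis
  proof cases
    case 1
    then show ?thesis using rep by (simp add: qts us step_code_def)
  next
    case 2
    have "(\<exists>x\<in>oracle_of w. word_on (ts ! 2) x) \<longleftrightarrow>
        Suc (word_code B (pfst (nth_code (list_code us) 2))) = w"
      using oracle_of_word_on[OF B(1)] nth[of 2] n3 by simp
    then show ?thesis using 2 us unfolding config_rep_def
      by (auto simp: qts step_code_def)
  next
    case 3
    have "scanned T \<in> range (fst T)" for T by (cases T) auto
    then have "scanned T \<in> alphabet M" if "T \<in> set ts" for T using c(3)[OF that] by blast
    then have ss: "set (map scanned ts) \<subseteq> alphabet M" by (simp add: image_subset_iff)
    obtain q' as where tr: "transition M q (map scanned ts) = (q', as)" by fastforce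
    have as: "length as = num_tapes M" "fst ` set as \<subseteq> alphabet M"
      using oracle_tm_transition[OF M 3 _ ss tr] c(2) by simp_all
    have "scan_code B (num_tapes M) (list_code us) = list_code (map symbol_code (map scanned ts))"
      unfolding scan_code_def
      by (rule arg_cong[of _ _ list_code], rule nth_equalityI)
        (use nth c(2) in \<open>auto simp: tape_rep_scanned\<close>)
    then have key: "prod_encode (state_code q, scan_code B (num_tapes M) (list_code us)) =
        scan_key (q, map scanned ts)"
      by (simp add: scan_key_def)
    have t: "tbl (scan_key (q, map scanned ts)) = action_code (q', as)"
      using tbl 3 ss c(2) tr by simp
    have qc: "state_code q \<noteq> 1" "state_code q \<noteq> 2" using 3 by (cases q; auto)+
    let ?vs = "map (\<lambda>(a, m). prod_encode (symbol_code a, move_code m)) as"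
    have s: "step_code B (num_tapes M) tbl w c =
        prod_encode (state_code q', act_list_code B (num_tapes M) (list_code us) (list_code ?vs))"
      using qc t by (simp add: step_code_def us key action_code_def)
    have "list_all2 (tape_rep B) (map2 act as ts)
        (map (\<lambda>i. act_code B (nth_code (list_code us) i) (nth_code (list_code ?vs) i)) [0..<num_tapes M])"
    proof (rule list_all2_all_nthI)
      fix i assume "i < length (map2 act as ts)"
      then have i: "i < num_tapes M" using as(1) c(2) by simp
      obtain a m where am: "as ! i = (a, m)" by fastforce
      have "(a, m) \<in> set as" using i as(1) am by (metis nth_mem)
      then have "symbol_code a < B" using as(2) B(2) by force
      then have "tape_rep B (act (a, m) (ts ! i)) (act_code B (us ! i) (prod_encode (symbol_code a, move_code m)))"
        using tape_rep_act nth(1)[OF i] by blast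
      then show "tape_rep B (map2 act as ts ! i)
        (map (\<lambda>i. act_code B (nth_code (list_code us) i) (nth_code (list_code ?vs) i)) [0..<num_tapes M] ! i)"
        using i as(1) c(2) am nth(2)[OF i] by (simp add: nth_code_list_code)
    qed (use as c in simp)
    then show ?thesis using 3 tr unfolding config_rep_def s act_list_code_def
      by (auto simp: qts)
  qed
qed

lemma digit_0: "digit B 0 e = 0"
  by (simp add: digit_def)

lemma digit_pair_shift:
  assumes "d < B" and "B \<ge> 2"
  shows "digit B (r * B\<^sup>2 + d) 0 = d" and "digit B (r * B\<^sup>2 + d) 1 = 0"
    and "digit B (r * B\<^sup>2 + d) (Suc (Suc e)) = digit B r e"
proof -
  have 1: "r * B\<^sup>2 + d = d + B * (B * r)" by (simp add: power2_eq_square)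
  have 2: "(r * B\<^sup>2 + d) div B = B * r" unfolding 1 using assms by simp
  show "digit B (r * B\<^sup>2 + d) 0 = d" unfolding digit_def 1 using assms by simp
  show "digit B (r * B\<^sup>2 + d) 1 = 0" unfolding digit_def using 2 assms by simp
  have "(r * B\<^sup>2 + d) div B ^ Suc (Suc e) = (r * B\<^sup>2 + d) div B div B div B ^ e"
    by (simp add: div_mult2_eq)
  also have "\<dots> = r div B ^ e" unfolding 2 using assms by simp
  finally show "digit B (r * B\<^sup>2 + d) (Suc (Suc e)) = digit B r e" by (simp add: digit_def)
qed

lemma digit_input_code:
  assumes "B \<ge> 3"
  shows "digit B (input_code B (enc s)) (2 * k) = (if k < length s then 1 + of_bool (s ! k) else 0)"
    and "digit B (input_code B (enc s)) (Suc (2 * k)) = 0"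
proof -
  let ?f = "\<lambda>s. foldr (\<lambda>b r. r * B\<^sup>2 + 1 + of_bool b) s (0::nat)"
  have d: "1 + of_bool b < B" "2 \<le> B" for b using assms by auto
  have "digit B (?f s) (2 * k) = (if k < length s then 1 + of_bool (s ! k) else 0) \<and>
     digit B (?f s) (Suc (2 * k)) = 0"
  proof (induction s arbitrary: k)
    case Nil
    show ?case by (simp add: digit_0)
  next
    case (Cons b s)
    have f: "?f (b # s) = ?f s * B\<^sup>2 + (1 + of_bool b)" by simp
    show ?case
    proof (cases k)
      case 0
      then show ?thesis using digit_pair_shift(1,2)[OF d] unfolding f by simp
    next
      case (Suc j)
      have "2 * k = Suc (Suc (2 * j))" using Suc by simp
      then show ?thesis using digit_pair_shift(3)[OF d] Cons[of j] Suc unfolding f by simp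
    qed
  qed
  then show "digit B (input_code B (enc s)) (2 * k) = (if k < length s then 1 + of_bool (s ! k) else 0)"
    "digit B (input_code B (enc s)) (Suc (2 * k)) = 0"
    by (simp_all add: input_code_def)
qed

lemma init_rep:
  assumes M: "oracle_tm M" and B: "B \<ge> 3"
  shows "config_rep B (init_config M x) (init_code B (num_tapes M) (enc x))"
    and "config_ok M (init_config M x)"
proof -
  have 1: "tape_rep B (tape_of x) (prod_encode (input_code B (enc x), 0))"
  proof -
    have "digit B (input_code B (enc x)) (int_encode i) = symbol_code (fst (tape_of x) i)" for i
    proof (cases "i < 0")
      case True
      then show ?thesis using digit_input_code(2)[OF B] by (simp add: int_encode_neg tape_of_def)
    next
      case False
      then show ?thesis using digit_input_code(1)[OF B]
        by (auto simp: int_encode_nonneg tape_of_def nat_less_iff)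
    qed
    then show ?thesis by (simp add: tape_rep_def int_encode_nonneg, simp add: tape_of_def int_encode_nonneg)
  qed
  have 2: "tape_rep B (tape_of []) 0"
    by (simp add: tape_rep_def tape_of_def digit_0 int_encode_nonneg)
  have "list_all2 (tape_rep B) (tape_of x # replicate (num_tapes M - 1) (tape_of []))
      (prod_encode (input_code B (enc x), 0) # replicate (num_tapes M - 1) 0)"
    using 1 2 by (simp only: list_all2_Cons) (simp add: list_all2_conv_all_nth)
  then show "config_rep B (init_config M x) (init_code B (num_tapes M) (enc x))"
    unfolding config_rep_def init_config_def init_code_def fst_conv snd_conv state_code.simps
    by blast
  have bits: "{Blank, Bit False, Bit True} \<subseteq> alphabet M" "3 \<le> num_tapes M" "Start \<in> states M"
    using M by (simp_all add: oracle_tm_def)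
  have "Bit b \<in> alphabet M" for b using bits by (cases b) auto
  then have "range (fst (tape_of z)) \<subseteq> alphabet M" for z
    using bits by (auto simp: tape_of_def)
  then show "config_ok M (init_config M x)"
    using bits by (auto simp: config_ok_def init_config_def)
qed

text \<open>The simulation runs for \<open>k\<close> steps only and is therefore total; the value 0
  means that \<open>k\<close> steps were not enough, and outputs are shifted by 1 to make room for
  it. The oracle is an argument, which later allows its string to be taken from an input.\<close>

theorem simulation:
  assumes M: "oracle_tm M"
  shows "\<exists>sim. computable (\<lambda>p. sim (pfst p) (pfst (psnd p)) (psnd (psnd p))) \<and>
    (\<forall>w x k y. sim w (enc x) k = Suc (enc y) \<longleftrightarrow>
      (\<exists>ts. (step M (oracle_of w) ^^ k) (init_config M x) = (Halt, ts) \<and> word_on (ts ! 1) y))"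
proof -
  have fin: "finite (states M)" "finite (alphabet M)" using M by (simp_all add: oracle_tm_def)
  \<comment> \<open>Every symbol code is a summand and so below \<open>B\<close>; the added constant
    gives \<open>B >= 3\<close>, as \<open>input_code\<close> has the digits 1 and 2.\<close>
  define B where "B = Suc (3 + (\<Sum>a\<in>alphabet M. symbol_code a))"
  have B: "B \<ge> 3" by (simp add: B_def)
  have B': "\<forall>a \<in> alphabet M. symbol_code a < B"
    using member_le_sum[of _ "alphabet M" symbol_code] fin(2) by (fastforce simp: B_def)
  let ?K = "(states M) \<times> {ss. set ss \<subseteq> alphabet M \<and> length ss = num_tapes M}"
  have "finite ?K" using fin finite_lists_length_eq by blast
  moreover have "inj_on scan_key ?K"
  proof (rule inj_onI)
    fix k l assume kl: "k \<in> ?K" "l \<in> ?K" and e: "scan_key k = scan_key l"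
    have "fst k = fst l" using e state_code_inject by (simp add: scan_key_def)
    moreover have "map symbol_code (snd k) = map symbol_code (snd l)"
      using e kl by (intro list_code_inject) (auto simp: scan_key_def)
    then have "snd k = snd l"
      using symbol_code_inject by (simp add: inj_map_eq_map inj_def)
    ultimately show "k = l" by (rule prod_eqI)
  qed
  ultimately obtain tbl where tbl: "computable tbl"
    "\<forall>k\<in>?K. tbl (scan_key k) = action_code (transition M (fst k) (snd k))"
    using finite_table[of ?K scan_key "\<lambda>k. action_code (transition M (fst k) (snd k))"] by blast
  let ?n = "num_tapes M"
  have run: "config_rep B ((step M (oracle_of w) ^^ k) (init_config M x))
       ((step_code B ?n tbl w ^^ k) (init_code B ?n (enc x))) \<and>
     config_ok M ((step M (oracle_of w) ^^ k) (init_config M x))" for w k x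
  proof (induction k)
    case 0
    then show ?case using init_rep[OF M B] by simp
  next
    case (Suc k)
    then show ?case using config_rep_step[OF M _ _ _ B', of _ _ tbl] config_ok_step[OF M] B tbl(2)
      by (simp del: step.simps)
  qed
  have "sim_code B ?n tbl w (enc x) k = Suc (enc y) \<longleftrightarrow>
      (\<exists>ts. (step M (oracle_of w) ^^ k) (init_config M x) = (Halt, ts) \<and> word_on (ts ! 1) y)" for w x k y
  proof -
    obtain q ts where qts: "(step M (oracle_of w) ^^ k) (init_config M x) = (q, ts)" by fastforce
    obtain us where us: "(step_code B ?n tbl w ^^ k) (init_code B ?n (enc x)) =
        prod_encode (state_code q, list_code us)" "list_all2 (tape_rep B) ts us"
      using run[where w = w and k = k and x = x] by (auto simp: config_rep_def qts)
    have "length ts = ?n" using run[where w = w and k = k and x = x] by (simp add: config_ok_def qts)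
    moreover have "3 \<le> ?n" using M by (simp add: oracle_tm_def)
    ultimately have l: "1 < length ts" "length us = length ts"
      using us(2) by (auto simp: list_all2_lengthD)
    then have rep: "tape_rep B (ts ! 1) (us ! 1)" and n: "nth_code (list_code us) 1 = us ! 1"
      using us(2) by (simp_all add: list_all2_conv_all_nth nth_code_list_code)
    have B2: "2 \<le> B" using B by simp
    have "word_code B (pfst (us ! 1)) = enc y \<longleftrightarrow> word_on (ts ! 1) y"
      using word_code_correct[OF B2 rep] word_on_exists[OF B2 rep] by (metis enc_inject)
    moreover have "state_code q = 1 \<longleftrightarrow> q = Halt" by (cases q) auto
    ultimately show ?thesis unfolding sim_code_def us qts using n by auto
  qed
  then show ?thesis using computable_sim_code[OF tbl(1)] by blast
qed

section \<open>Coding finite sets of strings\<close>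

lemma Suc_enc_snoc: "Suc (enc (s @ [b])) = 2 * Suc (enc s) + of_bool b"
  by simp

lemma inj_dec: "inj dec"
  by (metis enc_dec injI)

lemma shortlex_index_eq: "shortlex_index s = Suc (enc s)"
  by (induction s rule: rev_induct) (auto simp: shortlex_index_def)

lemma inj_shortlex_index: "inj shortlex_index"
  by (auto simp: inj_def shortlex_index_eq)

text \<open>\<open>sorted_key_list_of_set\<close> folds insertion over a set. Injectivity of the key
  makes insertions commute, so a sorted list can be rebuilt element by element.\<close>

lemma sorted_key_list_of_set_set:
  assumes "distinct xs" and "sorted (map shortlex_index xs)"
  shows "sorted_key_list_of_set shortlex_index (set xs) = xs"
proof -
  have comm: "insort_key shortlex_index y (insort_key shortlex_index x zs) =
      insort_key shortlex_index x (insort_key shortlex_index y zs)" for x y zs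
    using inj_shortlex_index by (induction zs) (auto simp: inj_eq)
  interpret folding_on UNIV "insort_key shortlex_index" "[]"
    by standard (auto simp: comm fun_eq_iff)
  have "F (set xs) = xs"
    using assms
  proof (induction xs)
    case (Cons x xs)
    then show ?case by (simp add: insort_is_Cons)
  qed simp
  then show ?thesis by (simp add: sorted_key_list_of_set_def)
qed

section \<open>Lengths and binary values in terms of codes\<close>

lemma enc_bounds: "2 ^ length s \<le> Suc (enc s)" "Suc (enc s) < 2 ^ Suc (length s)"
proof -
  have "2 ^ length s \<le> Suc (enc s) \<and> Suc (enc s) < 2 ^ Suc (length s)"
  proof (induction s rule: rev_induct)
    case (snoc b s)
    have "(of_bool b :: nat) \<le> 1" by simp
    then show ?case using snoc unfolding Suc_enc_snoc by (simp del: of_bool_less_eq_one)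
  qed simp
  then show "2 ^ length s \<le> Suc (enc s)" "Suc (enc s) < 2 ^ Suc (length s)" by blast+
qed

lemma length_le_enc: "length s \<le> enc s"
  using enc_bounds(1)[of s] less_exp[of "length s"] by linarith

text \<open>There are \<open>2 ^ Suc n - 1\<close> strings of length at most \<open>n\<close>, and
  codes number the strings by length. Bounds on lengths thus become bounds for sums and recursions
  over codes.\<close>

lemma length_le_iff: "length s \<le> n \<longleftrightarrow> enc s < 2 ^ Suc n - 1"
proof
  assume "length s \<le> n"
  then have "(2::nat) ^ Suc (length s) \<le> 2 ^ Suc n" by (intro power_increasing) auto
  then show "enc s < 2 ^ Suc n - 1" using enc_bounds(2)[of s] by linarith
next
  assume "enc s < 2 ^ Suc n - 1"
  then have "(2::nat) ^ length s < 2 ^ Suc n" using enc_bounds(1)[of s] by linarith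
  then show "length s \<le> n" by (metis less_Suc_eq_le power_less_imp_less_exp one_less_numeral_iff semiring_norm(76))
qed

definition binary_val :: "bool list \<Rightarrow> nat" where
  "binary_val s = foldl (\<lambda>v b. 2 * v + of_bool b) 0 s"

text \<open>\<open>Suc (enc s)\<close> has the binary notation \<open>1 s\<close>; dropping the
  leading 1 leaves the value of \<open>s\<close>.\<close>

definition val_code :: "nat \<Rightarrow> nat" where
  "val_code c = Suc c - 2 ^ length (dec c)"

lemma val_code_enc [simp]: "val_code (enc s) = binary_val s"
proof -
  have "Suc (enc s) = 2 ^ length s + binary_val s"
    by (induction s rule: rev_induct) (auto simp: binary_val_def)
  then show ?thesis by (simp add: val_code_def)
qed

lemma computable_val_code [comp_intros]:
  "computable f \<Longrightarrow> computable (\<lambda>x. val_code (f x))"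
  unfolding val_code_def by (intro comp_intros)

lemma binary_val_binary_of_nat: "binary_val (binary_of_nat n) = n"
proof (induction n rule: binary_of_nat.induct)
  case (1 n)
  then show ?case
    by (subst binary_of_nat.simps) (auto simp: binary_val_def elim: oddE)
qed

text \<open>For \<open>n >= 1\<close> the notation of \<open>n\<close> is a 1 followed by the string
  with code \<open>n - 1\<close>, since \<open>Suc (enc s)\<close> is written
  \<open>1 s\<close>.\<close>

definition nat_code :: "nat \<Rightarrow> nat" where
  "nat_code n = enc (dec (enc [True]) @ dec (n - 1))"

lemma computable_nat_code [comp_intros]:
  "computable f \<Longrightarrow> computable (\<lambda>x. nat_code (f x))"
  unfolding nat_code_def
  by (intro computable_append computable_const computable_comp[OF computable_pred])

lemma enc_binary_of_nat: "n \<ge> 1 \<Longrightarrow> enc (binary_of_nat n) = nat_code n"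
proof -
  assume n: "n \<ge> 1"
  have "binary_of_nat n = True # dec (n - 1)"
    using n
  proof (induction n rule: less_induct)
    case (less n)
    have b: "binary_of_nat n = binary_of_nat (n div 2) @ [odd n]"
      using less.prems by (subst binary_of_nat.simps) simp
    show ?case
    proof (cases "n = 1")
      case True
      then show ?thesis unfolding b by (simp add: binary_of_nat.simps[of 0])
    next
      case False
      then have n: "n \<ge> 2" using less.prems by simp
      then have "n div 2 - 1 = (n - 1 - 1) div 2" by presburger
      moreover have "even (n - 1) = odd n" using n by simp
      moreover have "binary_of_nat (n div 2) = True # dec (n div 2 - 1)"
        using less.IH[of "n div 2"] n by simp
      ultimately show ?thesis unfolding b using dec_pos[of "n - 1"] n by simp
    qed
  qed
  then show ?thesis by (simp add: nat_code_def)
qed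

lemma length_real_restrict [simp]: "length (real_restrict \<alpha> n) = nat n"
  by (simp add: real_restrict_def)

text \<open>Passing from \<open>y\<close> to \<open>2 * y\<close> doubles the floor and adds 0 or 1,
  and the parity that defines the next bit tells which.\<close>

lemma binary_val_real_restrict:
  "int (binary_val (real_restrict \<alpha> n)) = \<lfloor>2 ^ nat n * frac \<alpha>\<rfloor>"
proof -
  have "int (binary_val (map (\<lambda>i. odd \<lfloor>2 ^ i * frac \<alpha>\<rfloor>) [1..<m + 1])) = \<lfloor>2 ^ m * frac \<alpha>\<rfloor>" for m
  proof (induction m)
    case 0
    have "\<lfloor>frac \<alpha>\<rfloor> = 0" by (simp add: floor_eq_iff frac_lt_1)
    then show ?case by (simp add: binary_val_def)
  next
    case (Suc m)
    let ?y = "2 ^ m * frac \<alpha>"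
    have "\<lfloor>2 * ?y\<rfloor> = 2 * \<lfloor>?y\<rfloor> \<or> \<lfloor>2 * ?y\<rfloor> = 2 * \<lfloor>?y\<rfloor> + 1" by linarith
    then have "\<lfloor>2 * ?y\<rfloor> = 2 * \<lfloor>?y\<rfloor> + of_bool (odd \<lfloor>2 * ?y\<rfloor>)" by auto
    then show ?case using Suc by (simp add: binary_val_def mult.assoc)
  qed
  then show ?thesis by (simp add: real_restrict_def)
qed

lemma computable_self_delimiting [comp_intros]:
  assumes "computable f"
  shows "computable (\<lambda>x. enc (self_delimiting (dec (f x))))"
proof -
  let ?g = "\<lambda>b r. enc (dec (if b = 0 then enc [True, False] else enc [True, True]) @ dec r)"
  have "computable (\<lambda>x. foldr (\<lambda>b. (\<lambda>_. ?g) x (of_bool b :: nat)) (dec (f x)) (enc [False]))"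
    by (rule computable_foldr) (intro comp_intros assms)+
  moreover have "foldr (\<lambda>b. ?g (of_bool b)) s (enc [False]) = enc (self_delimiting s)" for s
    by (induction s) auto
  ultimately show ?thesis by simp
qed

text \<open>Increasing codes list the strings in the order used by \<open>encode_set\<close>, so no
  sorting occurs.\<close>

definition set_code :: "(nat \<Rightarrow> nat \<Rightarrow> nat) \<Rightarrow> nat \<Rightarrow> nat \<Rightarrow> nat" where
  "set_code w n k = rec_nat 0
     (\<lambda>i r. if w i k = 0 then r else enc (dec r @ dec (enc (self_delimiting (dec i))))) (2 ^ Suc n - 1)"

lemma computable_set_code [comp_intros]:
  assumes w: "computable (\<lambda>p. w (pfst p) (psnd p))" and "computable f" and g: "computable g"
  shows "computable (\<lambda>x. set_code w (f x) (g x))"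
proof -
  have "computable (\<lambda>p. w (pfst (psnd p)) (g (pfst p)))"
    using computable_comp[OF w, of "\<lambda>p. prod_encode (pfst (psnd p), g (pfst p))"]
    by (simp add: comp_intros computable_comp[OF g])
  then show ?thesis unfolding set_code_def by (intro comp_intros assms)
qed

lemma set_code_correct:
  "set_code w n k = enc (encode_set {p. length p \<le> n \<and> w (enc p) k \<noteq> 0})"
proof -
  let ?l = "\<lambda>m. map dec (filter (\<lambda>i. w i k \<noteq> 0) [0..<m])"
  have 1: "rec_nat 0 (\<lambda>i r. if w i k = 0 then r else enc (dec r @ dec (enc (self_delimiting (dec i))))) m
      = enc (concat (map self_delimiting (?l m)))" for m
    by (induction m) auto
  let ?m = "2 ^ Suc n - 1"
  have set: "set (?l ?m) = {p. length p \<le> n \<and> w (enc p) k \<noteq> 0}"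
    unfolding length_le_iff by (auto simp: image_iff) (metis dec_enc)
  have "map shortlex_index (?l ?m) = map Suc (filter (\<lambda>i. w i k \<noteq> 0) [0..<?m])"
    by (simp add: shortlex_index_eq)
  moreover have "sorted (map Suc (filter (\<lambda>i. w i k \<noteq> 0) [0..<?m]))"
    by (rule sorted_filter[of Suc "[0..<?m]" "\<lambda>i. w i k \<noteq> 0"]) (simp add: sorted_iff_nth_mono)
  moreover have "distinct (?l ?m)" by (simp add: distinct_map inj_on_subset[OF inj_dec subset_UNIV])
  ultimately have "sorted_key_list_of_set shortlex_index (set (?l ?m)) = ?l ?m"
    by (intro sorted_key_list_of_set_set) (auto simp del: map_map)
  then show ?thesis unfolding encode_set_def set[symmetric] set_code_def 1 by simp
qed

text \<open>The length of the code is a sum of positive contributions of the elements, so a proper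
  subset has a shorter code. This comparison takes the place of decoding.\<close>

lemma encode_set_subset_eq:
  assumes "finite T" and "S \<subseteq> T" and "encode_set S = encode_set T"
  shows "S = T"
proof -
  let ?g = "\<lambda>p. length (self_delimiting p)"
  have len: "length (encode_set X) = (\<Sum>p\<in>X. ?g p)" if "finite X" for X
  proof -
    obtain ys where "set ys = X" "distinct ys" using finite_distinct_list \<open>finite X\<close> by blast
    then obtain xs where xs: "set xs = X" "distinct xs" "sorted (map shortlex_index xs)"
      using sorted_sort_key[of shortlex_index ys] by (metis distinct_sort set_sort)
    then have "sorted_key_list_of_set shortlex_index X = xs"
      using sorted_key_list_of_set_set by blast
    moreover have "sum_list (map ?g xs) = (\<Sum>p\<in>X. ?g p)"
      using xs by (metis sum_list_distinct_conv_sum_set)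
    ultimately show ?thesis by (simp add: encode_set_def length_concat o_def)
  qed
  have fS: "finite S" using assms(1,2) by (rule rev_finite_subset)
  have pos: "?g p > 0" for p by (cases p) auto
  show ?thesis
  proof (rule ccontr)
    assume "S \<noteq> T"
    then obtain p where p: "p \<in> T" "p \<notin> S" using assms(2) by blast
    have "(\<Sum>p\<in>S. ?g p) < (\<Sum>p\<in>T. ?g p)"
      by (rule sum_strict_mono2[OF assms(1,2), of p]) (use p pos in auto)
    then show False using len[OF fS] len[OF assms(1)] assms(3) by simp
  qed
qed

text \<open>Every \<open>p\<close> is extended to all strings of the common length \<open>N\<close>;
  prefix-freeness makes these families disjoint, and together they have at most \<open>2 ^ N\<close>
  members. The sum of all lengths is just a convenient upper bound for each of them.\<close>

lemma kraft:
  assumes "finite S" and "prefix_free S"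
  shows "(\<Sum>p\<in>S. (1/2 :: real) ^ length p) \<le> 1"
proof -
  define N where "N = (\<Sum>p\<in>S. length p)"
  have N: "length p \<le> N" if "p \<in> S" for p
    unfolding N_def using member_le_sum[OF that, of length] assms(1) by simp
  let ?L = "\<lambda>k. {x :: bool list. set x \<subseteq> UNIV \<and> length x = k}"
  let ?E = "\<lambda>p. (@) p ` ?L (N - length p)"
  have card: "card (?E p) = 2 ^ (N - length p)" for p
  proof -
    have "card (?E p) = card (?L (N - length p))" by (rule card_image) (simp add: inj_on_def)
    then show ?thesis using card_lists_length_eq[of "UNIV :: bool set"] by simp
  qed
  have fin: "finite (?E p)" for p using finite_lists_length_eq[of "UNIV :: bool set"] by simp
  have disj: "?E p \<inter> ?E q = {}" if "p \<in> S" "q \<in> S" "p \<noteq> q" for p q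
  proof (rule ccontr)
    assume "?E p \<inter> ?E q \<noteq> {}"
    then obtain u v where "p @ u = q @ v" by blast
    then have "prefix p (p @ u)" "prefix q (p @ u)" by (rule_tac [2] prefixI) simp_all
    then have "prefix p q \<or> prefix q p" by (metis prefix_same_cases)
    then show False using that assms(2) unfolding prefix_free_def by metis
  qed
  have "(\<Sum>p\<in>S. 2 ^ (N - length p)) = card (\<Union>p\<in>S. ?E p)"
    using assms(1) fin disj card by (subst card_UN_disjoint) auto
  also have "\<dots> \<le> card (?L N)"
    using N finite_lists_length_eq[of "UNIV :: bool set" N] by (intro card_mono) auto
  also have "\<dots> = 2 ^ N" using card_lists_length_eq[of "UNIV :: bool set" N] by simp
  finally have "real (\<Sum>p\<in>S. 2 ^ (N - length p)) \<le> 2 ^ N"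
    by (metis of_nat_le_iff of_nat_numeral of_nat_power)
  then have "(\<Sum>p\<in>S. (2::real) ^ (N - length p)) \<le> 2 ^ N" by simp
  moreover have "(2::real) ^ (N - length p) = 2 ^ N * (1/2) ^ length p" if "p \<in> S" for p
    using N[OF that] by (simp add: power_diff power_one_over field_simps)
  ultimately have "2 ^ N * (\<Sum>p\<in>S. (1/2 :: real) ^ length p) \<le> 2 ^ N * 1"
    by (simp add: sum_distrib_left)
  then show ?thesis by (rule mult_left_le_imp_le) simp
qed

lemma prefix_free_subset: "prefix_free T \<Longrightarrow> S \<subseteq> T \<Longrightarrow> prefix_free S"
  unfolding prefix_free_def by blast

text \<open>Kraft's inequality bounds the finite subsums. Hence the family is summable, its infinite
  sum is no default value, and it is the supremum of the finite ones.\<close>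

lemma Omega_bounds:
  assumes "prefix_free (dom V)"
  shows "finite F \<Longrightarrow> F \<subseteq> dom V \<Longrightarrow> (\<Sum>p\<in>F. (1/2) ^ length p) \<le> Omega V"
    and "e > 0 \<Longrightarrow> \<exists>F. finite F \<and> F \<subseteq> dom V \<and> Omega V - e < (\<Sum>p\<in>F. (1/2) ^ length p)"
    and "0 \<le> Omega V"
proof -
  let ?g = "\<lambda>p :: bool list. (1/2 :: real) ^ length p"
  have bdd: "bdd_above (sum ?g ` {F. F \<subseteq> dom V \<and> finite F})"
    using kraft prefix_free_subset[OF assms] by (intro bdd_aboveI[of _ 1]) auto
  have summable: "?g summable_on dom V" using bdd by (intro nonneg_bdd_above_summable_on) auto
  show "finite F \<Longrightarrow> F \<subseteq> dom V \<Longrightarrow> (\<Sum>p\<in>F. ?g p) \<le> Omega V"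
    unfolding Omega_def using summable by (intro finite_sum_le_infsum) auto
  show "0 \<le> Omega V" unfolding Omega_def by (intro infsum_nonneg) auto
  assume e: "e > 0"
  have O: "Omega V = (SUP F\<in>{F. finite F \<and> F \<subseteq> dom V}. sum ?g F)"
    unfolding Omega_def using bdd by (intro nonneg_bdd_above_infsum) auto
  have "Omega V - e < (SUP F\<in>{F. finite F \<and> F \<subseteq> dom V}. sum ?g F)"
    using e O by linarith
  moreover have "bdd_above (sum ?g ` {F. finite F \<and> F \<subseteq> dom V})"
    using bdd by (simp add: conj_commute)
  ultimately show "\<exists>F. finite F \<and> F \<subseteq> dom V \<and> Omega V - e < (\<Sum>p\<in>F. ?g p)"
    by (subst (asm) less_cSUP_iff) auto
qed

section \<open>From the halting probability to the domain\<close>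

text \<open>By the last clause a result, once found, stays, so that stages can be raised
  freely.\<close>

definition simulates :: "(nat \<Rightarrow> nat \<Rightarrow> nat \<Rightarrow> nat) \<Rightarrow> otm \<Rightarrow> bool" where
  "simulates sim M \<longleftrightarrow> computable (\<lambda>p. sim (pfst p) (pfst (psnd p)) (psnd (psnd p))) \<and>
    (\<forall>w x y. halts_with M (oracle_of w) x y \<longleftrightarrow> (\<exists>k. sim w (enc x) k = Suc (enc y))) \<and>
    (\<forall>w x k l v. sim w x k = Suc v \<longrightarrow> k \<le> l \<longrightarrow> sim w x l = Suc v)"

lemma simulates_exists:
  assumes "oracle_tm M"
  shows "\<exists>sim. simulates sim M"
proof -
  obtain sim where sim: "computable (\<lambda>p. sim (pfst p) (pfst (psnd p)) (psnd (psnd p)))"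
    "\<And>w x k y. sim w (enc x) k = Suc (enc y) \<longleftrightarrow>
      (\<exists>ts. (step M (oracle_of w) ^^ k) (init_config M x) = (Halt, ts) \<and> word_on (ts ! 1) y)"
    using simulation[OF assms] by blast
  have "sim w x l = Suc v" if v: "sim w x k = Suc v" and "k \<le> l" for w x k l v
  proof -
    obtain ts where ts: "(step M (oracle_of w) ^^ k) (init_config M (dec x)) = (Halt, ts)"
      "word_on (ts ! 1) (dec v)"
      using sim(2)[of w "dec x" k "dec v"] v by auto
    have "fst ((step M (oracle_of w) ^^ k) (init_config M (dec x))) = Halt" unfolding ts by simp
    then have "(step M (oracle_of w) ^^ l) (init_config M (dec x)) = (Halt, ts)"
      using funpow_step_after_Halt[OF _ \<open>k \<le> l\<close>] ts(1) by metis
    then show ?thesis using sim(2)[of w "dec x" l "dec v"] ts(2) by auto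
  qed
  then have "simulates sim M" unfolding simulates_def halts_with_def using sim by blast
  then show ?thesis by blast
qed

definition approximates :: "(nat \<Rightarrow> nat \<Rightarrow> nat) \<Rightarrow> (bool list \<rightharpoonup> bool list) \<Rightarrow> bool" where
  "approximates v C \<longleftrightarrow> computable (\<lambda>p. v (pfst p) (psnd p)) \<and>
    (\<forall>x y. C x = Some y \<longleftrightarrow> (\<exists>k. v (enc x) k = Suc (enc y))) \<and>
    (\<forall>x k l u. v x k = Suc u \<longrightarrow> k \<le> l \<longrightarrow> v x l = Suc u)"

lemma approximates_exists:
  assumes "partial_recursive C"
  shows "\<exists>v. approximates v C"
proof -
  obtain M where M: "oracle_tm M" "\<And>x y. C x = Some y \<longleftrightarrow> halts_with M {} x y"
    using assms by (auto simp: partial_recursive_def)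
  obtain sim where sim: "simulates sim M" using simulates_exists[OF M(1)] by blast
  then have "computable (\<lambda>p. sim (pfst p) (pfst (psnd p)) (psnd (psnd p)))"
    unfolding simulates_def by (rule conjunct1)
  from computable_comp[OF this, of "\<lambda>p. prod_encode (0, p)"]
  have "computable (\<lambda>p. sim 0 (pfst p) (psnd p))" by (simp add: comp_intros)
  moreover have "C x = Some y \<longleftrightarrow> (\<exists>k. sim 0 (enc x) k = Suc (enc y))" for x y
    using sim M(2) unfolding simulates_def by (metis oracle_of.simps(1))
  moreover have "sim 0 x k = Suc u \<longrightarrow> k \<le> l \<longrightarrow> sim 0 x l = Suc u" for x k l u
    using sim unfolding simulates_def by blast
  ultimately have "approximates (sim 0) C" unfolding approximates_def by blast
  then show ?thesis by blast
qed

lemma approximates_iff: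
  "approximates v C \<Longrightarrow> C x = Some y \<longleftrightarrow> (\<exists>k. v (enc x) k = Suc (enc y))"
  unfolding approximates_def by (elim conjE) (drule spec, erule spec)

lemma approximates_computable: "approximates v C \<Longrightarrow> computable (\<lambda>p. v (pfst p) (psnd p))"
  unfolding approximates_def by (rule conjunct1)

lemma approximates_SomeD:
  assumes "approximates v C" and "v (enc p) k \<noteq> 0"
  shows "C p = Some (dec (v (enc p) k - 1))"
  unfolding approximates_iff[OF assms(1)] using assms(2) by (intro exI[of _ k]) simp

lemma approximates_mono:
  assumes "approximates v C" and "v x k \<noteq> 0" and "k \<le> l"
  shows "v x l = v x k"
proof -
  obtain u where u: "v x k = Suc u" using assms(2) not0_implies_Suc by blast
  have "\<forall>x k l u. v x k = Suc u \<longrightarrow> k \<le> l \<longrightarrow> v x l = Suc u"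
    using assms(1) unfolding approximates_def by (elim conjE)
  then have "v x l = Suc u" using u assms(3) by blast
  then show ?thesis using u by simp
qed

lemma approximates_dom:
  assumes "approximates v C"
  shows "p \<in> dom C \<longleftrightarrow> (\<exists>k. v (enc p) k \<noteq> 0)"
proof
  assume "p \<in> dom C"
  then obtain y where "C p = Some y" by blast
  then obtain k where "v (enc p) k = Suc (enc y)" using approximates_iff[OF assms] by metis
  then show "\<exists>k. v (enc p) k \<noteq> 0" by (intro exI[of _ k]) simp
next
  assume "\<exists>k. v (enc p) k \<noteq> 0"
  then show "p \<in> dom C" using approximates_SomeD[OF assms] by blast
qed

section \<open>The weight of the programs that have halted by a stage\<close>

definition halted :: "(nat \<Rightarrow> nat \<Rightarrow> nat) \<Rightarrow> nat \<Rightarrow> bool list set" where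
  "halted v k = dec ` {q. q < k \<and> v q k \<noteq> 0}"

lemma in_halted: "p \<in> halted v k \<longleftrightarrow> enc p < k \<and> v (enc p) k \<noteq> 0"
  unfolding halted_def by (auto simp: image_iff intro: exI[of _ "enc p"])

lemma finite_halted: "finite (halted v k)"
  by (simp add: halted_def)

lemma halted_subset: "approximates v C \<Longrightarrow> halted v k \<subseteq> dom C"
  by (auto simp: in_halted dest: approximates_SomeD)

lemma halted_mono:
  assumes "approximates v C" and "k \<le> l"
  shows "halted v k \<subseteq> halted v l"
proof
  fix p assume "p \<in> halted v k"
  then have p: "enc p < k" "v (enc p) k \<noteq> 0" by (simp_all add: in_halted)
  then have "v (enc p) l \<noteq> 0" using approximates_mono[OF assms(1) p(2) assms(2)] by simp
  then show "p \<in> halted v l" using p(1) assms(2) by (simp add: in_halted)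
qed

lemma halted_exhausts:
  assumes v: "approximates v C" and "finite F" and "F \<subseteq> dom C"
  shows "\<exists>k. F \<subseteq> halted v k"
  using assms(2,3)
proof (induction F rule: finite_induct)
  case (insert p F)
  then obtain k l where k: "F \<subseteq> halted v k" and l: "v (enc p) l \<noteq> 0"
    using approximates_dom[OF v] by auto
  let ?m = "max k (max l (Suc (enc p)))"
  have "F \<subseteq> halted v ?m" using k halted_mono[OF v, of k ?m] by auto
  moreover have "p \<in> halted v ?m"
    using l approximates_mono[OF v l, of ?m] by (auto simp: in_halted)
  ultimately show ?case by blast
qed simp

text \<open>The weight is scaled by \<open>2 ^ k\<close> to be an integer: programs found by stage
  \<open>k\<close> have codes below \<open>k\<close>, and a string is never longer than its
  code.\<close>

definition mass :: "(nat \<Rightarrow> nat \<Rightarrow> nat) \<Rightarrow> nat \<Rightarrow> nat" where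
  "mass v k = (\<Sum>q<k. if v q k = 0 then 0 else 2 ^ (k - length (dec q)))"

lemma mass_eq: "real (mass v k) = 2 ^ k * (\<Sum>p\<in>halted v k. (1/2) ^ length p)"
proof -
  let ?H = "{q. q < k \<and> v q k \<noteq> 0}"
  have "mass v k = (\<Sum>q\<in>?H. 2 ^ (k - length (dec q)))"
    unfolding mass_def by (rule sum.mono_neutral_cong_right) auto
  also have "real \<dots> = (\<Sum>q\<in>?H. 2 ^ k * (1/2) ^ length (dec q))"
    unfolding of_nat_sum
  proof (rule sum.cong[OF refl])
    fix q assume "q \<in> ?H"
    then have "length (dec q) \<le> k" using length_le_enc[of "dec q"] by simp
    then have "(2::real) ^ (k - length (dec q)) = 2 ^ k * (1/2) ^ length (dec q)"
      by (simp add: power_diff power_one_over field_simps)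
    then show "real (2 ^ (k - length (dec q))) = 2 ^ k * (1/2) ^ length (dec q)"
      by simp
  qed
  also have "\<dots> = (\<Sum>p\<in>halted v k. 2 ^ k * (1/2) ^ length p)"
    unfolding halted_def
    by (subst sum.reindex[OF inj_on_subset[OF inj_dec subset_UNIV]]) simp
  finally show ?thesis by (simp add: sum_distrib_left)
qed

text \<open>
  Writing \<open>m\<close> for the length of the string coded by \<open>s\<close>, this says that the weight of the
  programs found by stage \<open>k\<close> exceeds \<open>z + 0.s - 2^-m\<close>. The term \<open>2^-m\<close> makes the search
  terminate even if the weights only converge to a dyadic rational.
\<close>

definition nearly_exhausted :: "(nat \<Rightarrow> nat \<Rightarrow> nat) \<Rightarrow> nat \<Rightarrow> nat \<Rightarrow> nat \<Rightarrow> bool" where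
  "nearly_exhausted v z s k \<longleftrightarrow>
    (z * 2 ^ length (dec s) + val_code s) * 2 ^ k < mass v k * 2 ^ length (dec s) + 2 ^ k"

text \<open>Multiplication by \<open>2 ^ length s\<close> and \<open>2 ^ k\<close> turns the
  inequality between reals into the integer test.\<close>

lemma nearly_exhausted_iff:
  "nearly_exhausted v z (enc s) k \<longleftrightarrow>
    real z + real (binary_val s) / 2 ^ length s - 1 / 2 ^ length s < (\<Sum>p\<in>halted v k. (1/2) ^ length p)"
  (is "_ \<longleftrightarrow> ?l < ?S")
proof -
  let ?m = "(2::real) ^ length s" and ?k = "(2::real) ^ k"
  have "nearly_exhausted v z (enc s) k \<longleftrightarrow>
      real ((z * 2 ^ length s + binary_val s) * 2 ^ k) < real (mass v k * 2 ^ length s + 2 ^ k)"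
    unfolding nearly_exhausted_def of_nat_less_iff by simp
  also have "\<dots> \<longleftrightarrow> (real z * ?m + real (binary_val s)) * ?k < ?k * ?S * ?m + ?k"
    by (simp add: mass_eq)
  also have "\<dots> \<longleftrightarrow> (?m * ?k) * ?l < (?m * ?k) * ?S"
  proof -
    have "(?m * ?k) * ?l = (real z * ?m + real (binary_val s)) * ?k - ?k" by (simp add: field_simps)
    then show ?thesis by (simp add: algebra_simps)
  qed
  also have "\<dots> \<longleftrightarrow> ?l < ?S" by (subst mult_less_cancel_left_pos) auto
  finally show ?thesis .
qed

text \<open>\<open>real_restrict\<close> ignores the integer part, which \<open>z\<close> restores;
  truncation loses less than one unit of the last kept place. For \<open>i <= 0\<close> the string
  is empty and the bounds are those of the floor.\<close>

lemma Omega_prefix: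
  fixes i :: int
  assumes "prefix_free (dom V)"
  defines "z \<equiv> nat \<lfloor>Omega V\<rfloor>" and "s \<equiv> real_restrict (Omega V) i"
  shows "real z + real (binary_val s) / 2 ^ length s \<le> Omega V"
    and "Omega V < real z + real (binary_val s) / 2 ^ length s + 1 / 2 ^ length s"
proof -
  let ?m = "(2::real) ^ length s"
  have z: "real z = of_int \<lfloor>Omega V\<rfloor>" using Omega_bounds(3)[OF assms(1)] by (simp add: z_def)
  have "real (binary_val s) = of_int \<lfloor>?m * frac (Omega V)\<rfloor>"
    using binary_val_real_restrict[of "Omega V" i] unfolding s_def length_real_restrict
    by (metis of_int_of_nat_eq)
  then have "real (binary_val s) \<le> ?m * frac (Omega V)" "?m * frac (Omega V) < real (binary_val s) + 1"
    by linarith+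
  then have "real (binary_val s) / ?m \<le> frac (Omega V)" "frac (Omega V) < real (binary_val s) / ?m + 1 / ?m"
    by (simp_all add: field_simps)
  then show "real z + real (binary_val s) / ?m \<le> Omega V"
    "Omega V < real z + real (binary_val s) / ?m + 1 / ?m"
    unfolding z frac_def by linarith+
qed

lemma computable_nearly_exhausted:
  assumes v: "computable (\<lambda>p. v (pfst p) (psnd p))" and f: "computable f" and g: "computable g"
  shows "decidable (\<lambda>x. nearly_exhausted v z (f x) (g x))"
proof -
  have "computable (\<lambda>p. v (psnd p) (g (pfst p)))"
    using computable_comp[OF v, of "\<lambda>p. prod_encode (psnd p, g (pfst p))"]
    by (simp add: comp_intros computable_comp[OF g])
  then show ?thesis unfolding nearly_exhausted_def mass_def
    by (intro comp_intros f g computable_comp[OF g])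
qed

lemma bounded_imp_computes_dom:
  assumes V: "optimal_computer V" and W: "optimal_computer W" and f: "bdd_above (f ` {1..})"
  shows "\<exists>(M :: otm) (c :: nat). oracle_tm M \<and>
            (\<forall>n \<ge> 1. halts_with M {real_restrict (Omega V) (int n - int (f n) + int c)}
                        (binary_of_nat n) (encode_set (set_restrict (dom W) (int n))))"
proof -
  have cV: "computer V" "computer W" using V W by (auto simp: optimal_computer_def)
  then have pf: "prefix_free (dom V)" "prefix_free (dom W)" by (auto simp: computer_def)
  obtain v w where v: "approximates v V" and w: "approximates w W"
    using cV approximates_exists unfolding computer_def by blast
  have cv: "computable (\<lambda>p. v (pfst p) (psnd p))" and cw: "computable (\<lambda>p. w (pfst p) (psnd p))"
    using v w by (simp_all only: approximates_computable)
  text \<open>The output of this computer on \<open>p\<close> bounds the running time of \<open>W\<close> on \<open>p\<close>.\<close>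
  let ?t = "\<lambda>p. LEAST k. w (enc p) k \<noteq> 0"
  define C where "C x = (if \<exists>k. w (enc x) k \<noteq> 0 then Some (dec (?t x)) else None)" for x
  have "partial_recursive C"
    using search_partial_recursive[of "\<lambda>x k. w x k \<noteq> 0" "\<lambda>x k. k"] cw
    unfolding C_def by (simp add: comp_intros)
  moreover have dom: "dom C = dom W"
  proof (rule set_eqI)
    fix p
    have "p \<in> dom C \<longleftrightarrow> (\<exists>k. w (enc p) k \<noteq> 0)" by (simp add: C_def domIff)
    then show "p \<in> dom C \<longleftrightarrow> p \<in> dom W" unfolding approximates_dom[OF w] .
  qed
  ultimately have "computer C" using pf by (simp add: computer_def)
  then obtain d where d: "\<And>p. p \<in> dom C \<Longrightarrow> \<exists>q. V q = C p \<and> length q \<le> length p + d"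
    using V unfolding optimal_computer_def by blast
  obtain b where b: "\<And>n. n \<ge> 1 \<Longrightarrow> f n \<le> b" using f unfolding bdd_above_def by auto
  \<comment> \<open>A constant built into the machine, since the oracle string lacks the integer
    part.\<close>
  define z where "z = nat \<lfloor>Omega V\<rfloor>"
  \<comment> \<open>The sum replaces a maximum: it is at least each output code of a program of
    \<open>V\<close> found by stage \<open>k\<close>, and a larger bound does no harm because
    \<open>w\<close> keeps its values at later stages.\<close>
  let ?T = "\<lambda>k. \<Sum>q<k. v q k"
  \<comment> \<open>\<open>t\<close> pairs a candidate for the oracle string with a stage;
    \<open>a\<close> is the answer of the oracle.\<close>
  let ?P = "\<lambda>(x::nat) t a. a = 1 \<and> nearly_exhausted v z (pfst t) (psnd t)"
  let ?U = "\<lambda>x t. set_code w (val_code x) (?T (psnd t))"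
  have P: "decidable (\<lambda>p. ?P (pfst p) (pfst (psnd p)) (psnd (psnd p)))"
    by (intro comp_intros computable_nearly_exhausted cv)
  have "computable (\<lambda>p. v (psnd p) (psnd (psnd (pfst p))))"
    using computable_comp[OF cv, of "\<lambda>p. prod_encode (psnd p, psnd (psnd (pfst p)))"]
    by (simp add: comp_intros)
  then have U: "computable (\<lambda>p. ?U (pfst p) (psnd p))" by (intro comp_intros cw)
  obtain M where M: "oracle_tm M" "\<And>A x y. halts_with M A x y \<longleftrightarrow>
    (\<exists>t. ?P (enc x) t (of_bool (dec (pfst t) \<in> A) :: nat) \<and>
      (\<forall>i<t. \<not> ?P (enc x) i (of_bool (dec (pfst i) \<in> A) :: nat)) \<and> y = dec (?U (enc x) t))"
    using search_tm[OF P U] by blast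
  \<comment> \<open>\<open>b\<close> offsets \<open>f n\<close> and \<open>d\<close> is the overhead
    of \<open>V\<close> over \<open>C\<close>. The 1 is there because two errors of at most
    \<open>2^-m\<close> add up, \<open>m\<close> being the length of the oracle string: that of
    truncating \<open>Omega V\<close> and that allowed by \<open>nearly_exhausted\<close>.\<close>
  define c where "c = b + d + 1"
  have "halts_with M {real_restrict (Omega V) (int n - int (f n) + int c)} (binary_of_nat n)
      (encode_set (set_restrict (dom W) (int n)))" if n: "n \<ge> 1" for n
  proof -
    define s where "s = real_restrict (Omega V) (int n - int (f n) + int c)"
    have m: "n + d + 1 \<le> length s" using b[OF n] by (simp add: s_def c_def)
    note O = Omega_prefix[OF pf(1), of "int n - int (f n) + int c", folded z_def s_def]
    let ?R = "\<lambda>t. ?P (enc (binary_of_nat n)) t (of_bool (dec (pfst t) \<in> {s}) :: nat)"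
    obtain F where F: "finite F" "F \<subseteq> dom V" "Omega V - 1 / 2 ^ length s < (\<Sum>p\<in>F. (1/2) ^ length p)"
      using Omega_bounds(2)[OF pf(1), of "1 / 2 ^ length s"] by auto
    obtain k where "F \<subseteq> halted v k" using halted_exhausts[OF v F(1,2)] by blast
    then have "(\<Sum>p\<in>F. (1/2 :: real) ^ length p) \<le> (\<Sum>p\<in>halted v k. (1/2) ^ length p)"
      by (intro sum_mono2 finite_halted) auto
    then have "nearly_exhausted v z (enc s) k"
      unfolding nearly_exhausted_iff using F(3) O(1) by linarith
    then have "?R (prod_encode (enc s, k))" by simp
    then have "\<exists>t. ?R t" by blast
    then obtain t where t: "?R t" "\<forall>i<t. \<not> ?R i"
      using exists_least_iff[of ?R] by blast
    define k where "k = psnd t"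
    have "dec (pfst t) = s" using t(1) by (cases "dec (pfst t) = s") auto
    then have "pfst t = enc s" by (metis enc_dec)
    then have near: "nearly_exhausted v z (enc s) k" using t(1) by (simp add: k_def)
    \<comment> \<open>A program missed so far would add its weight to that of stage
      \<open>k\<close>, which is already closer than \<open>2^-(m-1)\<close> to
      \<open>Omega V\<close>, where \<open>m\<close> is the length of \<open>s\<close>; so it would
      be longer than \<open>m - 1\<close>, hence than \<open>n + d\<close>.\<close>
    have found: "q \<in> halted v k" if q: "q \<in> dom V" "length q \<le> n + d" for q
    proof (rule ccontr)
      assume q': "q \<notin> halted v k"
      have "(\<Sum>p\<in>insert q (halted v k). (1/2) ^ length p) \<le> Omega V"
        by (rule Omega_bounds(1)[OF pf(1)]) (use q finite_halted halted_subset[OF v] in auto)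
      then have "(1/2) ^ length q + (\<Sum>p\<in>halted v k. (1/2) ^ length p) \<le> Omega V"
        using q' finite_halted by simp
      then have "(1/2) ^ length q < 1 / 2 ^ length s + 1 / (2::real) ^ length s"
        using near[unfolded nearly_exhausted_iff] O(2) by linarith
      also have "\<dots> = (1/2) ^ (length s - 1)"
        using m by (cases "length s") (auto simp: power_one_over)
      finally have "length s - 1 < length q"
        by (simp add: power_strict_decreasing_iff)
      then show False using q m by simp
    qed
    have bound: "w (enc p) (?T k) \<noteq> 0" if p: "p \<in> dom W" "length p \<le> n" for p
    proof -
      have ex: "\<exists>k. w (enc p) k \<noteq> 0" using p approximates_dom[OF w] by blast
      then have tp: "w (enc p) (?t p) \<noteq> 0" by (rule LeastI_ex)
      have Cp: "C p = Some (dec (?t p))" using ex by (simp add: C_def)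
      then obtain q where q: "V q = Some (dec (?t p))" "length q \<le> length p + d"
        using d[of p] p(1) dom by auto
      then have "q \<in> halted v k" using found[of q] p(2) by auto
      then have q': "enc q < k" "v (enc q) k \<noteq> 0" by (auto simp: in_halted)
      then have "dec (v (enc q) k - 1) = dec (?t p)"
        using approximates_SomeD[OF v q'(2)] q(1) by simp
      then have "v (enc q) k - 1 = ?t p" by (metis enc_dec)
      moreover have "v (enc q) k \<le> ?T k" using q'(1) by (intro member_le_sum) auto
      ultimately have "?t p \<le> ?T k" by linarith
      then have "w (enc p) (?T k) = w (enc p) (?t p)" by (rule approximates_mono[OF w tp])
      then show ?thesis using tp by metis
    qed
    have "{p. length p \<le> n \<and> w (enc p) (?T k) \<noteq> 0} = set_restrict (dom W) (int n)"
      using bound approximates_SomeD[OF w] by (auto simp: set_restrict_def)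
    then have "dec (?U (enc (binary_of_nat n)) t) = encode_set (set_restrict (dom W) (int n))"
      by (simp add: set_code_correct binary_val_binary_of_nat k_def)
    then show ?thesis unfolding M(2) s_def[symmetric] using t by metis
  qed
  then show ?thesis using M(1) by blast
qed

section \<open>From the domain to bounded functions\<close>

lemma computable2:
  assumes "computable (\<lambda>p. g (pfst p) (psnd p))" and "computable a" and "computable b"
  shows "computable (\<lambda>x. g (a x) (b x))"
  using computable_comp[OF assms(1) computable_pair[OF assms(2,3)]] by simp

lemma computable3:
  assumes "computable (\<lambda>p. g (pfst p) (pfst (psnd p)) (psnd (psnd p)))"
    and "computable a" and "computable b" and "computable c"
  shows "computable (\<lambda>x. g (a x) (b x) (c x))"
  using computable_comp[OF assms(1) computable_pair[OF assms(2) computable_pair[OF assms(3,4)]]]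
  by simp

lemma computable_replicate [comp_intros]:
  assumes "computable f"
  shows "computable (\<lambda>x. enc (replicate (f x) True))"
proof -
  have "enc (replicate n True) = ((\<lambda>r. 2 * r + 2) ^^ n) 0" for n
  proof (induction n)
    case (Suc n)
    have "replicate (Suc n) True = replicate n True @ [True]" by (simp add: replicate_append_same)
    then show ?case using Suc by (simp del: replicate_Suc)
  qed simp
  then show ?thesis by (simp only:) (intro comp_intros assms)
qed

lemma unary_prefix_unique:
  "replicate i True @ False # a = replicate j True @ False # b \<Longrightarrow> i = j \<and> a = b"
proof (induction i arbitrary: j)
  case 0
  then show ?case by (cases j) auto
next
  case (Suc i)
  then show ?case by (cases j) auto
qed

lemma simulates_computable:
  "simulates sim M \<Longrightarrow> computable (\<lambda>p. sim (pfst p) (pfst (psnd p)) (psnd (psnd p)))"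
  unfolding simulates_def by (rule conjunct1)

lemma simulates_halts_with:
  "simulates sim M \<Longrightarrow> halts_with M (oracle_of w) x y \<longleftrightarrow> (\<exists>k. sim w (enc x) k = Suc (enc y))"
  unfolding simulates_def by (elim conjE) (drule spec, drule spec, erule spec)

lemma simulates_unique:
  assumes "simulates sim M" and "halts_with M (oracle_of w) x y" and "sim w (enc x) k = Suc u"
  shows "u = enc y"
proof -
  have "halts_with M (oracle_of w) x (dec u)"
    unfolding simulates_halts_with[OF assms(1)] using assms(3) by (intro exI[of _ k]) simp
  then have "dec u = y" by (rule halts_with_unique) (rule assms(2))
  then show ?thesis by auto
qed

text \<open>The tests of a search must be total, so \<open>f\<close> enters through stages:
  \<open>g n k\<close> is 0 while the machine for \<open>f\<close> has not been seen to halt, and it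
  never takes a wrong non-zero value.\<close>

lemma total_recursive_sim:
  assumes "total_recursive f"
  shows "\<exists>g. computable (\<lambda>p. g (pfst p) (psnd p)) \<and> (\<forall>n\<ge>1. \<exists>k. g n k \<noteq> 0) \<and>
    (\<forall>n\<ge>1. \<forall>k. g n k \<noteq> 0 \<longrightarrow> g n k = Suc (f n))"
proof -
  obtain M where M: "oracle_tm M" "\<And>n. n \<ge> 1 \<Longrightarrow> halts_with M (oracle_of 0) (binary_of_nat n) (binary_of_nat (f n))"
    using assms unfolding total_recursive_def by auto
  obtain sim where sim: "simulates sim M" using simulates_exists[OF M(1)] by blast
  define g where "g n k = (if sim 0 (nat_code n) k = 0 then 0 else Suc (val_code (sim 0 (nat_code n) k - 1)))" for n k
  have "computable (\<lambda>p. sim 0 (nat_code (pfst p)) (psnd p))"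
    by (intro computable3[OF simulates_computable[OF sim]] comp_intros)
  then have "computable (\<lambda>p. g (pfst p) (psnd p))"
    unfolding g_def by (intro comp_intros)
  moreover have "\<exists>k. g n k \<noteq> 0" if n: "n \<ge> 1" for n
  proof -
    obtain k where "sim 0 (enc (binary_of_nat n)) k = Suc (enc (binary_of_nat (f n)))"
      using M(2)[OF n] unfolding simulates_halts_with[OF sim] by blast
    then show ?thesis by (intro exI[of _ k]) (simp add: g_def enc_binary_of_nat[OF n])
  qed
  moreover have "g n k = Suc (f n)" if n: "n \<ge> 1" and g: "g n k \<noteq> 0" for n k
  proof -
    have "sim 0 (enc (binary_of_nat n)) k \<noteq> 0" using g by (simp add: g_def enc_binary_of_nat[OF n] split: if_splits)
    then obtain u where u: "sim 0 (enc (binary_of_nat n)) k = Suc u"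
      by (cases "sim 0 (enc (binary_of_nat n)) k") auto
    then have "u = enc (binary_of_nat (f n))" by (rule simulates_unique[OF sim M(2)[OF n]])
    then show ?thesis using u by (simp add: g_def binary_val_binary_of_nat flip: enc_binary_of_nat[OF n])
  qed
  ultimately show ?thesis by blast
qed

lemma finite_set_restrict: "finite (set_restrict S (int n))"
  by (rule finite_subset[OF _ finite_lists_length_le[of "UNIV :: bool set" n]])
    (auto simp: set_restrict_def)

lemma computes_dom_imp_bounded:
  assumes W: "optimal_computer W" and f: "total_recursive f" and M: "oracle_tm M"
    and halts: "\<And>n. n \<ge> 1 \<Longrightarrow> halts_with M {real_restrict (Omega V) (int n - int (f n) + int c)}
      (binary_of_nat n) (encode_set (set_restrict (dom W) (int n)))"
  shows "bdd_above (f ` {1..})"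
proof (rule ccontr)
  assume unbounded: "\<not> bdd_above (f ` {1..})"
  have "computer W" using W by (simp add: optimal_computer_def)
  then obtain w where w: "approximates w W"
    using approximates_exists unfolding computer_def by blast
  note cw = approximates_computable[OF w]
  obtain sim where sim: "simulates sim M" using simulates_exists[OF M] by blast
  obtain g where g: "computable (\<lambda>p. g (pfst p) (psnd p))" "\<And>n. n \<ge> 1 \<Longrightarrow> \<exists>k. g n k \<noteq> 0"
    "\<And>n k. n \<ge> 1 \<Longrightarrow> g n k \<noteq> 0 \<Longrightarrow> g n k = Suc (f n)"
    using total_recursive_sim[OF f] by blast
  text \<open>
    The number \<open>j\<close> determines the least pair \<open>e\<close>, and hence an argument \<open>n = pfst e\<close> such that
    \<open>n\<close> and \<open>f n\<close> are at least \<open>2 j\<close>. As \<open>n\<close> fixes the length of the oracle string,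
    the inputs \<open>1^j 0 s\<close> accepted below form a prefix-free set.
  \<close>
  define R where "R j e \<longleftrightarrow> 1 \<le> pfst e \<and> 2 * j \<le> pfst e \<and> 2 * j < g (pfst e) (psnd e)" for j e
  \<comment> \<open>\<open>t\<close> bundles all guesses: \<open>j\<close> and \<open>s\<close>
    parse the input, \<open>e\<close> is an argument with a stage for \<open>f\<close>,
    \<open>k\<close> bounds the run of the oracle machine, \<open>l\<close> is a stage for
    \<open>W\<close>. The equation with \<open>search_below\<close> makes \<open>e\<close> least. As
    \<open>g\<close> is \<open>Suc (f n)\<close>, the required length is \<open>n + c - f n\<close>,
    truncated at 0 just as in \<open>real_restrict\<close>. Whether \<open>s\<close> consists of
    bits of \<open>Omega V\<close> is not tested; prefix-freeness rests on its length.\<close>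
  define P where "P x t \<longleftrightarrow>
     (let j = pfst t; s = pfst (psnd t); e = pfst (psnd (psnd t)); k = pfst (psnd (psnd (psnd t)));
          l = psnd (psnd (psnd (psnd t)))
      in x = enc (dec (enc (replicate j True)) @ dec (enc (dec (enc [False]) @ dec s))) \<and>
         R j e \<and> search_below (R j) e = e \<and>
         length (dec s) = Suc (pfst e + c) - g (pfst e) (psnd e) \<and>
         sim (Suc s) (nat_code (pfst e)) k = Suc (set_code w (pfst e) l))" for x t
  \<comment> \<open>A non-zero value of \<open>w\<close> exceeds the output code by 1, so the sum
    over a range containing all codes of strings of length at most \<open>n\<close> exceeds each of
    their outputs found by stage \<open>l\<close>.\<close>
  define U where "U (x::nat) t =
    (\<Sum>i<2 ^ Suc (pfst (pfst (psnd (psnd t)))). w i (psnd (psnd (psnd (psnd t)))))" for x t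
  have R: "decidable (\<lambda>x. R (a x) (b x))" if "computable a" "computable b" for a b
    unfolding R_def by (intro comp_intros computable2[OF g(1)] that)
  have cP: "decidable (\<lambda>p. P (pfst p) (psnd p))"
    unfolding P_def Let_def
    by (intro decidable_conj decidable_eq R computable_search_below computable2[OF g(1)]
        computable3[OF simulates_computable[OF sim]] computable_set_code[OF cw] comp_intros)
  have cU: "computable (\<lambda>p. U (pfst p) (psnd p))"
    unfolding U_def by (intro computable_sum computable2[OF cw] comp_intros)
  define C where "C x = (if \<exists>t. P (enc x) t then Some (dec (U (enc x) (LEAST t. P (enc x) t))) else None)" for x
  have rec: "partial_recursive C"
    unfolding C_def by (rule search_partial_recursive[OF cP cU])
  have Pd: "\<exists>j s e k l. t = prod_encode (j, prod_encode (enc s, prod_encode (e, prod_encode (k, l)))) \<and>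
      x = replicate j True @ False # s \<and> R j e \<and> e = (LEAST e. R j e) \<and>
      length s = pfst e + c - f (pfst e) \<and>
      sim (Suc (enc s)) (enc (binary_of_nat (pfst e))) k = Suc (set_code w (pfst e) l)"
    if "P (enc x) t" for x t
  proof -
    define j where "j = pfst t"
    define s where "s = dec (pfst (psnd t))"
    define e where "e = pfst (psnd (psnd t))"
    define k where "k = pfst (psnd (psnd (psnd t)))"
    define l where "l = psnd (psnd (psnd (psnd t)))"
    have s': "pfst (psnd t) = enc s" by (simp add: s_def)
    have t: "t = prod_encode (j, prod_encode (enc s, prod_encode (e, prod_encode (k, l))))"
      by (simp add: j_def s_def e_def k_def l_def pfst_def psnd_def)
    have p: "enc x = enc (replicate j True @ [False] @ s)" "R j e" "search_below (R j) e = e"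
       "length s = Suc (pfst e + c) - g (pfst e) (psnd e)"
       "sim (Suc (enc s)) (nat_code (pfst e)) k = Suc (set_code w (pfst e) l)"
      using that unfolding P_def Let_def s' j_def[symmetric] e_def[symmetric] k_def[symmetric]
        l_def[symmetric] by (simp_all del: enc_inject)
    have e1: "1 \<le> pfst e" "g (pfst e) (psnd e) \<noteq> 0" using p(2) by (auto simp: R_def)
    have "e = (LEAST e. R j e)" using search_below_Least[of "R j" e e] p(2,3) by simp
    then show ?thesis using t p g(3)[OF e1] enc_binary_of_nat[OF e1(1)] by auto
  qed
  have Pi: "P (enc (replicate j True @ False # s))
      (prod_encode (j, prod_encode (enc s, prod_encode (e, prod_encode (k, l)))))"
    if "R j e" "e = (LEAST e. R j e)" "length s = pfst e + c - f (pfst e)"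
      "sim (Suc (enc s)) (enc (binary_of_nat (pfst e))) k = Suc (set_code w (pfst e) l)"
    for j s e k l
  proof -
    have e1: "1 \<le> pfst e" "g (pfst e) (psnd e) \<noteq> 0" using that(1) by (auto simp: R_def)
    have "search_below (R j) e = e" using search_below_Least[of "R j" e e] that(1,2) by simp
    moreover have "sim (Suc (enc s)) (nat_code (pfst e)) k = Suc (set_code w (pfst e) l)"
      using that(4) unfolding enc_binary_of_nat[OF e1(1)] .
    ultimately show ?thesis
      using that(1,3) g(3)[OF e1] unfolding P_def Let_def by simp
  qed
  have domC: "x \<in> dom C \<longleftrightarrow> (\<exists>t. P (enc x) t)" for x by (simp add: C_def domIff)
  have "prefix_free (dom C)"
    unfolding prefix_free_def
  proof (intro ballI impI)
    fix x y assume x: "x \<in> dom C" and y: "y \<in> dom C" and "prefix x y"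
    obtain i s d where 1: "x = replicate i True @ False # s" "d = (LEAST e. R i e)"
      "length s = pfst d + c - f (pfst d)"
      using x Pd unfolding domC by blast
    obtain j t e where 2: "y = replicate j True @ False # t" "e = (LEAST e. R j e)"
      "length t = pfst e + c - f (pfst e)"
      using y Pd unfolding domC by blast
    obtain z where z: "y = x @ z" using \<open>prefix x y\<close> by (auto elim: prefixE)
    then have "replicate i True @ False # (s @ z) = replicate j True @ False # t"
      using 1(1) 2(1) by simp
    then have "i = j" "t = s @ z" using unary_prefix_unique by blast+
    then have "length z = 0" using 1 2 by simp
    then show "x = y" using z by simp
  qed
  then have "computer C" using rec by (simp add: computer_def)
  then obtain d where d: "\<And>p. p \<in> dom C \<Longrightarrow> \<exists>q. W q = C p \<and> length q \<le> length p + d"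
    using W unfolding optimal_computer_def by blast
  \<comment> \<open>The input \<open>1^j 0 s\<close> and the overhead \<open>d\<close> have total
    length \<open>j + 1 + d + (n + c - f n)\<close>. Where the difference is not truncated,
    \<open>f n >= 2 * j\<close> brings this down to \<open>n\<close>; where it is truncated to 0,
    \<open>n >= 2 * j\<close> does.\<close>
  define j where "j = c + d + 1"
  have "\<exists>e. R j e"
  proof -
    \<comment> \<open>Unboundedness gives large values but not large arguments; exceeding the sum of
      all values on arguments up to \<open>2 * j\<close> rules those arguments out.\<close>
    obtain n where n: "n \<ge> 1" "2 * j + (\<Sum>i\<le>2 * j. f i) < f n"
      using unbounded unfolding bdd_above_def by (auto simp: not_le)
    have "2 * j < n"
    proof (rule ccontr)
      assume "\<not> 2 * j < n"
      then have "f n \<le> (\<Sum>i\<le>2 * j. f i)" by (intro member_le_sum) auto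
      then show False using n(2) by simp
    qed
    moreover obtain k where "g n k \<noteq> 0" using g(2)[OF n(1)] by blast
    then have "g n k = Suc (f n)" by (rule g(3)[OF n(1)])
    ultimately have "R j (prod_encode (n, k))" using n by (simp add: R_def)
    then show ?thesis by (rule exI)
  qed
  define e where "e = (LEAST e. R j e)"
  have e: "R j e" unfolding e_def using \<open>\<exists>e. R j e\<close> by (rule LeastI_ex)
  define n where "n = pfst e"
  \<comment> \<open>The single condition \<open>2 * j < g (pfst e) (psnd e)\<close> in
    \<open>R\<close> says both that the stage suffices, \<open>g\<close> being non-zero, and that
    \<open>2 * j <= f n\<close>.\<close>
  have n: "1 \<le> n" "2 * j \<le> n" "2 * j \<le> f n"
    using e g(3)[of n "psnd e"] by (auto simp: R_def n_def)
  define s where "s = real_restrict (Omega V) (int n - int (f n) + int c)"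
  have len: "length s = n + c - f n" unfolding s_def length_real_restrict by linarith
  let ?D = "set_restrict (dom W) (int n)"
  let ?S = "\<lambda>l. {p. length p \<le> n \<and> w (enc p) l \<noteq> 0}"
  have h: "halts_with M (oracle_of (Suc (enc s))) (binary_of_nat n) (encode_set ?D)"
    using halts[OF n(1)] by (simp add: s_def)
  have sub: "?S l \<subseteq> ?D" for l
    using approximates_SomeD[OF w] by (auto simp: set_restrict_def)
  obtain k where k: "sim (Suc (enc s)) (enc (binary_of_nat n)) k = Suc (enc (encode_set ?D))"
    using h unfolding simulates_halts_with[OF sim] by blast
  obtain l where l: "?D \<subseteq> halted w l"
    using halted_exhausts[OF w finite_set_restrict] by (metis (no_types, lifting) mem_Collect_eq set_restrict_def subsetI)
  have "?D \<subseteq> ?S l"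
  proof
    fix p assume "p \<in> ?D"
    then show "p \<in> ?S l" using l by (auto simp: set_restrict_def in_halted)
  qed
  then have "?S l = ?D" using sub by blast
  then have "sim (Suc (enc s)) (enc (binary_of_nat n)) k = Suc (set_code w n l)"
    using k by (simp add: set_code_correct)
  then have ex: "\<exists>t. P (enc (replicate j True @ False # s)) t"
    using Pi[OF e e_def, of s k l] len unfolding n_def by blast
  define x where "x = replicate j True @ False # s"
  define t where "t = (LEAST t. P (enc x) t)"
  have Pt: "P (enc x) t" unfolding t_def x_def using ex by (rule LeastI_ex)
  \<comment> \<open>The least witness may differ from the one just built, but the input determines
    \<open>i\<close> and \<open>s'\<close>, hence \<open>e'\<close>; and the output of a halting run
    is unique, so at stage \<open>l'\<close> again exactly the programs in \<open>?D\<close> have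
    been found among those of length at most \<open>n\<close>.\<close>
  obtain i s' e' k' l' where t: "t = prod_encode (i, prod_encode (enc s', prod_encode (e', prod_encode (k', l'))))"
    "x = replicate i True @ False # s'" "e' = (LEAST e. R i e)"
    "sim (Suc (enc s')) (enc (binary_of_nat (pfst e'))) k' = Suc (set_code w (pfst e') l')"
    using Pd[OF Pt] by blast
  have "i = j" "s' = s" using t(2) unary_prefix_unique unfolding x_def by blast+
  then have e': "e' = e" using t(3) by (simp add: e_def)
  have "set_code w n l' = enc (encode_set ?D)"
    using simulates_unique[OF sim h] t(4) \<open>s' = s\<close> e' by (simp add: n_def)
  then have "encode_set (?S l') = encode_set ?D" by (simp add: set_code_correct)
  then have S: "?S l' = ?D" using encode_set_subset_eq[OF finite_set_restrict sub] by blast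
  have Cx: "C x = Some (dec (\<Sum>i<2 ^ Suc n. w i l'))"
    using Pt unfolding C_def t_def[symmetric] by (auto simp: U_def t(1) e' n_def)
  then obtain q where q: "W q = Some (dec (\<Sum>i<2 ^ Suc n. w i l'))" "length q \<le> length x + d"
    using d[of x] by auto
  have "length x + d \<le> n" using n by (simp add: x_def len j_def)
  then have "q \<in> ?D" using q by (auto simp: set_restrict_def)
  then have q': "length q \<le> n" "w (enc q) l' \<noteq> 0" using S by blast+
  \<comment> \<open>The output code of \<open>q\<close> would be the whole sum, while the summand
    belonging to \<open>q\<close> is already that code plus 1.\<close>
  have "dec (w (enc q) l' - 1) = dec (\<Sum>i<2 ^ Suc n. w i l')"
    using approximates_SomeD[OF w q'(2)] q(1) by simp
  then have "w (enc q) l' - 1 = (\<Sum>i<2 ^ Suc n. w i l')" by (metis enc_dec)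
  moreover have "w (enc q) l' \<le> (\<Sum>i<2 ^ Suc n. w i l')"
    using q'(1) unfolding length_le_iff by (intro member_le_sum) auto
  ultimately show False using q'(2) by linarith
qed

theorem theorem5p4:
  fixes V W :: "bool list \<rightharpoonup> bool list" and f :: "nat \<Rightarrow> nat"
  assumes "optimal_computer V" and "optimal_computer W" and "total_recursive f"
  shows "(\<exists>(M :: otm) (c :: nat). oracle_tm M \<and>
            (\<forall>n \<ge> 1. halts_with M {real_restrict (Omega V) (int n - int (f n) + int c)}
                        (binary_of_nat n) (encode_set (set_restrict (dom W) (int n)))))
         \<longleftrightarrow> bdd_above (f ` {1..})"
proof
  assume "\<exists>(M :: otm) (c :: nat). oracle_tm M \<and>
            (\<forall>n \<ge> 1. halts_with M {real_restrict (Omega V) (int n - int (f n) + int c)}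
                        (binary_of_nat n) (encode_set (set_restrict (dom W) (int n))))"
  then obtain M :: otm and c :: nat where "oracle_tm M" and
    "\<And>n. n \<ge> 1 \<Longrightarrow> halts_with M {real_restrict (Omega V) (int n - int (f n) + int c)}
      (binary_of_nat n) (encode_set (set_restrict (dom W) (int n)))" by blast
  then show "bdd_above (f ` {1..})" by (rule computes_dom_imp_bounded[OF assms(2,3)])
qed (rule bounded_imp_computes_dom[OF assms(1,2)])

end
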